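(* Let $C$ be a compact convex subset of $\mathbb{R}^n$. Let $f:C\to\mathbb{R}$ be a function, and let $\{P^{m}_{y}\}_{y\in C, m\in \mathbb{N}}$ be a compatible family of polynomials for $C^{\infty}$ extension of $f$. Then $f$ has a convex extension $F$ of class $C^{\infty}$ to all of $\mathbb{R}^n$, with $J^{m}_{y}F=P^{m}_{y}$ for every $y\in C$ and $m\in\mathbb{N}$, if and only if $\{P^{m}_{y}\}_{y\in C}$ satisfies $(W^{m})$ on $C$ and $(CW^{m})$ on $C$ for every $m\in \mathbb{N}$, $m\geq 2$. Moreover, if $C$ has nonempty interior and $f:C\to\mathbb{R}$ is convex, then $f$ has a convex extension $F$ of class $C^{\infty}$ to all of $\mathbb{R}^n$, with $J^{m}_{y}F=P^{m}_{y}$ for every $y\in C$ and $m\in\mathbb{N}$, if and only if $\{P^{m}_{y}\}_{y\in C}$ satisfies $(W^{m})$ on $C$ and $(CW^{m})$ on $\partial C$ for every $m\in \mathbb{N}$, $m\geq 2$.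
   Context: $\mathbb{S}^{n-1}$ is the Euclidean unit sphere of $\mathbb{R}^n$. $D^jP(y)$ denotes the $j$-th derivative of $P$ at $y$ as a symmetric $j$-linear form, with $\|A\|=\sup_{u_i\in\mathbb{S}^{n-1}}|A(u_1,\ldots,u_j)|$; $D^{k}P(y)(w^{k-2},v^2)$ means this form evaluated with $w$ repeated $k-2$ times and $v$ repeated twice. $J^m_yF$ is the Taylor polynomial of order $m$ of $F$ at $y$. Compatible family for $C^\infty$ extension of $f:C\to\mathbb{R}$: a family of polynomials $P^m_y:\mathbb{R}^n\to\mathbb{R}$ of degree at most $m$ ($y\in C$) such that $P^m_y(y)=f(y)$ for all $y,m$ and, for every $k>j$, $P^j_y$ is the Taylor polynomial of order $j$ at $y$ of $P^k_y$. Condition $(W^m)$ on $C$ (Whitney): for each compact $K\subset C$, $\lim_{\delta\to0^+}\rho_m(K,\delta)=0$, where $$\rho_m(K,\delta)=\sup\left\{\frac{\|D^jP^m_y(z)-D^jP^m_z(z)\|}{|y-z|^{m-j}}: j=0,\ldots,m,\ y,z\in K,\ 0<|y-z|\le\delta\right\}$$ (supremum over the empty set being $0$). Condition $(CW^m)$ on a set $S\subseteq C$ ($m\ge2$): for every $\varepsilon>0$ there exists $t_\varepsilon>0$ such that $$D^2P^{m}_{y}(y)(v^2)+ t\, D^3P^{m}_{y}(y)(w,v^2)+ \cdots + \frac{t^{m-2}}{(m-2)!} D^{m}P^{m}_{y}(y)(w^{m-2},v^2) \geq -\varepsilon t^{m-2}$$ for all $y\in S$, $v,w\in\mathbb{S}^{n-1}$,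 $0<t\le t_\varepsilon$. *)

theory Defs
  imports "HOL-Analysis.Analysis"
begin

text \<open>
  \<open>dform F y [u1, ..., uj]\<close> is \<open>D^j F(y)(u1, ..., uj)\<close>, the \<open>j\<close>-th derivative as a \<open>j\<close>-linear
  form: the derivative at \<open>y\<close> in direction \<open>u1\<close> of \<open>z \<mapsto> D^(j-1) F(z)(u2, ..., uj)\<close>.  The order \<open>j\<close>
  is the length of the list.
\<close>
primrec dform :: "('a::real_normed_vector \<Rightarrow> real) \<Rightarrow> 'a \<Rightarrow> 'a list \<Rightarrow> real" where
  "dform F y [] = F y"
| "dform F y (u # us) = frechet_derivative (\<lambda>z. dform F z us) (at y) u"

definition form_norm :: "nat \<Rightarrow> ('a::real_normed_vector list \<Rightarrow> real) \<Rightarrow> real" where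
  "form_norm j A = (SUP us \<in> {us. length us = j \<and> set us \<subseteq> sphere 0 1}. \<bar>A us\<bar>)"

text \<open>
  In finite dimension, differentiability and continuity of \<open>y \<mapsto> D^j F(y)\<close> for the operator norm
  amount to the same for \<open>y \<mapsto> D^j F(y)(us)\<close>, for each fixed list \<open>us\<close> of \<open>j\<close> directions.
\<close>
definition class_C :: "nat \<Rightarrow> (real^'n \<Rightarrow> real) \<Rightarrow> bool" where
  "class_C k F \<longleftrightarrow>
     (\<forall>us. length us < k \<longrightarrow> (\<lambda>y. dform F y us) differentiable_on UNIV) \<and>
     (\<forall>us. length us \<le> k \<longrightarrow> continuous_on UNIV (\<lambda>y. dform F y us))"

definition class_C_infinity :: "(real^'n \<Rightarrow> real) \<Rightarrow> bool" where
  "class_C_infinity F \<longleftrightarrow> (\<forall>k. class_C k F)"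

definition taylor_poly :: "nat \<Rightarrow> 'a::real_normed_vector \<Rightarrow> ('a \<Rightarrow> real) \<Rightarrow> 'a \<Rightarrow> real" where
  "taylor_poly m y F = (\<lambda>x. \<Sum>j\<le>m. dform F y (replicate j (x - y)) / fact j)"

definition polynomial_of_degree_le :: "nat \<Rightarrow> (real^'n \<Rightarrow> real) \<Rightarrow> bool" where
  "polynomial_of_degree_le m p \<longleftrightarrow>
     (\<exists>c. \<forall>x. p x = (\<Sum>\<alpha> \<in> {\<alpha> :: 'n \<Rightarrow> nat. (\<Sum>i\<in>UNIV. \<alpha> i) \<le> m}. c \<alpha> * (\<Prod>i\<in>UNIV. (x $ i) ^ \<alpha> i)))"

text \<open>
  Throughout, \<open>P m y\<close> is the polynomial \<open>P^m_y\<close>; it and \<open>f y\<close> are constrained only for \<open>y \<in> C\<close>.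
\<close>
definition compatible_family ::
  "(real^'n) set \<Rightarrow> (real^'n \<Rightarrow> real) \<Rightarrow> (nat \<Rightarrow> real^'n \<Rightarrow> real^'n \<Rightarrow> real) \<Rightarrow> bool" where
  "compatible_family C f P \<longleftrightarrow>
     (\<forall>m. \<forall>y\<in>C. polynomial_of_degree_le m (P m y)) \<and>
     (\<forall>m. \<forall>y\<in>C. P m y y = f y) \<and>
     (\<forall>j k. j < k \<longrightarrow> (\<forall>y\<in>C. P j y = taylor_poly j y (P k y)))"

text \<open>
  The supremum is taken in \<^typ>\<open>ennreal\<close>, since it may be infinite; there the supremum of the
  empty set is \<open>0\<close>.
\<close>
definition rho ::
  "(nat \<Rightarrow> real^'n \<Rightarrow> real^'n \<Rightarrow> real) \<Rightarrow> nat \<Rightarrow> (real^'n) set \<Rightarrow> real \<Rightarrow> ennreal" where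
  "rho P m K \<delta> = Sup {ennreal (form_norm j (\<lambda>us. dform (P m y) z us - dform (P m z) z us)
                                 / norm (y - z) ^ (m - j)) | j y z.
                        j \<le> m \<and> y \<in> K \<and> z \<in> K \<and> 0 < norm (y - z) \<and> norm (y - z) \<le> \<delta>}"

definition cond_W ::
  "(nat \<Rightarrow> real^'n \<Rightarrow> real^'n \<Rightarrow> real) \<Rightarrow> nat \<Rightarrow> (real^'n) set \<Rightarrow> bool" where
  "cond_W P m C \<longleftrightarrow> (\<forall>K. compact K \<and> K \<subseteq> C \<longrightarrow> ((\<lambda>\<delta>. rho P m K \<delta>) \<longlongrightarrow> 0) (at_right 0))"

text \<open>Meaningful for \<open>m \<ge> 2\<close> only.\<close>
definition cond_CW ::
  "(nat \<Rightarrow> real^'n \<Rightarrow> real^'n \<Rightarrow> real) \<Rightarrow> nat \<Rightarrow> (real^'n) set \<Rightarrow> bool" where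
  "cond_CW P m S \<longleftrightarrow>
     (\<forall>\<epsilon>>0. \<exists>t\<^sub>\<epsilon>>0. \<forall>y\<in>S. \<forall>v\<in>sphere 0 1. \<forall>w\<in>sphere 0 1. \<forall>t. 0 < t \<and> t \<le> t\<^sub>\<epsilon> \<longrightarrow>
        (\<Sum>k = 2..m. t ^ (k - 2) / fact (k - 2) * dform (P m y) y (replicate (k - 2) w @ [v, v]))
          \<ge> - \<epsilon> * t ^ (m - 2))"

definition has_convex_smooth_extension ::
  "(real^'n) set \<Rightarrow> (real^'n \<Rightarrow> real) \<Rightarrow> (nat \<Rightarrow> real^'n \<Rightarrow> real^'n \<Rightarrow> real) \<Rightarrow> bool" where
  "has_convex_smooth_extension C f P \<longleftrightarrow>
     (\<exists>F. convex_on UNIV F \<and> class_C_infinity F \<and> (\<forall>y\<in>C. F y = f y) \<and>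
          (\<forall>m. \<forall>y\<in>C. taylor_poly m y F = P m y))"

end

theory Submission
  imports Defs
begin

text \<open>
  The conditions are necessary because both are Taylor formulas.  If \<open>F\<close> is an extension, then
  \<open>D^j P^m_y(z) - D^j P^m_z(z)\<close> is minus the remainder of order \<open>m - j\<close> of \<open>D^j F\<close> between the
  points \<open>y\<close> and \<open>z\<close> of \<open>C\<close>, which gives \<open>(W^m)\<close>; and the sum in \<open>(CW^m)\<close> is the Taylor polynomial
  of \<open>t \<mapsto> D^2F(y + tw)(v^2)\<close>, a function that convexity makes nonnegative
  (\<open>extension_imp_cond_W\<close>, \<open>extension_imp_cond_CW\<close>).

  For sufficiency, the jet is first extended to a smooth, compactly supported and in general
  nonconvex \<open>F\<close>, and then a convex function is added that is flat on \<open>C\<close> and bends upwards off \<open>C\<close>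
  enough to repair convexity.

  The extension (\<open>whitney_extension\<close>) uses the nearest point map \<open>\<pi>\<close> of \<open>C\<close>, which is 1-Lipschitz.
  At scale \<open>2^-k\<close> the polynomials \<open>P^m_\<pi>(q)\<close> are glued, over the points \<open>q\<close> of \<open>2^-k \<int>^n\<close> near \<open>C\<close>,
  by a partition of unity into a smooth function \<open>F_k\<close>, with a degree \<open>m = \<mu>(k)\<close> that tends to infinity
  slowly.  By \<open>(W^m)\<close> the derivative of order \<open>j\<close> of \<open>F_k\<close> differs from that of \<open>P^m_\<pi>(x)\<close>, at a
  point \<open>x\<close> within distance of order \<open>2^-k\<close> of \<open>C\<close>, by a multiple of \<open>2^(-k(m - j))\<close>, up to powers of
  \<open>2^k\<close> that do not depend on \<open>m\<close>.  Hence \<open>F = F_k0 + \<Sum>\<^sub>k \<chi>_k (F_(k+1) - F_k)\<close>, with cutoffs \<open>\<chi>_k\<close> that are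
  \<open>1\<close> near \<open>C\<close> and live at distance of order \<open>2^-k\<close>, converges with all derivatives on the whole space,
  and on \<open>C\<close> the sum telescopes to the limit of the jets of the \<open>F_k\<close>.

  The convex correction (\<open>convexifier_exists\<close>) is a series of functions \<open>g(2^k (w \<bullet> x - h(w)))\<close>,
  where \<open>h\<close> is the support function of \<open>C\<close> and \<open>g\<close> is smooth and convex, vanishes on the negative half
  line and is strictly convex on the positive one.  Each term is convex and vanishes on \<open>C\<close> with all
  its derivatives.  A point of a given ball at distance at least \<open>2^-k\<close> from \<open>C\<close> is separated from \<open>C\<close> by a
  half-space, and the vectors \<open>w\<close> of a fine lattice near its normal span all directions, so the terms
  of index \<open>k\<close> together have a second derivative bounded below there by a constant independent of \<open>k\<close>.
  The coefficient of index \<open>k\<close> is proportional to the convexity defect of \<open>F\<close> at distance at most \<open>2 \<cdot> 2^-k\<close>.  It is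
  smaller than every power of \<open>2^-k\<close>: a point \<open>x\<close> off \<open>C\<close> is \<open>y + tw\<close> with \<open>y = \<pi>(x)\<close> on the
  frontier of \<open>C\<close> and \<open>t\<close> the distance, and \<open>(CW^m)\<close> at \<open>y\<close> bounds \<open>D^2F(x)(v^2)\<close> below by a multiple of
  \<open>-t^(m-2)\<close>.  This is where only frontier points matter (\<open>convex_extension_exists\<close>).
\<close>

section \<open>Smooth functions and their derivatives\<close>

text \<open>
  Agrees with \<open>class_C_infinity\<close>, continuity of the derivatives being automatic, and makes sense on
  every normed space; the scalar functions below live on \<open>real\<close>.
\<close>
definition smooth :: "('a::real_normed_vector \<Rightarrow> real) \<Rightarrow> bool" where
  "smooth F \<longleftrightarrow> (\<forall>us x. (\<lambda>y. dform F y us) differentiable (at x))"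

lemma dform_append: "dform F y (us @ vs) = dform (\<lambda>z. dform F z vs) y us"
  by (induction us arbitrary: y) simp_all

text \<open>
  Derivatives are handled through the rules below; unfolding them to \<open>frechet_derivative\<close> would
  destroy the list of directions.
\<close>
declare dform.simps(2) [simp del]

lemma smooth_dform: "smooth F \<Longrightarrow> smooth (\<lambda>z. dform F z vs)"
  unfolding smooth_def by (simp flip: dform_append)

lemma dform_has_derivative:
  assumes "smooth F"
  shows "((\<lambda>z. dform F z us) has_derivative (\<lambda>u. dform F x (u # us))) (at x)"
  using assms unfolding smooth_def by (simp add: dform.simps(2) flip: frechet_derivative_works)

text \<open>
  The principle by which the derivatives of every construction below are computed: whoever guesses the whole
  hierarchy of derivatives has only to check that each level differentiates to the next, and
  obtains smoothness together with the formula.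
\<close>
lemma dform_eqI:
  assumes D0: "\<And>x. D x [] = F x"
    and DS: "\<And>us x. ((\<lambda>z. D z us) has_derivative (\<lambda>u. D x (u # us))) (at x)"
  shows "smooth F" and "dform F x us = D x us"
proof -
  have *: "(\<lambda>x. dform F x us) = (\<lambda>x. D x us)" for us
  proof (induction us)
    case (Cons u us)
    have "frechet_derivative (\<lambda>z. D z us) (at x) = (\<lambda>u. D x (u # us))" for x
      using frechet_derivative_at[OF DS] by simp
    then show ?case using Cons by (simp add: dform.simps(2))
  qed (simp add: D0)
  show "dform F x us = D x us" using *[of us] by meson
  show "smooth F" unfolding smooth_def * using DS differentiable_def by blast
qed

lemma smooth_continuous: "smooth F \<Longrightarrow> continuous_on S (\<lambda>x. dform F x us)"
  by (intro continuous_at_imp_continuous_on ballI has_derivative_continuous[OF dform_has_derivative])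

lemma smooth_imp_class_C_infinity:
  assumes "smooth F" shows "class_C_infinity F"
  using assms smooth_continuous[OF assms]
  unfolding class_C_infinity_def class_C_def smooth_def differentiable_on_def
  by (simp add: differentiable_at_withinI)

lemma class_C_infinity_imp_smooth: "class_C_infinity F \<Longrightarrow> smooth F"
  unfolding class_C_infinity_def class_C_def smooth_def differentiable_on_def
  by (metis UNIV_I lessI)

lemma dform_cong_open:
  assumes "open U" "x \<in> U" "\<And>y. y \<in> U \<Longrightarrow> F y = G y"
  shows "dform F x us = dform G x us"
  using assms(2)
proof (induction us arbitrary: x)
  case (Cons u us)
  have "(((\<lambda>z. dform F z us) has_derivative D) (at x)) = (((\<lambda>z. dform G z us) has_derivative D) (at x))" for D
    using has_derivative_transform_within_open[of "\<lambda>z. dform F z us" D x UNIV U "\<lambda>z. dform G z us"]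
      has_derivative_transform_within_open[of "\<lambda>z. dform G z us" D x UNIV U "\<lambda>z. dform F z us"]
      assms(1) Cons by auto
  then show ?case by (simp add: dform.simps(2) frechet_derivative_def)
qed (use assms in simp)

section \<open>Rules of differentiation\<close>

lemma
  fixes x :: "'a::real_normed_vector"
  shows smooth_const: "smooth (\<lambda>x::'a. c)"
    and dform_const: "dform (\<lambda>x. c) x us = (if us = [] then c else 0)"
  by (rule dform_eqI(1)[of "\<lambda>x us. if us = [] then c else 0"]; simp)
    (rule dform_eqI(2)[of "\<lambda>x us. if us = [] then c else 0" "\<lambda>x. c"]; simp)

lemma assumes "smooth F" "smooth G"
  shows smooth_add: "smooth (\<lambda>x. F x + G x)"
    and dform_add: "dform (\<lambda>x. F x + G x) x us = dform F x us + dform G x us"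
  by (rule dform_eqI(1)[of "\<lambda>x us. dform F x us + dform G x us"]; auto intro!: has_derivative_add dform_has_derivative assms)
    (rule dform_eqI(2)[of "\<lambda>x us. dform F x us + dform G x us" "\<lambda>x. F x + G x"]; auto intro!: has_derivative_add dform_has_derivative assms)

lemma assumes "\<And>i. i \<in> I \<Longrightarrow> smooth (F i)"
  shows smooth_sum: "smooth (\<lambda>x. \<Sum>i\<in>I. F i x)"
    and dform_sum: "dform (\<lambda>x. \<Sum>i\<in>I. F i x) x us = (\<Sum>i\<in>I. dform (F i) x us)"
  by (rule dform_eqI(1)[of "\<lambda>x us. \<Sum>i\<in>I. dform (F i) x us"]; auto intro!: has_derivative_sum dform_has_derivative assms)
    (rule dform_eqI(2)[of "\<lambda>x us. \<Sum>i\<in>I. dform (F i) x us" "\<lambda>x. \<Sum>i\<in>I. F i x"]; auto intro!: has_derivative_sum dform_has_derivative assms)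

text \<open>
  The terms of the Leibniz rule: every way to deal out the directions to the two factors.
\<close>
primrec splits :: "'a list \<Rightarrow> ('a list \<times> 'a list) list" where
  "splits [] = [([], [])]"
| "splits (u # us) = map (apfst (Cons u)) (splits us) @ map (apsnd (Cons u)) (splits us)"

lemma has_derivative_sum_list:
  "(\<And>p. p \<in> set ps \<Longrightarrow> (f p has_derivative f' p) F) \<Longrightarrow>
   ((\<lambda>x. \<Sum>p\<leftarrow>ps. f p x) has_derivative (\<lambda>h. \<Sum>p\<leftarrow>ps. f' p h)) F"
  by (induction ps) (auto intro!: has_derivative_add)

lemma length_splits: "length (splits us) = 2 ^ length us"
  by (induction us) auto

lemma assumes "smooth F" "smooth G"
  shows smooth_mult: "smooth (\<lambda>x. F x * G x)"
    and dform_mult: "dform (\<lambda>x. F x * G x) x us = (\<Sum>p\<leftarrow>splits us. dform F x (fst p) * dform G x (snd p))"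
proof -
  let ?D = "\<lambda>x us. \<Sum>p\<leftarrow>splits us. dform F x (fst p) * dform G x (snd p)"
  have "((\<lambda>z. ?D z us) has_derivative (\<lambda>u. ?D x (u # us))) (at x)" for us x
  proof -
    have "((\<lambda>z. ?D z us) has_derivative (\<lambda>h. \<Sum>p\<leftarrow>splits us.
        dform F x (fst p) * dform G x (h # snd p) + dform F x (h # fst p) * dform G x (snd p))) (at x)"
      by (intro has_derivative_sum_list has_derivative_mult dform_has_derivative assms)
    then show ?thesis
      by (simp add: o_def sum_list_addf add.commute)
  qed
  then show "smooth (\<lambda>x. F x * G x)" "dform (\<lambda>x. F x * G x) x us = ?D x us" for x us
    using dform_eqI[of ?D "\<lambda>x. F x * G x"] by auto
qed

lemma smooth_prod: "(\<And>i. i \<in> I \<Longrightarrow> smooth (F i)) \<Longrightarrow> smooth (\<lambda>x. \<Prod>i\<in>I. F i x)"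
  by (induction I rule: infinite_finite_induct) (auto intro: smooth_const smooth_mult)

lemma smooth_power: "smooth F \<Longrightarrow> smooth (\<lambda>x. F x ^ n)"
  by (induction n) (auto intro: smooth_const smooth_mult)

lemma assumes "smooth F"
  shows smooth_cmult: "smooth (\<lambda>x. c * F x)"
    and dform_cmult: "dform (\<lambda>x. c * F x) x us = c * dform F x us"
  by (rule dform_eqI(1)[of "\<lambda>x us. c * dform F x us"]; auto intro!: has_derivative_mult_right dform_has_derivative assms)
    (rule dform_eqI(2)[of "\<lambda>x us. c * dform F x us" "\<lambda>x. c * F x"]; auto intro!: has_derivative_mult_right dform_has_derivative assms)

lemma assumes "smooth F" "smooth G"
  shows smooth_diff: "smooth (\<lambda>x. F x - G x)"
    and dform_diff: "dform (\<lambda>x. F x - G x) x us = dform F x us - dform G x us"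
  by (rule dform_eqI(1)[of "\<lambda>x us. dform F x us - dform G x us"]; auto intro!: has_derivative_diff dform_has_derivative assms)
    (rule dform_eqI(2)[of "\<lambda>x us. dform F x us - dform G x us" "\<lambda>x. F x - G x"]; auto intro!: has_derivative_diff dform_has_derivative assms)

text \<open>
  An affine substitution acts on the directions alone; this covers both rescaling and functions of
  one linear functional.
\<close>
lemma assumes "smooth G" "bounded_linear A"
  shows smooth_affine: "smooth (\<lambda>x. G (A x + c))"
    and dform_affine: "dform (\<lambda>x. G (A x + c)) x us = dform G (A x + c) (map A us)"
proof -
  have A: "((\<lambda>x. A x + c) has_derivative A) (at x)" for x
    using has_derivative_add_const[OF bounded_linear_imp_has_derivative[OF assms(2)]] .
  have "((\<lambda>x. dform G (A x + c) (map A us)) has_derivative (\<lambda>u. dform G (A x + c) (map A (u # us)))) (at x)" for us x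
    using has_derivative_compose[OF A dform_has_derivative[OF assms(1)]] by simp
  then show "smooth (\<lambda>x. G (A x + c))" "dform (\<lambda>x. G (A x + c)) x us = dform G (A x + c) (map A us)" for x us
    using dform_eqI[of "\<lambda>x us. dform G (A x + c) (map A us)" "\<lambda>x. G (A x + c)"] by auto
qed

lemma smooth_id: "smooth (\<lambda>t::real. t)"
proof -
  let ?D = "\<lambda>t us. case us of [] \<Rightarrow> t | [u] \<Rightarrow> u | _ \<Rightarrow> (0::real)"
  have "((\<lambda>t. ?D t us) has_derivative (\<lambda>u. ?D t (u # us))) (at t)" for us t
    by (cases us; cases "tl us") (auto intro!: derivative_eq_intros)
  then show ?thesis using dform_eqI(1)[of ?D "\<lambda>t. t"] by auto
qed

lemma smooth_bounded_linear: "bounded_linear A \<Longrightarrow> smooth A"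
  using smooth_affine[OF smooth_id, of A 0] by simp

text \<open>
  The innermost direction of a list belongs to the first differentiation, so on the real line it
  enters as a scalar factor in front of the derivatives of \<open>f\<close>.
\<close>
lemma smooth_primitive:
  fixes F f :: "real \<Rightarrow> real"
  assumes F: "\<And>t. (F has_real_derivative f t) (at t)" and f: "smooth f"
  shows "smooth F" and "dform F t (us @ [u]) = u * dform f t us"
proof -
  let ?D = "\<lambda>t us. if us = [] then F t else last us * dform f t (butlast us)"
  have "((\<lambda>t. ?D t us) has_derivative (\<lambda>u. ?D t (u # us))) (at t)" for us t
    using F[of t] dform_has_derivative[OF f, of "butlast us" t]
    by (cases "us = []") (auto simp: has_field_derivative_def intro!: derivative_eq_intros elim!: has_derivative_eq_rhs)
  from dform_eqI[of ?D F, OF _ this]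
  show "smooth F" "dform F t (us @ [u]) = u * dform f t us" by auto
qed

lemma polynomial_smooth: "polynomial_of_degree_le m p \<Longrightarrow> smooth p"
proof -
  assume "polynomial_of_degree_le m p"
  then obtain c where "\<And>x. p x = (\<Sum>\<alpha> \<in> {\<alpha> :: 'a \<Rightarrow> nat. (\<Sum>i\<in>UNIV. \<alpha> i) \<le> m}. c \<alpha> * (\<Prod>i\<in>UNIV. (x $ i) ^ \<alpha> i))"
    unfolding polynomial_of_degree_le_def by auto
  then have "p = (\<lambda>x. \<Sum>\<alpha> \<in> {\<alpha> :: 'a \<Rightarrow> nat. (\<Sum>i\<in>UNIV. \<alpha> i) \<le> m}. c \<alpha> * (\<Prod>i\<in>UNIV. (x $ i) ^ \<alpha> i))" by auto
  then show ?thesis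
    by (simp add: smooth_sum smooth_cmult smooth_prod smooth_power smooth_bounded_linear[OF bounded_linear_vec_nth])
qed

section \<open>Symmetry and multilinearity of the derivatives\<close>

lemma linear_dform_first: "smooth F \<Longrightarrow> linear (\<lambda>u. dform F x (u # us))"
  using dform_has_derivative has_derivative_linear by blast

lemma dform_line_derivative:
  assumes "smooth F"
  shows "((\<lambda>t. dform F (x + t *\<^sub>R u) us) has_real_derivative dform F (x + t *\<^sub>R u) (u # us)) (at t)"
proof -
  have "((\<lambda>t. x + t *\<^sub>R u) has_derivative (\<lambda>h. h *\<^sub>R u)) (at t)"
    by (auto intro!: derivative_eq_intros)
  from has_derivative_compose[OF this dform_has_derivative[OF assms]]
  show ?thesis unfolding has_field_derivative_def
    by (simp add: linear_cmul[OF linear_dform_first[OF assms]] mult.commute[of _ "dform _ _ _"] )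
qed

text \<open>
  The mean value theorem is applied to the second difference first in the direction \<open>u\<close> and then
  in the direction \<open>v\<close>.  The second difference is symmetric in \<open>u\<close> and \<open>v\<close>, which is the source of
  the symmetry of the second derivative.
\<close>
lemma second_difference_mvt:
  assumes "smooth F" "0 < h"
  shows "\<exists>s t. 0 < s \<and> s < h \<and> 0 < t \<and> t < h \<and>
     F (x + h *\<^sub>R u + h *\<^sub>R v) - F (x + h *\<^sub>R u) - F (x + h *\<^sub>R v) + F x
       = h * h * dform F (x + s *\<^sub>R u + t *\<^sub>R v) [v, u]"
proof -
  let ?p = "\<lambda>s. F (x + h *\<^sub>R v + s *\<^sub>R u) - F (x + s *\<^sub>R u)"
  have "(?p has_real_derivative (dform F (x + h *\<^sub>R v + s *\<^sub>R u) [u] - dform F (x + s *\<^sub>R u) [u])) (at s)" for s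
    using dform_line_derivative[OF assms(1), of _ _ "[]"] by (auto intro!: derivative_eq_intros)
  from MVT2[OF assms(2), of ?p, OF this] obtain s where s: "0 < s" "s < h"
    "?p h - ?p 0 = h * (dform F (x + h *\<^sub>R v + s *\<^sub>R u) [u] - dform F (x + s *\<^sub>R u) [u])" by auto
  from MVT2[OF assms(2), of "\<lambda>t. dform F (x + s *\<^sub>R u + t *\<^sub>R v) [u]", OF dform_line_derivative[OF assms(1)]]
  obtain t where t: "0 < t" "t < h" "dform F (x + s *\<^sub>R u + h *\<^sub>R v) [u] - dform F (x + s *\<^sub>R u) [u]
     = h * dform F (x + s *\<^sub>R u + t *\<^sub>R v) [v, u]" by auto
  have "F (x + h *\<^sub>R u + h *\<^sub>R v) - F (x + h *\<^sub>R u) - F (x + h *\<^sub>R v) + F x = ?p h - ?p 0"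
    by (simp add: algebra_simps)
  also have "\<dots> = h * (dform F (x + s *\<^sub>R u + h *\<^sub>R v) [u] - dform F (x + s *\<^sub>R u) [u])"
    using s(3) by (simp add: add_ac)
  also have "\<dots> = h * h * dform F (x + s *\<^sub>R u + t *\<^sub>R v) [v, u]"
    by (simp only: t(3) mult.assoc)
  finally show ?thesis using s t by blast
qed

text \<open>
  Both mixed derivatives take a common value at two points as close to \<open>x\<close> as desired, and both
  are continuous at \<open>x\<close>.
\<close>
lemma dform_swap2:
  assumes "smooth F"
  shows "dform F x [u, v] = dform F x [v, u]"
proof -
  define N where "N = norm u + norm v + 1"
  have N: "N > 0" by (simp add: N_def add_nonneg_pos)
  have "\<bar>dform F x [u, v] - dform F x [v, u]\<bar> < e" if "e > 0" for e
  proof -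
    obtain d where d: "d > 0" "\<And>z us. us = [u,v] \<or> us = [v,u] \<Longrightarrow> dist z x < d \<Longrightarrow> \<bar>dform F z us - dform F x us\<bar> < e/2"
    proof -
      have "\<forall>us. \<exists>d>0. \<forall>z. dist z x < d \<longrightarrow> \<bar>dform F z us - dform F x us\<bar> < e/2"
      proof
        fix us
        have "continuous (at x) (\<lambda>z. dform F z us)"
          using dform_has_derivative[OF assms] has_derivative_continuous by blast
        then show "\<exists>d>0. \<forall>z. dist z x < d \<longrightarrow> \<bar>dform F z us - dform F x us\<bar> < e/2"
          using \<open>e > 0\<close> unfolding continuous_at_eps_delta by (auto simp: dist_real_def dest!: spec[of _ "e/2"])
      qed
      then obtain dd where dd: "\<And>us. dd us > 0" "\<And>us z. dist z x < dd us \<Longrightarrow> \<bar>dform F z us - dform F x us\<bar> < e/2"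
        by metis
      show ?thesis
        by (rule that[of "min (dd [u,v]) (dd [v,u])"]) (use dd in auto)
    qed
    \<comment> \<open>The points that \<open>second_difference_mvt\<close> provides for the step size \<open>h\<close> stay within \<open>d\<close> of \<open>x\<close>.\<close>
    define h where "h = d / N"
    have h: "h > 0" "h * N = d" using d N by (auto simp: h_def)
    have close: "dist (x + s *\<^sub>R a + t *\<^sub>R b) x < d" if "0 < s" "s < h" "0 < t" "t < h" "norm a + norm b < N" for s t a b
    proof -
      have "dist (x + s *\<^sub>R a + t *\<^sub>R b) x \<le> s * norm a + t * norm b"
        using that norm_triangle_ineq[of "s *\<^sub>R a" "t *\<^sub>R b"] by (simp add: dist_norm)
      also have "\<dots> \<le> h * (norm a + norm b)"
        using that by (simp add: distrib_left add_mono mult_right_mono)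
      also have "\<dots> < d" using that h by (metis mult_strict_left_mono)
      finally show ?thesis .
    qed
    obtain s t where 1: "0 < s" "s < h" "0 < t" "t < h" "F (x + h *\<^sub>R u + h *\<^sub>R v) - F (x + h *\<^sub>R u) - F (x + h *\<^sub>R v) + F x
       = h * h * dform F (x + s *\<^sub>R u + t *\<^sub>R v) [v, u]" using second_difference_mvt[OF assms h(1)] by blast
    obtain s' t' where 2: "0 < s'" "s' < h" "0 < t'" "t' < h" "F (x + h *\<^sub>R v + h *\<^sub>R u) - F (x + h *\<^sub>R v) - F (x + h *\<^sub>R u) + F x
       = h * h * dform F (x + s' *\<^sub>R v + t' *\<^sub>R u) [u, v]" using second_difference_mvt[OF assms h(1)] by blast
    have "h * h * dform F (x + s *\<^sub>R u + t *\<^sub>R v) [v, u] = h * h * dform F (x + s' *\<^sub>R v + t' *\<^sub>R u) [u, v]"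
      unfolding 1(5)[symmetric] 2(5)[symmetric] by (simp add: algebra_simps)
    then have "dform F (x + s *\<^sub>R u + t *\<^sub>R v) [v, u] = dform F (x + s' *\<^sub>R v + t' *\<^sub>R u) [u, v]"
      using h(1) by simp
    moreover have "\<bar>dform F (x + s *\<^sub>R u + t *\<^sub>R v) [v, u] - dform F x [v, u]\<bar> < e/2"
      by (intro d(2) close 1) (auto simp: N_def)
    moreover have "\<bar>dform F (x + s' *\<^sub>R v + t' *\<^sub>R u) [u, v] - dform F x [u, v]\<bar> < e/2"
      by (intro d(2) close 2) (auto simp: N_def)
    ultimately show ?thesis by linarith
  qed
  from this[of "\<bar>dform F x [u, v] - dform F x [v, u]\<bar>"] show ?thesis by linarith
qed

lemma dform_swap:
  assumes "smooth F" shows "dform F x (u # v # us) = dform F x (v # u # us)"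
  using dform_swap2[OF smooth_dform[OF assms, of us], of x u v] by (simp flip: dform_append)

lemma dform_to_front:
  assumes "smooth F" shows "dform F x (as @ u # bs) = dform F x (u # as @ bs)"
proof (induction as arbitrary: x)
  case (Cons a as)
  have "(\<lambda>z. dform F z (as @ u # bs)) = (\<lambda>z. dform F z (u # as @ bs))"
    using Cons.IH by (intro ext)
  then have "dform F x ((a # as) @ u # bs) = dform F x (a # u # as @ bs)"
    using dform_append[of F x "[a]" "as @ u # bs"] dform_append[of F x "[a]" "u # as @ bs"] by simp
  then show ?case using dform_swap[OF assms] by simp
qed simp

lemma linear_dform:
  assumes "smooth F" shows "linear (\<lambda>u. dform F x (as @ u # bs))"
  unfolding dform_to_front[OF assms] by (rule linear_dform_first[OF assms])

lemma dform_basis_expansion: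
  fixes F :: "'a::euclidean_space \<Rightarrow> real"
  assumes "smooth F" shows "dform F x (as @ u # bs) = (\<Sum>b\<in>Basis. (u \<bullet> b) * dform F x (as @ b # bs))"
proof -
  have "dform F x (as @ u # bs) = dform F x (as @ (\<Sum>b\<in>Basis. (u \<bullet> b) *\<^sub>R b) # bs)"
    by (simp only: euclidean_representation)
  also have "\<dots> = (\<Sum>b\<in>Basis. (u \<bullet> b) * dform F x (as @ b # bs))"
    using linear_sum[OF linear_dform[OF assms, of x as bs], of "\<lambda>b. (u \<bullet> b) *\<^sub>R b" Basis]
      linear_cmul[OF linear_dform[OF assms, of x as bs]] by simp
  finally show ?thesis .
qed

lemma dform_rotate:
  assumes "smooth F" shows "dform F x (as @ bs) = dform F x (bs @ as)"
proof (induction as arbitrary: x)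
  case (Cons a as)
  have "(\<lambda>z. dform F z (as @ bs)) = (\<lambda>z. dform F z (bs @ as))"
    using Cons.IH by (intro ext)
  then have "dform F x ((a # as) @ bs) = dform F x (a # bs @ as)"
    using dform_append[of F x "[a]"] by simp
  then show ?case using dform_to_front[OF assms] by simp
qed simp

section \<open>Taylor polynomials\<close>

text \<open>
  The derivative of a homogeneous form along the diagonal.  One copy of \<open>x - y\<close> is expanded in the
  basis, which leaves linear functions of \<open>x\<close> times forms with one copy fewer; by symmetry the
  \<open>i\<close> copies contribute equally.
\<close>
lemma has_derivative_dform_replicate:
  fixes Q :: "'a::euclidean_space \<Rightarrow> real"
  assumes "smooth Q"
  shows "((\<lambda>x. dform Q y (us @ replicate i (x - y))) has_derivative
     (\<lambda>u. real i * dform Q y (u # us @ replicate (i - 1) (x - y)))) (at x)"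
proof (induction i arbitrary: us)
  case (Suc i)
  let ?w = "x - y"
  have eq: "dform Q y (us @ replicate (Suc i) w) = (\<Sum>b\<in>Basis. (w \<bullet> b) * dform Q y ((b # us) @ replicate i w))" for w
    using dform_to_front[OF assms, of y us w "replicate i w"]
      dform_basis_expansion[OF assms, of y "[]" w "us @ replicate i w"] by simp
  have front: "real i * dform Q y (u # ?w # us @ replicate (i - 1) ?w) = real i * dform Q y (u # us @ replicate i ?w)" for u
    using dform_to_front[OF assms, of y "u # us" ?w "replicate (i - 1) ?w"] dform_swap[OF assms, of y u ?w]
    by (cases i) auto
  have "((\<lambda>x. \<Sum>b\<in>Basis. ((x - y) \<bullet> b) * dform Q y ((b # us) @ replicate i (x - y))) has_derivative
    (\<lambda>u. \<Sum>b\<in>Basis. (?w \<bullet> b) * (real i * dform Q y (u # (b # us) @ replicate (i - 1) ?w))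
        + (u \<bullet> b) * dform Q y ((b # us) @ replicate i ?w))) (at x)"
    by (intro has_derivative_sum has_derivative_mult Suc.IH) (auto intro!: derivative_eq_intros)
  moreover have "(\<Sum>b\<in>Basis. (?w \<bullet> b) * (real i * dform Q y (u # (b # us) @ replicate (i - 1) ?w))
        + (u \<bullet> b) * dform Q y ((b # us) @ replicate i ?w)) = real (Suc i) * dform Q y (u # us @ replicate i ?w)" for u
  proof -
    have "(\<Sum>b\<in>Basis. (?w \<bullet> b) * (real i * dform Q y (u # (b # us) @ replicate (i - 1) ?w)))
      = real i * dform Q y (u # ?w # us @ replicate (i - 1) ?w)"
      using dform_basis_expansion[OF assms, of y "[u]" ?w "us @ replicate (i - 1) ?w"]
      by (simp add: sum_distrib_left mult.left_commute)
    moreover have "(\<Sum>b\<in>Basis. (u \<bullet> b) * dform Q y ((b # us) @ replicate i ?w)) = dform Q y (u # us @ replicate i ?w)"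
      using dform_basis_expansion[OF assms, of y "[]" u "us @ replicate i ?w"] by simp
    ultimately show ?thesis
      by (simp only: sum.distrib front) (simp add: algebra_simps)
  qed
  ultimately show ?case unfolding eq by simp
qed simp

text \<open>
  Differentiating a Taylor polynomial of \<open>Q\<close> gives the Taylor polynomial of the derivative of \<open>Q\<close>,
  of correspondingly smaller order.
\<close>
lemma
  fixes Q :: "'a::euclidean_space \<Rightarrow> real"
  assumes Q: "smooth Q"
  shows dform_taylor_poly_ge: "length us > m \<Longrightarrow> dform (taylor_poly m y Q) x us = 0"
    and dform_taylor_poly_le: "length us \<le> m \<Longrightarrow>
       dform (taylor_poly m y Q) x us = (\<Sum>i\<le>m - length us. dform Q y (us @ replicate i (x - y)) / fact i)"
proof -
  let ?q = "\<lambda>i x. dform Q y (replicate i (x - y)) / fact i"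
  let ?D = "\<lambda>i x us. if length us \<le> i
     then dform Q y (us @ replicate (i - length us) (x - y)) / fact (i - length us) else 0"
  have D: "((\<lambda>z. ?D i z us) has_derivative (\<lambda>u. ?D i x (u # us))) (at x)" for i x us
  proof (cases "length us < i")
    case True
    then obtain k where k: "i - length us = Suc k" by (metis Suc_diff_Suc)
    then have k': "i - Suc (length us) = k" by simp
    have "((\<lambda>z. dform Q y (us @ replicate (Suc k) (z - y)) / fact (Suc k)) has_derivative
        (\<lambda>u. real (Suc k) * dform Q y (u # us @ replicate (Suc k - 1) (x - y)) / fact (Suc k))) (at x)"
      unfolding divide_inverse by (intro has_derivative_mult_left has_derivative_dform_replicate Q)
    moreover have "real (Suc k) * c / fact (Suc k) = c / fact k" for c :: real
      by (simp add: divide_simps)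
    ultimately show ?thesis
      using True k k' by (simp del: fact_Suc of_nat_Suc replicate_Suc)
  next
    case False
    then show ?thesis by (cases "length us = i") auto
  qed
  have q: "smooth (?q i)" "dform (?q i) x us = ?D i x us" for i x us
    using dform_eqI[of "?D i" "?q i", OF _ D] by auto
  have *: "dform (taylor_poly m y Q) x us = (\<Sum>i\<le>m. ?D i x us)"
    unfolding taylor_poly_def dform_sum[OF q(1)] q(2) ..
  show "dform (taylor_poly m y Q) x us = 0" if "length us > m"
    unfolding * using that by (intro sum.neutral) auto
  show "dform (taylor_poly m y Q) x us = (\<Sum>i\<le>m - length us. dform Q y (us @ replicate i (x - y)) / fact i)"
    if "length us \<le> m"
  proof -
    have "(\<Sum>i\<le>m. ?D i x us) = (\<Sum>i\<in>{length us..m}. ?D i x us)"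
      by (rule sum.mono_neutral_right) auto
    also have "\<dots> = (\<Sum>i\<le>m - length us. dform Q y (us @ replicate i (x - y)) / fact i)"
      by (rule sum.reindex_bij_witness[of _ "\<lambda>i. i + length us" "\<lambda>i. i - length us"]) (use that in auto)
    finally show ?thesis using * by simp
  qed
qed

lemma dform_replicate_zero:
  assumes "smooth F" shows "dform F y (us @ replicate i 0) = (if i = 0 then dform F y us else 0)"
  using linear_0[OF linear_dform[OF assms, of y us "replicate (i - 1) 0"]] by (cases i) auto

lemma dform_taylor_poly_center:
  fixes Q :: "'a::euclidean_space \<Rightarrow> real"
  assumes "smooth Q" "length us \<le> m"
  shows "dform (taylor_poly m y Q) y us = dform Q y us"
  unfolding dform_taylor_poly_le[OF assms] by (simp add: dform_replicate_zero[OF assms(1)] if_distrib[of "\<lambda>a. a / _"] cong: if_cong)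

section \<open>Bounds for derivatives\<close>

abbreviation norm_prod :: "'a::real_normed_vector list \<Rightarrow> real" where
  "norm_prod us \<equiv> prod_list (map norm us)"

text \<open>
  A bound \<open>B\<close> for the norm of \<open>D^j F(x)\<close>, in the homogeneous form that survives products,
  substitutions and repeated directions.
\<close>
definition dbound :: "('a::real_normed_vector \<Rightarrow> real) \<Rightarrow> 'a \<Rightarrow> nat \<Rightarrow> real \<Rightarrow> bool" where
  "dbound F x j B \<longleftrightarrow> (\<forall>us. length us = j \<longrightarrow> \<bar>dform F x us\<bar> \<le> B * norm_prod us)"

lemma norm_prod_nonneg: "0 \<le> norm_prod us"
  by (induction us) auto

lemma norm_prod_replicate: "norm_prod (replicate i w) = norm w ^ i"
  by (induction i) auto

lemma dboundD: "dbound F x (length us) B \<Longrightarrow> \<bar>dform F x us\<bar> \<le> B * norm_prod us"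
  unfolding dbound_def by blast

lemma dbound_mono: "dbound F x j B \<Longrightarrow> B \<le> B' \<Longrightarrow> dbound F x j B'"
  unfolding dbound_def using mult_right_mono[OF _ norm_prod_nonneg] order_trans by blast

lemma dbound_cong: "open U \<Longrightarrow> x \<in> U \<Longrightarrow> (\<And>y. y \<in> U \<Longrightarrow> F y = G y) \<Longrightarrow> dbound F x j B \<longleftrightarrow> dbound G x j B"
  unfolding dbound_def using dform_cong_open[of U x F G] by auto

lemma dbound_add: "smooth F \<Longrightarrow> smooth G \<Longrightarrow> dbound F x j A \<Longrightarrow> dbound G x j B \<Longrightarrow> dbound (\<lambda>x. F x + G x) x j (A + B)"
  unfolding dbound_def dform_add by (smt (verit, best) distrib_right)

lemma dbound_diff: "smooth F \<Longrightarrow> smooth G \<Longrightarrow> dbound F x j A \<Longrightarrow> dbound G x j B \<Longrightarrow> dbound (\<lambda>x. F x - G x) x j (A + B)"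
  unfolding dbound_def dform_diff by (smt (verit, best) distrib_right)

lemma dbound_cmult: "smooth F \<Longrightarrow> dbound F x j A \<Longrightarrow> dbound (\<lambda>x. c * F x) x j (\<bar>c\<bar> * A)"
  unfolding dbound_def by (simp add: dform_cmult abs_mult mult_left_mono mult.assoc)

lemma dbound_sum:
  assumes "\<And>i. i \<in> I \<Longrightarrow> smooth (F i)" "\<And>i. i \<in> I \<Longrightarrow> dbound (F i) x j (B i)"
  shows "dbound (\<lambda>x. \<Sum>i\<in>I. F i x) x j (\<Sum>i\<in>I. B i)"
  unfolding dbound_def
proof (intro allI impI)
  fix us :: "'b list" assume us: "length us = j"
  have "\<bar>dform (\<lambda>x. \<Sum>i\<in>I. F i x) x us\<bar> \<le> (\<Sum>i\<in>I. \<bar>dform (F i) x us\<bar>)"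
    by (simp add: dform_sum assms(1) sum_abs)
  also have "\<dots> \<le> (\<Sum>i\<in>I. B i * norm_prod us)"
    using assms(2) us by (intro sum_mono) (auto simp: dbound_def)
  finally show "\<bar>dform (\<lambda>x. \<Sum>i\<in>I. F i x) x us\<bar> \<le> (\<Sum>i\<in>I. B i) * norm_prod us"
    by (simp add: sum_distrib_right)
qed

lemma splits_props:
  assumes "p \<in> set (splits us)"
  shows "length (fst p) + length (snd p) = length us" "norm_prod (fst p) * norm_prod (snd p) = norm_prod us"
  using assms by (induction us arbitrary: p) (fastforce simp: mult.assoc mult.left_commute)+

text \<open>
  The Leibniz rule has \<open>2^j\<close> terms, and in each of them the orders of the two derivatives add up to
  \<open>j\<close>.
\<close>
lemma dbound_mult:
  assumes "smooth F" "smooth G" and F: "\<And>i. i \<le> j \<Longrightarrow> dbound F x i (A i)" and G: "\<And>i. i \<le> j \<Longrightarrow> dbound G x i (B i)"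
    and M: "\<And>i. i \<le> j \<Longrightarrow> A i * B (j - i) \<le> M" and "\<And>i. i \<le> j \<Longrightarrow> A i \<ge> 0"
  shows "dbound (\<lambda>x. F x * G x) x j (2 ^ j * M)"
  unfolding dbound_def
proof (intro allI impI)
  fix us :: "'a list" assume us: "length us = j"
  have "\<bar>dform F x (fst p) * dform G x (snd p)\<bar> \<le> M * norm_prod us" if p: "p \<in> set (splits us)" for p
  proof -
    have len: "length (fst p) \<le> j" "length (snd p) = j - length (fst p)" "length (snd p) \<le> j"
      using splits_props(1)[OF p] us by auto
    have "\<bar>dform F x (fst p) * dform G x (snd p)\<bar>
       \<le> (A (length (fst p)) * norm_prod (fst p)) * (B (length (snd p)) * norm_prod (snd p))"
      unfolding abs_mult using len assms(6)
      by (intro mult_mono dboundD F G) (auto simp: norm_prod_nonneg)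
    also have "\<dots> = A (length (fst p)) * B (j - length (fst p)) * norm_prod us"
      using splits_props(2)[OF p] len by (simp add: mult_ac)
    also have "\<dots> \<le> M * norm_prod us"
      using M[OF len(1)] by (simp add: mult_right_mono norm_prod_nonneg)
    finally show ?thesis .
  qed
  then have "(\<Sum>p\<leftarrow>splits us. \<bar>dform F x (fst p) * dform G x (snd p)\<bar>) \<le> (\<Sum>p\<leftarrow>splits us. M * norm_prod us)"
    by (intro sum_list_mono)
  moreover have "\<bar>\<Sum>p\<leftarrow>splits us. dform F x (fst p) * dform G x (snd p)\<bar> \<le> (\<Sum>p\<leftarrow>splits us. \<bar>dform F x (fst p) * dform G x (snd p)\<bar>)"
    using sum_list_abs[of "map (\<lambda>p. dform F x (fst p) * dform G x (snd p)) (splits us)"] by (simp add: o_def)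
  ultimately show "\<bar>dform (\<lambda>x. F x * G x) x us\<bar> \<le> 2 ^ j * M * norm_prod us"
    using us by (simp add: dform_mult[OF assms(1,2)] sum_list_triv length_splits)
qed

lemma dbound_affine:
  assumes "smooth G" "bounded_linear A" and s: "\<And>u. norm (A u) \<le> s * norm u" "s \<ge> 0" and "dbound G (A x + c) j B" "B \<ge> 0"
  shows "dbound (\<lambda>x. G (A x + c)) x j (B * s ^ j)"
  unfolding dbound_def
proof (intro allI impI)
  fix us :: "'b list" assume us: "length us = j"
  have "norm_prod (map A us) \<le> s ^ length us * norm_prod us"
  proof (induction us)
    case (Cons u us)
    have "norm (A u) * norm_prod (map A us) \<le> (s * norm u) * (s ^ length us * norm_prod us)"
      by (intro mult_mono s Cons.IH mult_nonneg_nonneg norm_prod_nonneg norm_ge_zero)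
    then show ?case by (simp add: mult_ac)
  qed simp
  then have "B * norm_prod (map A us) \<le> B * (s ^ j * norm_prod us)"
    using assms(6) us by (simp add: mult_left_mono)
  then show "\<bar>dform (\<lambda>x. G (A x + c)) x us\<bar> \<le> B * s ^ j * norm_prod us"
    using dboundD[of G "A x + c" "map A us" B] assms(5) us
    by (simp add: dform_affine[OF assms(1,2)] mult.assoc)
qed

text \<open>
  The directions are normalised one after another, using linearity in each position.
\<close>
lemma dbound_unitI:
  assumes F: "smooth F" and B: "\<And>us. length us = j \<Longrightarrow> set us \<subseteq> sphere 0 1 \<Longrightarrow> \<bar>dform F x us\<bar> \<le> B"
  shows "dbound F x j B"
proof -
  have "length vs + length us = j \<Longrightarrow> set vs \<subseteq> sphere 0 1 \<Longrightarrow> \<bar>dform F x (vs @ us)\<bar> \<le> B * norm_prod us" for vs us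
  proof (induction us arbitrary: vs)
    case (Cons u us)
    interpret linear "\<lambda>u. dform F x (vs @ u # us)" by (rule linear_dform[OF F])
    show ?case
    proof (cases "u = 0")
      case False
      have "dform F x (vs @ u # us) = norm u * dform F x ((vs @ [u /\<^sub>R norm u]) @ us)"
        using scale[of "norm u" "u /\<^sub>R norm u"] False by simp
      moreover have "\<bar>dform F x ((vs @ [u /\<^sub>R norm u]) @ us)\<bar> \<le> B * norm_prod us"
        using Cons.prems False by (intro Cons.IH) auto
      ultimately show ?thesis
        using mult_left_mono[of "\<bar>dform F x ((vs @ [u /\<^sub>R norm u]) @ us)\<bar>" "B * norm_prod us" "norm u"]
        by (simp add: abs_mult mult.left_commute)
    qed (use zero in auto)
  qed (use B in auto)
  from this[of "[]"] show ?thesis unfolding dbound_def by auto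
qed

text \<open>
  Only finitely many functions have to be bounded: by linearity the innermost direction can be
  taken from the basis, and then the induction hypothesis applies to a partial derivative of \<open>F\<close>.
\<close>
lemma dbound_compact:
  fixes F :: "'a::euclidean_space \<Rightarrow> real"
  assumes "smooth F" "compact K"
  shows "\<exists>B\<ge>0. \<forall>x\<in>K. dbound F x j B"
  using assms(1)
proof (induction j arbitrary: F)
  case 0
  have "bounded (F ` K)"
    using smooth_continuous[OF 0, of K "[]"] assms(2) compact_continuous_image compact_imp_bounded by auto
  then obtain B where "B > 0" "\<And>x. x \<in> K \<Longrightarrow> \<bar>F x\<bar> \<le> B"
    unfolding bounded_pos by auto
  then show ?case by (auto simp: dbound_def intro!: exI[of _ B])
next
  case (Suc j)
  have "\<forall>b. \<exists>B\<ge>0. \<forall>x\<in>K. dbound (\<lambda>z. dform F z [b]) x j B"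
    using Suc.IH smooth_dform[OF Suc.prems] by blast
  then obtain B where B: "\<And>b. B b \<ge> 0" "\<And>b x. x \<in> K \<Longrightarrow> dbound (\<lambda>z. dform F z [b]) x j (B b)"
    by metis
  have "dbound F x (Suc j) (\<Sum>b\<in>Basis. B b)" if x: "x \<in> K" for x
    unfolding dbound_def
  proof (intro allI impI)
    fix us :: "'a list" assume us: "length us = Suc j"
    then obtain vs u where vs: "us = vs @ [u]" "length vs = j" by (metis length_Suc_conv_rev)
    have "\<bar>dform F x us\<bar> \<le> (\<Sum>b\<in>Basis. \<bar>(u \<bullet> b) * dform F x (vs @ [b])\<bar>)"
      unfolding vs dform_basis_expansion[OF Suc.prems, of x vs u "[]"] by (rule sum_abs)
    also have "\<dots> \<le> (\<Sum>b\<in>Basis. norm u * (B b * norm_prod vs))"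
      unfolding abs_mult dform_append
      using B(2)[OF x] vs(2) by (intro sum_mono mult_mono) (auto simp: Basis_le_norm dbound_def)
    also have "\<dots> = (\<Sum>b\<in>Basis. B b) * norm_prod us"
      by (simp add: vs sum_distrib_left sum_distrib_right mult_ac)
    finally show "\<bar>dform F x us\<bar> \<le> (\<Sum>b\<in>Basis. B b) * norm_prod us" .
  qed
  then show ?case using B(1) by (meson sum_nonneg)
qed

lemma dbound_compact_support:
  fixes F :: "'a::euclidean_space \<Rightarrow> real"
  assumes "smooth F" "compact K" "\<And>x. x \<notin> K \<Longrightarrow> F x = 0"
  shows "\<exists>B\<ge>0. \<forall>x. dbound F x j B"
proof -
  obtain B where B: "B \<ge> 0" "\<And>x. x \<in> K \<Longrightarrow> dbound F x j B"
    using dbound_compact[OF assms(1,2)] by blast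
  have "dbound F x j B" if "x \<notin> K" for x
  proof -
    have "dform F x us = 0" for us
      using dform_cong_open[of "- K" x F "\<lambda>_. 0" us] that assms(2,3) by (auto simp: compact_imp_closed dform_const open_Compl)
    then show ?thesis using B(1) by (simp add: dbound_def norm_prod_nonneg)
  qed
  then show ?thesis using B by blast
qed

text \<open>
  The one-dimensional Taylor theorem for \<open>t \<mapsto> D^|us| F(y + t(x - y))(us)\<close> on \<open>[0, 1]\<close>.  The
  factorial in the remainder is estimated by \<open>1\<close>, since constants never matter below.
\<close>
lemma taylor_remainder:
  assumes F: "smooth F" and B: "\<And>z. z \<in> closed_segment y x \<Longrightarrow> dbound F z (Suc m + length us) B"
  shows "\<bar>dform F x us - (\<Sum>i\<le>m. dform F y (us @ replicate i (x - y)) / fact i)\<bar> \<le> B * norm_prod us * norm (x - y) ^ Suc m"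
proof -
  let ?w = "x - y"
  let ?d = "\<lambda>i t. dform F (y + t *\<^sub>R ?w) (replicate i ?w @ us)"
  have "\<exists>t. (if (1::real) < 0 then 1 < t \<and> t < 0 else 0 < t \<and> t < (1::real)) \<and>
    ?d 0 1 = (\<Sum>i<Suc m. (?d i 0 / fact i) * (1 - 0)^i) + (?d (Suc m) t / fact (Suc m)) * (1 - 0)^Suc m"
    by (rule Taylor[where n = "Suc m" and diff = ?d and f = "?d 0" and a = 0 and b = 1 and c = 0 and x = 1]) (auto simp: dform_line_derivative[OF F])
  then obtain t where t: "0 < t" "t < 1"
    "dform F x us = (\<Sum>i<Suc m. ?d i 0 / fact i) + ?d (Suc m) t / fact (Suc m)"
    by auto
  have "(\<Sum>i<Suc m. ?d i 0 / fact i) = (\<Sum>i\<le>m. dform F y (us @ replicate i ?w) / fact i)"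
    unfolding lessThan_Suc_atMost dform_rotate[OF F, of _ us] by simp
  moreover have "\<bar>?d (Suc m) t / fact (Suc m)\<bar> \<le> B * norm_prod us * norm ?w ^ Suc m"
  proof -
    have "y + t *\<^sub>R ?w \<in> closed_segment y x"
      unfolding in_segment using t by (intro exI[of _ t]) (auto simp: algebra_simps)
    from dboundD[of F "y + t *\<^sub>R ?w" "replicate (Suc m) ?w @ us" B] B[OF this]
    have "\<bar>?d (Suc m) t\<bar> \<le> B * norm_prod us * norm ?w ^ Suc m"
      by (simp add: norm_prod_replicate mult_ac del: replicate_Suc)
    moreover have "\<bar>a / fact (Suc m)\<bar> \<le> \<bar>a\<bar>" for a :: real
      using fact_ge_1[of "Suc m", where 'a=real] by (simp add: divide_le_eq mult_le_cancel_left1 del: fact_Suc)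
    ultimately show ?thesis using order_trans by blast
  qed
  ultimately show ?thesis using t(3) by linarith
qed

lemma taylor_exact:
  fixes F :: "'a::euclidean_space \<Rightarrow> real"
  assumes "smooth F" and "\<And>z us. length us > m \<Longrightarrow> dform F z us = 0"
  shows "taylor_poly m y F = F"
proof
  fix x
  have "\<bar>dform F x [] - (\<Sum>i\<le>m. dform F y ([] @ replicate i (x - y)) / fact i)\<bar> \<le> 0 * norm_prod ([]::'a list) * norm (x - y) ^ Suc m"
    using assms by (intro taylor_remainder) (auto simp: dbound_def)
  then show "taylor_poly m y F x = F x" by (simp add: taylor_poly_def)
qed

section \<open>Series of smooth functions\<close>

text \<open>
  Term by term differentiation: local bounds that are summable for each order of differentiation
  make the series of derivatives converge uniformly on balls.
\<close>
lemma
  fixes T :: "nat \<Rightarrow> 'a::real_normed_vector \<Rightarrow> real"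
  assumes T: "\<And>k. smooth (T k)"
    and s: "\<And>j R. \<exists>s. summable s \<and> (\<forall>k x. norm x \<le> R \<longrightarrow> dbound (T k) x j (s k))"
  shows smooth_series: "smooth (\<lambda>x. \<Sum>k. T k x)"
    and dform_series: "dform (\<lambda>x. \<Sum>k. T k x) x us = (\<Sum>k. dform (T k) x us)"
    and summable_dform_series: "summable (\<lambda>k. dform (T k) x us)"
proof -
  have summ: "summable (\<lambda>k. dform (T k) x us)" for x us
  proof -
    obtain s where "summable s" "\<And>k. dbound (T k) x (length us) (s k)" using s[of "norm x" "length us"] by blast
    then have le: "norm (dform (T k) x us) \<le> s k * norm_prod us" for k
      using dboundD[of "T k" x us "s k"] by simp
    show ?thesis
      by (rule summable_comparison_test[OF _ summable_mult2[OF \<open>summable s\<close>, of "norm_prod us"]])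
        (use le in blast)
  qed
  then show "summable (\<lambda>k. dform (T k) x us)" .
  let ?D = "\<lambda>x us. \<Sum>k. dform (T k) x us"
  have "((\<lambda>z. ?D z us) has_derivative (\<lambda>u. ?D x (u # us))) (at x)" for us x
  proof -
    let ?S = "ball 0 (norm x + 1) :: 'a set"
    obtain s where s: "summable s" "\<And>k z. norm z \<le> norm x + 1 \<Longrightarrow> dbound (T k) z (Suc (length us)) (s k)"
      using s[of "norm x + 1" "Suc (length us)"] by auto
    define p where "p = norm_prod us"
    have sp: "summable (\<lambda>k. s k * p)" using s(1) by (rule summable_mult2)
    have "\<exists>g. \<forall>z\<in>?S. (\<lambda>k. dform (T k) z us) sums g z \<and> (g has_derivative (\<lambda>u. ?D z (u # us))) (at z within ?S)"
    proof (rule has_derivative_series)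
      show "(\<lambda>k. dform (T k) x us) sums ?D x us" using summ by (rule summable_sums)
      fix e :: real assume "e > 0"
      from order_tendstoD(2)[OF suminf_exist_split2[OF sp] this]
      show "\<forall>\<^sub>F n in sequentially. \<forall>z\<in>?S. \<forall>h. norm ((\<Sum>k<n. dform (T k) z (h # us)) - ?D z (h # us)) \<le> e * norm h"
      proof eventually_elim
        case (elim n)
        show ?case
        proof (intro ballI allI)
          fix z h assume "z \<in> ?S"
          then have b: "\<bar>dform (T k) z (h # us)\<bar> \<le> s k * p * norm h" for k
            using dboundD[of "T k" z "h # us" "s k"] s(2)[of z k] by (simp add: p_def mult_ac)
          have sh: "summable (\<lambda>k. s (k + n) * p * norm h)"
            using summable_ignore_initial_segment[OF sp, of n] by (rule summable_mult2)
          have sT: "summable (\<lambda>k. \<bar>dform (T (k + n)) z (h # us)\<bar>)"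
            by (rule summable_comparison_test[OF _ sh]) (use b in auto)
          have "norm ((\<Sum>k<n. dform (T k) z (h # us)) - ?D z (h # us)) = \<bar>\<Sum>k. dform (T (k + n)) z (h # us)\<bar>"
            using suminf_split_initial_segment[OF summ, of z "h # us" n] by simp
          also have "\<dots> \<le> (\<Sum>k. \<bar>dform (T (k + n)) z (h # us)\<bar>)"
            using summable_norm[of "\<lambda>k. dform (T (k + n)) z (h # us)"] sT by simp
          also have "\<dots> \<le> (\<Sum>k. s (k + n) * p * norm h)"
            using b by (intro suminf_le sT sh) auto
          also have "\<dots> = (\<Sum>k. s (k + n) * p) * norm h"
            using suminf_mult2[OF summable_ignore_initial_segment[OF sp, of n], of "norm h"] by simp
          also have "\<dots> \<le> e * norm h"
            using elim by (intro mult_right_mono) auto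
          finally show "norm ((\<Sum>k<n. dform (T k) z (h # us)) - ?D z (h # us)) \<le> e * norm h" .
        qed
      qed
    next
      show "((\<lambda>z. dform (T k) z us) has_derivative (\<lambda>u. dform (T k) z (u # us))) (at z within ?S)" for k and z :: 'a
        using dform_has_derivative[OF T] has_derivative_at_withinI by blast
    qed auto
    then obtain g where g: "\<And>z. z \<in> ?S \<Longrightarrow> (\<lambda>k. dform (T k) z us) sums g z"
      "\<And>z. z \<in> ?S \<Longrightarrow> (g has_derivative (\<lambda>u. ?D z (u # us))) (at z within ?S)" by blast
    have x: "x \<in> ?S" by simp
    have "(g has_derivative (\<lambda>u. ?D x (u # us))) (at x)"
      using g(2)[OF x] x by (simp add: at_within_open[OF x open_ball])
    then show ?thesis
      by (rule has_derivative_transform_within_open[OF _ open_ball x]) (use g(1) sums_unique in auto)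
  qed
  from dform_eqI[of ?D "\<lambda>x. \<Sum>k. T k x", OF _ this]
  show "smooth (\<lambda>x. \<Sum>k. T k x)" "dform (\<lambda>x. \<Sum>k. T k x) x us = ?D x us" by auto
qed

section \<open>Flat functions and a smooth step\<close>

text \<open>
  The functions \<open>p(1/t) exp(-1/t)\<close>, extended by \<open>0\<close>, form a class that is closed under
  differentiation; this yields their smoothness at \<open>0\<close> and all their derivatives at once.
\<close>
definition flat :: "real poly \<Rightarrow> real \<Rightarrow> real" where
  "flat p t = (if t \<le> 0 then 0 else poly p (1 / t) * exp (- (1 / t)))"

text \<open>
  The polynomial of the derivative, by \<open>d/dt = -(1/t^2) d/ds\<close> for \<open>s = 1/t\<close>.
\<close>
definition flat_step :: "real poly \<Rightarrow> real poly" where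
  "flat_step p = [:0, 0, 1:] * (p - pderiv p)"

lemma poly_exp_tendsto_0: "((\<lambda>s. poly p s * exp (- s)) \<longlongrightarrow> (0::real)) at_top"
proof -
  have "((\<lambda>s. \<Sum>i\<le>degree p. coeff p i * (s ^ i / exp s)) \<longlongrightarrow> (\<Sum>i\<le>degree p. coeff p i * 0)) at_top"
    by (intro tendsto_intros tendsto_power_div_exp_0)
  then show ?thesis by (simp add: poly_altdef exp_minus divide_inverse sum_distrib_right mult.assoc)
qed

lemma flat_has_derivative: "(flat p has_real_derivative flat (flat_step p) t) (at t)"
proof -
  consider "t < 0" | "t = 0" | "t > 0" by linarith
  then show ?thesis
  proof cases
    case 1
    have "((\<lambda>_. 0) has_real_derivative flat (flat_step p) t) (at t)"
      using 1 by (simp add: flat_def)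
    then show ?thesis
      by (rule has_field_derivative_transform_within_open[of _ _ _ "{..<0}"]) (use 1 in \<open>auto simp: flat_def\<close>)
  next
    case 2
    have "((\<lambda>s. poly ([:0, 1:] * p) s * exp (- s)) \<longlongrightarrow> 0) at_top" by (rule poly_exp_tendsto_0)
    then have "((\<lambda>h. poly ([:0, 1:] * p) (inverse h) * exp (- inverse h)) \<longlongrightarrow> 0) (at_right (0::real))"
      using filterlim_compose[OF _ filterlim_inverse_at_top_right] by fast
    then have "((\<lambda>h. flat p h / h) \<longlongrightarrow> 0) (at_right 0)"
      by (rule Lim_transform_eventually) (auto simp: flat_def eventually_at_right_less field_simps intro!: eventually_mono[OF eventually_at_right_less])
    moreover have "((\<lambda>h. flat p h / h) \<longlongrightarrow> 0) (at_left 0)"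
      by (rule tendsto_eventually) (auto simp: flat_def eventually_at_left_field intro!: exI[of _ "-1"])
    ultimately have "((\<lambda>h. flat p h / h) \<longlongrightarrow> 0) (at 0)"
      by (simp add: filterlim_split_at)
    then show ?thesis using 2 by (simp add: DERIV_def flat_def)
  next
    case 3
    have "((\<lambda>t. poly p (1 / t) * exp (- (1 / t))) has_real_derivative
      poly (pderiv p) (1 / t) * (- 1 / t\<^sup>2) * exp (- (1 / t)) + poly p (1 / t) * (exp (- (1 / t)) * (1 / t\<^sup>2))) (at t)"
      using 3 by (auto intro!: derivative_eq_intros DERIV_chain'[OF _ poly_DERIV] simp: power2_eq_square field_simps)
    also have "poly (pderiv p) (1 / t) * (- 1 / t\<^sup>2) * exp (- (1 / t)) + poly p (1 / t) * (exp (- (1 / t)) * (1 / t\<^sup>2))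
       = flat (flat_step p) t"
      using 3 by (simp add: flat_def flat_step_def power2_eq_square field_simps)
    finally have "((\<lambda>t. poly p (1 / t) * exp (- (1 / t))) has_real_derivative flat (flat_step p) t) (at t)" .
    then show ?thesis
      by (rule has_field_derivative_transform_within_open[of _ _ _ "{0<..}"]) (use 3 in \<open>auto simp: flat_def\<close>)
  qed
qed

lemma
  shows smooth_flat: "smooth (flat p)"
    and dform_flat: "dform (flat p) t us = prod_list us * flat ((flat_step ^^ length us) p) t"
proof -
  let ?D = "\<lambda>t us. prod_list us * flat ((flat_step ^^ length us) p) t"
  have "((\<lambda>t. ?D t us) has_derivative (\<lambda>u. ?D t (u # us))) (at t)" for us t
    using flat_has_derivative[of "(flat_step ^^ length us) p" t]
    by (auto simp: has_field_derivative_def mult_ac intro!: derivative_eq_intros)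
  from dform_eqI[of ?D "flat p", OF _ this] show "smooth (flat p)" "dform (flat p) t us = ?D t us" by auto
qed

lemma flat_bounded: "\<exists>B\<ge>0. \<forall>t. \<bar>flat p t\<bar> \<le> B"
proof -
  have "\<forall>\<^sub>F s in at_top. \<bar>poly p s * exp (- s)\<bar> < 1"
    using tendstoD[OF poly_exp_tendsto_0[of p] zero_less_one] by (simp add: dist_real_def)
  then obtain N where N: "\<And>s. s \<ge> N \<Longrightarrow> \<bar>poly p s * exp (- s)\<bar> < 1" unfolding eventually_at_top_linorder by blast
  have "compact ((\<lambda>s. poly p s * exp (- s)) ` {0..N})"
    by (intro compact_continuous_image continuous_intros) auto
  from compact_imp_bounded[OF this]
  obtain B where B: "B > 0" "\<And>s. s \<in> {0..N} \<Longrightarrow> \<bar>poly p s * exp (- s)\<bar> \<le> B"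
    unfolding bounded_pos by auto
  have "\<bar>flat p t\<bar> \<le> max B 1" for t
  proof (cases "t \<le> 0")
    case False
    then show ?thesis using N[of "1/t"] B(2)[of "1/t"] by (cases "1 / t \<ge> N") (auto simp: flat_def)
  qed (simp add: flat_def)
  then show ?thesis by (intro exI[of _ "max B 1"]) auto
qed

text \<open>
  The normalised primitive of a bump function supported in \<open>[0, 1]\<close>.
\<close>
lemma smooth_step_exists:
  "\<exists>S :: real \<Rightarrow> real. smooth S \<and> (\<forall>t\<le>0. S t = 0) \<and> (\<forall>t\<ge>1. S t = 1)"
proof -
  define b where "b t = flat 1 t * flat 1 (1 - t)" for t
  have sb: "smooth b"
  proof -
    have "smooth (\<lambda>t. flat 1 (- t + 1))"
      by (intro smooth_affine[where A = "\<lambda>t. - t"] smooth_flat bounded_linear_minus bounded_linear_ident)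
    then show ?thesis unfolding b_def by (intro smooth_mult smooth_flat) (simp add: algebra_simps)
  qed
  have cont: "continuous_on A b" for A using smooth_continuous[OF sb, of A "[]"] by simp
  have b0: "b t = 0" if "t \<le> 0 \<or> t \<ge> 1" for t using that by (auto simp: b_def flat_def)
  have bpos: "b t > 0" if "0 < t" "t < 1" for t using that by (simp add: b_def flat_def)
  \<comment> \<open>Starting the integral at \<open>-1\<close>, to the left of the support, makes \<open>B\<close> a primitive on the whole
    line: its derivative is checked separately to the right of \<open>-1\<close> and on the negative half line.\<close>
  define B where "B t = integral {-1..t} b" for t
  have der: "(B has_real_derivative b t) (at t)" for t
  proof (cases "t > -1")
    case True
    have "(B has_vector_derivative b t) (at t within {-1..t+1})"
      unfolding B_def by (intro integral_has_vector_derivative cont) (use True in auto)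
    then have "(B has_real_derivative b t) (at t within {-1<..<t+1})"
      unfolding has_real_derivative_iff_has_vector_derivative
      by (rule has_vector_derivative_within_subset) auto
    then show ?thesis using True at_within_open[of t "{-1<..<t+1}"] by simp
  next
    case False
    have "((\<lambda>_. 0) has_real_derivative b t) (at t)" using False b0 by simp
    moreover have "B s = 0" if "s \<in> {..<0}" for s
    proof -
      have "integral {-1..s} b = integral {-1..s} (\<lambda>_. 0)"
        using that b0 by (intro integral_cong) auto
      then show ?thesis by (simp add: B_def)
    qed
    ultimately show ?thesis
      using False by (intro has_field_derivative_transform_within_open[of "\<lambda>_. 0" _ _ "{..<0}" B]) auto
  qed
  have sB: "smooth B" by (rule smooth_primitive[OF der sb])
  have "B 0 < B 1"
  proof -
    obtain z where "0 < z" "z < 1" "B 1 - B 0 = (1 - 0) * b z" using MVT2[of 0 1 B b] der by auto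
    then show ?thesis using bpos[of z] by simp
  qed
  have c: "B t = B s" if "s \<le> t" "t \<le> 0 \<or> s \<ge> 1" for s t
  proof (cases "s < t")
    case True
    then obtain z where "s < z" "z < t" "B t - B s = (t - s) * b z" using MVT2[of s t B b] der by blast
    then show ?thesis using b0[of z] that by auto
  qed (use that in auto)
  define S where "S t = (1 / (B 1 - B 0)) * (B t - B 0)" for t
  have "smooth S" unfolding S_def by (intro smooth_cmult smooth_diff sB smooth_const)
  moreover have "S t = 0" if "t \<le> 0" for t using c[of t 0] that by (simp add: S_def)
  moreover have "S t = 1" if "t \<ge> 1" for t using c[of 1 t] that \<open>B 0 < B 1\<close> by (simp add: S_def)
  ultimately show ?thesis by blast
qed

section \<open>A partition of unity on the integer lattice\<close>

definition lat :: "('n \<Rightarrow> int) \<Rightarrow> real^'n" where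
  "lat z = (\<chi> i. of_int (z i))"

lemma lat_component [simp]: "lat z $ i = of_int (z i)"
  by (simp add: lat_def)

lemma
  fixes R :: real
  shows finite_lat: "finite {z :: 'n::finite \<Rightarrow> int. norm (lat z) \<le> R}"
    and card_lat: "R \<ge> 0 \<Longrightarrow> card {z :: 'n::finite \<Rightarrow> int. norm (lat z) \<le> R} \<le> (2 * R + 1) ^ CARD('n)"
proof -
  let ?A = "PiE (UNIV :: 'n set) (\<lambda>_. {-\<lfloor>R\<rfloor>..\<lfloor>R\<rfloor>})"
  have sub: "{z :: 'n \<Rightarrow> int. norm (lat z) \<le> R} \<subseteq> ?A"
  proof (clarsimp simp: PiE_def Pi_def)
    fix z :: "'n \<Rightarrow> int" and i assume "norm (lat z) \<le> R"
    then have "\<bar>of_int (z i)\<bar> \<le> R" using component_le_norm_cart[of "lat z" i] by simp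
    then show "- \<lfloor>R\<rfloor> \<le> z i \<and> z i \<le> \<lfloor>R\<rfloor>" by linarith
  qed
  have fin: "finite ?A" by (intro finite_PiE) auto
  show "finite {z :: 'n \<Rightarrow> int. norm (lat z) \<le> R}" using finite_subset[OF sub fin] .
  assume "R \<ge> 0"
  have "card {z :: 'n \<Rightarrow> int. norm (lat z) \<le> R} \<le> card ?A" by (rule card_mono[OF fin sub])
  also have "card ?A = nat (2 * \<lfloor>R\<rfloor> + 1) ^ CARD('n)" by (simp add: card_PiE)
  finally have "real (card {z :: 'n \<Rightarrow> int. norm (lat z) \<le> R}) \<le> real (nat (2 * \<lfloor>R\<rfloor> + 1)) ^ CARD('n)"
    by (metis of_nat_le_iff of_nat_power)
  also have "real (nat (2 * \<lfloor>R\<rfloor> + 1)) ^ CARD('n) \<le> (2 * R + 1) ^ CARD('n)"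
    using \<open>R \<ge> 0\<close> by (intro power_mono) linarith+
  finally show "card {z :: 'n \<Rightarrow> int. norm (lat z) \<le> R} \<le> (2 * R + 1) ^ CARD('n)" .
qed

lemma norm_le_card_cart:
  fixes x :: "real^'n"
  assumes "\<And>i. \<bar>x $ i\<bar> \<le> c" shows "norm x \<le> real CARD('n) * c"
  using norm_le_l1_cart[of x] sum_mono[of UNIV "\<lambda>i. \<bar>x $ i\<bar>" "\<lambda>_. c"] assms by simp

text \<open>
  The crude constant \<open>n\<close>, the dimension, replaces \<open>sqrt n\<close> here and below, so that norms can be
  compared with coordinates.
\<close>
lemma lat_near: "\<exists>z. norm ((x::real^'n) - lat z) \<le> real CARD('n)"
proof
  show "norm (x - lat (\<lambda>i. \<lfloor>x $ i\<rfloor>)) \<le> real CARD('n)"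
    using norm_le_card_cart[of "x - lat (\<lambda>i. \<lfloor>x $ i\<rfloor>)" 1] by (simp add: abs_le_iff) linarith
qed

text \<open>
  In dimension one, \<open>h(t) = S(t + 1) - S(t)\<close> has integer translates that telescope to \<open>1\<close>; in
  dimension \<open>n\<close> the product of copies of \<open>h\<close> in the coordinates works, because a sum over a box of
  lattice points factors.
\<close>
lemma lattice_partition_of_unity:
  "\<exists>\<eta> :: real^'n \<Rightarrow> real. smooth \<eta> \<and> (\<forall>x. norm x > real CARD('n) \<longrightarrow> \<eta> x = 0) \<and>
     (\<forall>x Z. finite Z \<longrightarrow> {z. norm (x - lat z) \<le> real CARD('n)} \<subseteq> Z \<longrightarrow> (\<Sum>z\<in>Z. \<eta> (x - lat z)) = 1)"
proof -
  obtain S :: "real \<Rightarrow> real" where S: "smooth S" "\<And>t. t \<le> 0 \<Longrightarrow> S t = 0" "\<And>t. t \<ge> 1 \<Longrightarrow> S t = 1"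
    using smooth_step_exists by blast
  define h where "h t = S (t + 1) - S t" for t
  have h0: "h t = 0" if "\<bar>t\<bar> \<ge> 1" for t using that S(2,3) by (cases "t \<ge> 0") (auto simp: h_def)
  define \<eta> :: "real^'n \<Rightarrow> real" where "\<eta> x = (\<Prod>i\<in>UNIV. h (x $ i))" for x
  have "smooth (\<lambda>t. S (t + c))" for c
    by (rule smooth_affine[where A = "\<lambda>t. t", OF S(1) bounded_linear_ident])
  from smooth_diff[OF this[of 1] S(1)] have sh: "smooth h" unfolding h_def .
  have "smooth \<eta>"
    unfolding \<eta>_def using smooth_affine[OF sh bounded_linear_vec_nth, of _ 0] by (auto intro!: smooth_prod)
  moreover have "\<eta> x = 0" if "norm x > real CARD('n)" for x
  proof -
    have "\<exists>i. \<bar>x $ i\<bar> \<ge> 1"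
    proof (rule ccontr)
      assume "\<nexists>i. \<bar>x $ i\<bar> \<ge> 1"
      then have "\<bar>x $ i\<bar> \<le> 1" for i by (meson linear)
      then show False using norm_le_card_cart[of x 1] that by simp
    qed
    then obtain i where "\<bar>x $ i\<bar> \<ge> 1" ..
    then show ?thesis unfolding \<eta>_def using h0 by (intro prod_zero) auto
  qed
  moreover have "(\<Sum>z\<in>Z. \<eta> (x - lat z)) = 1"
    if Z: "finite Z" "{z. norm (x - lat z) \<le> real CARD('n)} \<subseteq> Z" for x Z
  proof -
    \<comment> \<open>Only the corners of the unit cube that contains \<open>x\<close> contribute.\<close>
    define A where "A i = {\<lfloor>x $ i\<rfloor>, \<lfloor>x $ i\<rfloor> + 1}" for i
    have "PiE UNIV A \<subseteq> {z. norm (x - lat z) \<le> real CARD('n)}"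
    proof safe
      fix z assume "z \<in> PiE UNIV A"
      then have "z i = \<lfloor>x $ i\<rfloor> \<or> z i = \<lfloor>x $ i\<rfloor> + 1" for i by (auto simp: A_def PiE_def Pi_def)
      then have "\<bar>(x - lat z) $ i\<bar> \<le> 1" for i
        by (simp add: abs_le_iff) (smt (verit) of_int_1 of_int_add of_int_floor_le real_of_int_floor_add_one_ge)
      then show "norm (x - lat z) \<le> real CARD('n)" using norm_le_card_cart[of "x - lat z" 1] by simp
    qed
    then have sub: "PiE UNIV A \<subseteq> Z" using Z(2) by blast
    have "(\<Sum>z\<in>Z. \<eta> (x - lat z)) = (\<Sum>z\<in>PiE UNIV A. \<eta> (x - lat z))"
    proof (intro sum.mono_neutral_right Z(1) sub ballI)
      fix z assume "z \<in> Z - PiE UNIV A"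
      then obtain i where "z i \<notin> A i" by (auto simp: PiE_def Pi_def)
      then have "z i < \<lfloor>x $ i\<rfloor> \<or> \<lfloor>x $ i\<rfloor> + 1 < z i" by (auto simp: A_def)
      then have "\<bar>(x - lat z) $ i\<bar> \<ge> 1" by (simp add: abs_if) linarith
      then have "h ((x - lat z) $ i) = 0" by (rule h0)
      then show "\<eta> (x - lat z) = 0" unfolding \<eta>_def by (intro prod_zero) auto
    qed
    also have "\<dots> = (\<Prod>i\<in>UNIV. \<Sum>k\<in>A i. h (x $ i - of_int k))"
      unfolding \<eta>_def by (subst prod_sum_PiE) (auto simp: A_def)
    also have "\<dots> = 1"
    proof (intro prod.neutral ballI)
      fix i
      have "(\<Sum>k\<in>A i. h (x $ i - of_int k)) = S (frac (x $ i) + 1) - S (frac (x $ i) - 1)"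
        by (simp add: A_def h_def frac_def algebra_simps)
      also have "\<dots> = 1"
        using S(2,3) frac_ge_0[of "x $ i"] frac_lt_1[of "x $ i"] by simp
      finally show "(\<Sum>k\<in>A i. h (x $ i - of_int k)) = 1" .
    qed
    finally show ?thesis .
  qed
  ultimately show ?thesis by blast
qed

section \<open>Convexity and the second derivative\<close>

lemma dform_scale_replicate:
  assumes "smooth F"
  shows "dform F y (us @ replicate i (t *\<^sub>R w)) = t ^ i * dform F y (us @ replicate i w)"
proof (induction i arbitrary: us)
  case (Suc i)
  have "dform F y (us @ t *\<^sub>R w # replicate i (t *\<^sub>R w)) = t * dform F y (us @ w # replicate i (t *\<^sub>R w))"
    using linear_cmul[OF linear_dform[OF assms]] by simp
  then show ?case using Suc.IH[of "us @ [w]"] by simp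
qed simp

text \<open>
  The second difference of a convex function is nonnegative, and by Taylor's formula it is
  \<open>t^2 D^2F(y)(v^2) + O(t^3)\<close>.
\<close>
lemma convex_imp_dform2_nonneg:
  fixes F :: "'a::euclidean_space \<Rightarrow> real"
  assumes F: "smooth F" and f: "convex_on S f" "\<And>x. x \<in> S \<Longrightarrow> F x = f x" and y: "y \<in> interior S"
  shows "dform F y [v, v] \<ge> 0"
proof (rule ccontr)
  assume neg: "\<not> dform F y [v, v] \<ge> 0"
  obtain r where r: "r > 0" "ball y r \<subseteq> S" using y by (meson interior_subset mem_interior subset_trans)
  obtain B where B: "B \<ge> 0" "\<And>z. z \<in> cball y r \<Longrightarrow> dbound F z 3 B" using dbound_compact[OF F compact_cball] by blast
  define V where "V = norm v + 1"
  have V: "V > 0" "norm v \<le> V" by (auto simp: V_def add_nonneg_pos)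
  have taylor: "\<bar>F (y + t *\<^sub>R v) - (F y + t * dform F y [v] + t\<^sup>2 / 2 * dform F y [v, v])\<bar> \<le> B * V ^ 3 * \<bar>t\<bar> ^ 3"
    if t: "\<bar>t\<bar> * V < r" for t
  proof -
    have tv: "norm (t *\<^sub>R v) \<le> \<bar>t\<bar> * V" using V by (simp add: mult_left_mono)
    have "closed_segment y (y + t *\<^sub>R v) \<subseteq> cball y r"
      using tv t r(1) by (intro closed_segment_subset) (auto simp: dist_norm)
    then have s1: "\<bar>dform F (y + t *\<^sub>R v) [] - (\<Sum>i\<le>2. dform F y ([] @ replicate i (y + t *\<^sub>R v - y)) / fact i)\<bar>
       \<le> B * norm_prod ([]::'a list) * norm (y + t *\<^sub>R v - y) ^ Suc 2"
      using B by (intro taylor_remainder F) auto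
    have s2: "(\<Sum>i\<le>2. dform F y ([] @ replicate i (y + t *\<^sub>R v - y)) / fact i) = F y + t * dform F y [v] + t\<^sup>2 / 2 * dform F y [v, v]"
      unfolding add_diff_cancel_left' dform_scale_replicate[OF F]
      by (simp add: numeral_2_eq_2)
    have "norm (t *\<^sub>R v) ^ 3 \<le> (\<bar>t\<bar> * V) ^ 3" using tv by (intro power_mono) auto
    then have "B * norm (t *\<^sub>R v) ^ 3 \<le> B * V ^ 3 * \<bar>t\<bar> ^ 3"
      using mult_left_mono[of "norm (t *\<^sub>R v) ^ 3" "(\<bar>t\<bar> * V) ^ 3" B] B(1) by (simp add: power_mult_distrib mult_ac)
    then show ?thesis using s1 unfolding s2 by (simp add: eval_nat_numeral)
  qed
  define c where "c = - dform F y [v, v]"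
  have c: "c > 0" using neg by (simp add: c_def)
  \<comment> \<open>The first bound keeps \<open>y + tv\<close> and \<open>y - tv\<close> in the ball where the remainder estimate holds, the
    second makes the cubic remainder smaller than the quadratic term.\<close>
  define t where "t = min (r / (2 * V)) (c / (4 * (B * V ^ 3 + 1)))"
  have BV: "B * V ^ 3 \<ge> 0" using B(1) V(1) by simp
  have t: "t > 0" using r V c BV by (simp add: t_def add_nonneg_pos)
  have "t * V \<le> r / (2 * V) * V" using V by (intro mult_right_mono) (auto simp: t_def)
  then have tr: "t * V < r" using r V by simp
  have "t * (B * V ^ 3 + 1) \<le> c / (4 * (B * V ^ 3 + 1)) * (B * V ^ 3 + 1)"
    using BV by (intro mult_right_mono) (auto simp: t_def)
  also have "\<dots> = c / 4" using BV by (simp add: field_simps)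
  finally have tc: "t * (B * V ^ 3) < c / 2" using t c by (simp add: distrib_left)
  have inS: "y + s *\<^sub>R v \<in> S" if "\<bar>s\<bar> * V < r" for s
  proof -
    have "norm (s *\<^sub>R v) < r" using that V mult_left_mono[of "norm v" V "\<bar>s\<bar>"] by simp
    then show ?thesis using r(2) by (auto simp: dist_norm)
  qed
  have "F ((1 - 1/2) *\<^sub>R (y + t *\<^sub>R v) + (1/2) *\<^sub>R (y + (- t) *\<^sub>R v)) \<le> (1 - 1/2) * F (y + t *\<^sub>R v) + 1/2 * F (y + (- t) *\<^sub>R v)"
  proof -
    have m: "(1 - 1/2) *\<^sub>R (y + t *\<^sub>R v) + (1/2) *\<^sub>R (y + (- t) *\<^sub>R v) = y"
      by (simp add: algebra_simps flip: scaleR_add_left)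
    show ?thesis using convex_onD[OF f(1), of "1/2" "y + t *\<^sub>R v" "y + (- t) *\<^sub>R v"] inS[of t] inS[of "- t"] inS[of 0] t tr r
      f(2)[of y] f(2)[of "y + t *\<^sub>R v"] f(2)[of "y + (- t) *\<^sub>R v"] unfolding m by simp
  qed
  then have "2 * F y \<le> F (y + t *\<^sub>R v) + F (y + (- t) *\<^sub>R v)"
    by (simp add: algebra_simps flip: scaleR_add_left)
  moreover have "F (y + t *\<^sub>R v) \<le> F y + t * dform F y [v] + t\<^sup>2 / 2 * dform F y [v, v] + B * V ^ 3 * t ^ 3"
    using taylor[of t] tr t by simp
  moreover have "F (y + (- t) *\<^sub>R v) \<le> F y - t * dform F y [v] + t\<^sup>2 / 2 * dform F y [v, v] + B * V ^ 3 * t ^ 3"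
    using taylor[of "- t"] tr t by simp
  ultimately have "0 \<le> - (t\<^sup>2 * c) + 2 * (B * V ^ 3 * t ^ 3)" by (simp add: c_def)
  also have "\<dots> = t\<^sup>2 * (- c + 2 * (t * (B * V ^ 3)))" by (simp add: power2_eq_square power3_eq_cube algebra_simps)
  finally have "- c + 2 * (t * (B * V ^ 3)) \<ge> 0" using t by (simp add: zero_le_mult_iff)
  with tc show False by linarith
qed

lemma dform2_nonneg_imp_convex:
  fixes F :: "'a::euclidean_space \<Rightarrow> real"
  assumes F: "smooth F" and nonneg: "\<And>x v. dform F x [v, v] \<ge> 0"
  shows "convex_on UNIV F"
proof (rule convex_onI)
  fix t :: real and x y :: 'a assume t: "0 < t" "t < 1"
  let ?v = "y - x"
  have "convex_on UNIV (\<lambda>s. F (x + s *\<^sub>R ?v))"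
    using dform_line_derivative[OF F, of x ?v "[]"] dform_line_derivative[OF F, of x ?v "[?v]"] nonneg
    by (intro f''_ge0_imp_convex[where f' = "\<lambda>s. dform F (x + s *\<^sub>R ?v) [?v]"
      and f'' = "\<lambda>s. dform F (x + s *\<^sub>R ?v) [?v, ?v]"]) auto
  from convex_onD[OF this, of t 0 1] t
  show "F ((1 - t) *\<^sub>R x + t *\<^sub>R y) \<le> (1 - t) * F x + t * F y"
    by (simp add: algebra_simps)
qed simp

section \<open>Jets and the Whitney condition\<close>

lemma form_norm_le:
  fixes A :: "'a::euclidean_space list \<Rightarrow> real"
  assumes "\<And>us. length us = j \<Longrightarrow> set us \<subseteq> sphere 0 1 \<Longrightarrow> \<bar>A us\<bar> \<le> B"
  shows "form_norm j A \<le> B"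
  unfolding form_norm_def
proof (rule cSUP_least)
  obtain b :: 'a where "b \<in> Basis" using nonempty_Basis by blast
  then have "replicate j b \<in> {us. length us = j \<and> set us \<subseteq> sphere 0 1}" by auto
  then show "{us :: 'a list. length us = j \<and> set us \<subseteq> sphere 0 1} \<noteq> {}" by blast
qed (use assms in auto)

lemma norm_prod_unit: "set us \<subseteq> sphere 0 1 \<Longrightarrow> norm_prod us = 1"
  by (induction us) auto

text \<open>
  The supremum in \<open>form_norm\<close> is a real number that bounds the form only if the form is bounded
  on unit vectors, which holds for derivatives of smooth functions.
\<close>
lemma dbound_form_norm:
  fixes F :: "'a::euclidean_space \<Rightarrow> real"
  assumes F: "smooth F" shows "dbound F x j (form_norm j (dform F x))"
proof (rule dbound_unitI[OF F])
  fix us :: "'a list" assume us: "length us = j" "set us \<subseteq> sphere 0 1"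
  obtain B where "dbound F x j B" using dbound_compact[OF F, of "{x}" j] by auto
  then have "bdd_above ((\<lambda>us. \<bar>dform F x us\<bar>) ` {us. length us = j \<and> set us \<subseteq> sphere 0 1})"
    by (auto simp: bdd_above_def dbound_def norm_prod_unit intro!: exI[of _ B])
  then show "\<bar>dform F x us\<bar> \<le> form_norm j (dform F x)"
    unfolding form_norm_def using us by (intro cSUP_upper) auto
qed

text \<open>
  The sum in \<open>(CW^m)\<close> is the Taylor polynomial of order \<open>m - 2\<close> of \<open>t \<mapsto> D^2F(y + tw)(v^2)\<close>.
\<close>
lemma CW_sum_remainder:
  fixes F :: "real^'n \<Rightarrow> real"
  assumes F: "smooth F" and m: "m \<ge> 2" and t: "t \<ge> 0" and vw: "norm v = 1" "norm w = 1"
    and B: "B \<ge> 0" "\<And>z. norm (z - y) \<le> t \<Longrightarrow> dbound F z (Suc m) B"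
  shows "\<bar>dform F (y + t *\<^sub>R w) [v, v] -
     (\<Sum>k = 2..m. t ^ (k - 2) / fact (k - 2) * dform F y (replicate (k - 2) w @ [v, v]))\<bar> \<le> B * t ^ (m - 1)"
proof -
  have seg: "norm (z - y) \<le> t" if "z \<in> closed_segment y (y + t *\<^sub>R w)" for z
    using segment_bound1[OF that] vw t by simp
  have "\<bar>dform F (y + t *\<^sub>R w) [v, v] - (\<Sum>i\<le>m - 2. dform F y ([v, v] @ replicate i (y + t *\<^sub>R w - y)) / fact i)\<bar>
     \<le> B * norm_prod [v, v] * norm (y + t *\<^sub>R w - y) ^ Suc (m - 2)"
    using m seg B by (intro taylor_remainder F) (auto simp: numeral_2_eq_2 Suc_diff_Suc)
  moreover have "(\<Sum>i\<le>m - 2. dform F y ([v, v] @ replicate i (y + t *\<^sub>R w - y)) / fact i)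
     = (\<Sum>k = 2..m. t ^ (k - 2) / fact (k - 2) * dform F y (replicate (k - 2) w @ [v, v]))"
    unfolding add_diff_cancel_left' dform_scale_replicate[OF F] dform_rotate[OF F, of y "[v,v]"]
    by (rule sum.reindex_bij_witness[of _ "\<lambda>k. k - 2" "\<lambda>i. i + 2"]) (use m in auto)
  moreover have "Suc (m - 2) = m - 1" using m by simp
  ultimately show ?thesis using vw t by simp
qed

context
  fixes C :: "(real^'n) set" and f :: "real^'n \<Rightarrow> real" and P :: "nat \<Rightarrow> real^'n \<Rightarrow> real^'n \<Rightarrow> real"
  assumes compat: "compatible_family C f P"
begin

lemma jet_smooth: "y \<in> C \<Longrightarrow> smooth (P m y)"
  using compat unfolding compatible_family_def by (meson polynomial_smooth)

lemma jet_taylor: "y \<in> C \<Longrightarrow> j < k \<Longrightarrow> P j y = taylor_poly j y (P k y)"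
  using compat unfolding compatible_family_def by blast

lemma jet_value: "y \<in> C \<Longrightarrow> P m y y = f y"
  using compat unfolding compatible_family_def by blast

lemma jet_dform_eq: "y \<in> C \<Longrightarrow> length us \<le> m \<Longrightarrow> m \<le> k \<Longrightarrow> dform (P m y) y us = dform (P k y) y us"
  using jet_taylor[of y m k] dform_taylor_poly_center[OF jet_smooth[of y k], of us m y]
  by (cases "m = k") auto

text \<open>
  \<open>P^m_y\<close> is also a Taylor polynomial of \<open>P^(m+1)_y\<close>, so the formula for the derivatives of Taylor
  polynomials applies.
\<close>
lemma jet_dform_high: "y \<in> C \<Longrightarrow> length us > m \<Longrightarrow> dform (P m y) x us = 0"
  using jet_taylor[of y m "Suc m"] dform_taylor_poly_ge[OF jet_smooth[of y "Suc m"], of m us y x] by simp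

text \<open>
  Re-expansion of the polynomial \<open>P^m_y\<close> at an arbitrary centre \<open>b\<close>.
\<close>
lemma jet_expansion:
  assumes "y \<in> C" "length us \<le> m"
  shows "dform (P m y) x us = (\<Sum>i\<le>m - length us. dform (P m y) b (us @ replicate i (x - b)) / fact i)"
proof -
  have "taylor_poly m b (P m y) = P m y"
    using jet_dform_high[OF assms(1)] by (intro taylor_exact jet_smooth assms(1))
  then show ?thesis using dform_taylor_poly_le[OF jet_smooth[OF assms(1), of m] assms(2), of b x] by simp
qed

text \<open>
  The form in which \<open>(W^m)\<close> is used: a single \<open>\<delta>\<close> serves all orders \<open>j\<close> and all pairs of points.
\<close>
lemma cond_W_bound:
  assumes W: "cond_W P m C" and C: "compact C" and "\<epsilon> > 0"
  obtains \<delta> where "\<delta> > 0"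
    "\<And>j y z. j \<le> m \<Longrightarrow> y \<in> C \<Longrightarrow> z \<in> C \<Longrightarrow> norm (y - z) \<le> \<delta> \<Longrightarrow>
       dbound (\<lambda>x. P m y x - P m z x) z j (\<epsilon> * norm (y - z) ^ (m - j))"
proof -
  have "((\<lambda>\<delta>. rho P m C \<delta>) \<longlongrightarrow> 0) (at_right 0)"
    using W C unfolding cond_W_def by blast
  then have "\<forall>\<^sub>F \<delta> in at_right 0. rho P m C \<delta> < ennreal \<epsilon>"
    by (rule order_tendstoD(2)) (use \<open>\<epsilon> > 0\<close> in simp)
  then obtain d where d: "d > 0" "\<And>\<delta>. 0 < \<delta> \<Longrightarrow> \<delta> < d \<Longrightarrow> rho P m C \<delta> < ennreal \<epsilon>"
    unfolding eventually_at_right_field by auto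
  show ?thesis
  proof (rule that[of "d/2"])
    show "d/2 > 0" using d by simp
    fix j and y z :: "real^'n" assume j: "j \<le> m" and yz: "y \<in> C" "z \<in> C" "norm (y - z) \<le> d/2"
    show "dbound (\<lambda>x. P m y x - P m z x) z j (\<epsilon> * norm (y - z) ^ (m - j))"
    proof (cases "y = z")
      case True
      then show ?thesis using \<open>\<epsilon> > 0\<close> by (auto simp: dbound_def dform_const norm_prod_nonneg)
    next
      case False
      let ?A = "\<lambda>us. dform (P m y) z us - dform (P m z) z us"
      have A: "?A = dform (\<lambda>x. P m y x - P m z x) z"
        by (intro ext) (simp add: dform_diff jet_smooth yz)
      have "ennreal (form_norm j ?A / norm (y - z) ^ (m - j)) \<le> rho P m C (d/2)"
        unfolding rho_def using j yz False by (intro Sup_upper) auto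
      also have "\<dots> < ennreal \<epsilon>" using d by simp
      finally have lt: "ennreal (form_norm j ?A / norm (y - z) ^ (m - j)) < ennreal \<epsilon>" .
      have "form_norm j ?A / norm (y - z) ^ (m - j) < \<epsilon>"
      proof (rule ccontr)
        assume "\<not> form_norm j ?A / norm (y - z) ^ (m - j) < \<epsilon>"
        then have "ennreal \<epsilon> \<le> ennreal (form_norm j ?A / norm (y - z) ^ (m - j))" by (intro ennreal_leI) simp
        with lt show False by simp
      qed
      then have "form_norm j ?A \<le> \<epsilon> * norm (y - z) ^ (m - j)"
        using False by (simp add: divide_less_eq)
      then show ?thesis
        using dbound_form_norm[OF smooth_diff[OF jet_smooth jet_smooth], of y z m m z j] yz
        unfolding A by (auto intro: dbound_mono)
    qed
  qed
qed

section \<open>Necessity of the conditions\<close>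

lemma extension_dform:
  assumes "smooth F" "\<And>m y. y \<in> C \<Longrightarrow> taylor_poly m y F = P m y" "y \<in> C" "length us \<le> m"
  shows "dform (P m y) y us = dform F y us"
  using dform_taylor_poly_center[OF assms(1,4), of y] assms(2)[OF assms(3), of m] by simp

text \<open>
  Up to sign, the quantity in \<open>(W^m)\<close> is the Taylor remainder of order \<open>m - j\<close> of \<open>D^j F\<close>, hence
  \<open>O(|y - z|^(m - j + 1))\<close>.  Convexity of \<open>C\<close> keeps the segment from \<open>y\<close> to \<open>z\<close> inside the compact
  set on which \<open>D^(m+1) F\<close> is bounded.
\<close>
lemma extension_imp_cond_W:
  assumes C: "compact C" "convex C" and F: "smooth F" and T: "\<And>m y. y \<in> C \<Longrightarrow> taylor_poly m y F = P m y"
  shows "cond_W P m C"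
  unfolding cond_W_def
proof (intro allI impI)
  fix K assume K: "compact K \<and> K \<subseteq> C"
  obtain B where B: "B \<ge> 0" "\<And>z. z \<in> C \<Longrightarrow> dbound F z (Suc m) B" using dbound_compact[OF F C(1)] by blast
  have "rho P m K \<delta> \<le> ennreal (B * \<delta>)" if "\<delta> > 0" for \<delta>
    unfolding rho_def
  proof (rule Sup_least, clarify)
    fix j y z assume j: "j \<le> m" and yz: "y \<in> K" "z \<in> K" "0 < norm (y - z)" "norm (y - z) \<le> \<delta>"
    have yzC: "y \<in> C" "z \<in> C" using K yz by auto
    have "form_norm j (\<lambda>us. dform (P m y) z us - dform (P m z) z us) \<le> B * norm (y - z) ^ Suc (m - j)"
    proof (rule form_norm_le)
      fix us :: "(real^'n) list" assume us: "length us = j" "set us \<subseteq> sphere 0 1"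
      have "\<bar>dform F z us - (\<Sum>i\<le>m - j. dform F y (us @ replicate i (z - y)) / fact i)\<bar>
          \<le> B * norm_prod us * norm (z - y) ^ Suc (m - j)"
        using B closed_segment_subset[OF yzC C(2)] us j by (intro taylor_remainder F) auto
      moreover have "(\<Sum>i\<le>m - j. dform F y (us @ replicate i (z - y)) / fact i) = dform (P m y) z us"
        using dform_taylor_poly_le[OF F, of us m y z] us j T[OF yzC(1)] by simp
      moreover have "dform (P m z) z us = dform F z us"
        using extension_dform[OF F T yzC(2)] us j by simp
      ultimately show "\<bar>dform (P m y) z us - dform (P m z) z us\<bar> \<le> B * norm (y - z) ^ Suc (m - j)"
        using norm_prod_unit[OF us(2)] by (simp add: norm_minus_commute abs_minus_commute)
    qed
    then have "form_norm j (\<lambda>us. dform (P m y) z us - dform (P m z) z us) / norm (y - z) ^ (m - j) \<le> B * norm (y - z)"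
      using yz(3) by (simp add: divide_le_eq mult_ac)
    also have "\<dots> \<le> B * \<delta>" using B(1) yz(4) by (intro mult_left_mono)
    finally show "ennreal (form_norm j (\<lambda>us. dform (P m y) z us - dform (P m z) z us) / norm (y - z) ^ (m - j)) \<le> ennreal (B * \<delta>)"
      by (rule ennreal_leI)
  qed
  then have "\<forall>\<^sub>F \<delta> in at_right 0. rho P m K \<delta> \<le> ennreal (B * \<delta>)"
    by (auto intro: eventually_mono[OF eventually_at_right_less])
  moreover have "((\<lambda>\<delta>. ennreal (B * \<delta>)) \<longlongrightarrow> ennreal (B * 0)) (at_right 0)"
    by (intro tendsto_ennrealI tendsto_intros)
  then have "((\<lambda>\<delta>. ennreal (B * \<delta>)) \<longlongrightarrow> 0) (at_right 0)" by simp
  moreover have "\<forall>\<^sub>F \<delta> in at_right 0. 0 \<le> rho P m K \<delta>" by simp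
  ultimately show "((\<lambda>\<delta>. rho P m K \<delta>) \<longlongrightarrow> 0) (at_right 0)"
    by (intro tendsto_sandwich[of "\<lambda>_. 0" "rho P m K" "at_right 0" "\<lambda>\<delta>. ennreal (B * \<delta>)" 0] tendsto_const)
qed

text \<open>
  Convexity gives \<open>D^2F(y + tw)(v^2) \<ge> 0\<close>, and the sum in \<open>(CW^m)\<close> differs from this by
  \<open>O(t^(m-1))\<close>, which is below \<open>\<epsilon> t^(m-2)\<close> for small \<open>t\<close>.
\<close>
lemma extension_imp_cond_CW:
  assumes C: "compact C" and F: "smooth F" "convex_on UNIV F"
    and T: "\<And>m y. y \<in> C \<Longrightarrow> taylor_poly m y F = P m y" and m: "m \<ge> 2" and S: "S \<subseteq> C"
  shows "cond_CW P m S"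
  unfolding cond_CW_def
proof (intro allI impI)
  fix \<epsilon> :: real assume \<epsilon>: "\<epsilon> > 0"
  obtain R where R: "\<And>y. y \<in> C \<Longrightarrow> norm y \<le> R" using compact_imp_bounded[OF C] unfolding bounded_iff by blast
  obtain B where B: "B \<ge> 0" "\<And>z. z \<in> cball 0 (R + 1) \<Longrightarrow> dbound F z (Suc m) B"
    using dbound_compact[OF F(1) compact_cball] by blast
  define t0 where "t0 = min 1 (\<epsilon> / (B + 1))"
  have t0: "t0 > 0" using \<epsilon> B(1) by (simp add: t0_def)
  show "\<exists>t0>0. \<forall>y\<in>S. \<forall>v\<in>sphere 0 1. \<forall>w\<in>sphere 0 1. \<forall>t. 0 < t \<and> t \<le> t0 \<longrightarrow>
      - \<epsilon> * t ^ (m - 2) \<le> (\<Sum>k = 2..m. t ^ (k - 2) / fact (k - 2) * dform (P m y) y (replicate (k - 2) w @ [v, v]))"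
  proof (intro exI[of _ t0] conjI t0 ballI allI impI)
    fix y v w :: "real^'n" and t assume y: "y \<in> S" and v: "v \<in> sphere 0 1" and w: "w \<in> sphere 0 1" and t: "0 < t \<and> t \<le> t0"
    let ?sum = "\<Sum>k = 2..m. t ^ (k - 2) / fact (k - 2) * dform F y (replicate (k - 2) w @ [v, v])"
    have "t \<le> 1" using t by (simp add: t0_def)
    have "\<bar>dform F (y + t *\<^sub>R w) [v, v] - ?sum\<bar> \<le> B * t ^ (m - 1)"
    proof (rule CW_sum_remainder[OF F(1) m])
      fix z assume "norm (z - y) \<le> t"
      then have "norm z \<le> R + 1" using R[of y] y S \<open>t \<le> 1\<close> norm_triangle_sub[of z y] by auto
      then show "dbound F z (Suc m) B" using B by simp
    qed (use t v w B in auto)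
    moreover have "dform F (y + t *\<^sub>R w) [v, v] \<ge> 0"
      by (rule convex_imp_dform2_nonneg[OF F(1) F(2)]) auto
    moreover have "B * t ^ (m - 1) \<le> \<epsilon> * t ^ (m - 2)"
    proof -
      have "t * (B + 1) \<le> \<epsilon>" using t B(1) by (simp add: t0_def pos_le_divide_eq)
      then have "B * t \<le> \<epsilon>" using t by (simp add: algebra_simps)
      then have "B * t * t ^ (m - 2) \<le> \<epsilon> * t ^ (m - 2)" using t by (intro mult_right_mono) auto
      moreover have "m - 1 = Suc (m - 2)" using m by simp
      ultimately show ?thesis by (simp add: mult_ac)
    qed
    moreover have "?sum = (\<Sum>k = 2..m. t ^ (k - 2) / fact (k - 2) * dform (P m y) y (replicate (k - 2) w @ [v, v]))"
      using y S by (intro sum.cong refl) (subst extension_dform[OF F(1) T], auto)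
    ultimately show "- \<epsilon> * t ^ (m - 2) \<le> (\<Sum>k = 2..m. t ^ (k - 2) / fact (k - 2) * dform (P m y) y (replicate (k - 2) w @ [v, v]))"
      by linarith
  qed
qed

end

section \<open>Extending a smooth jet from a compact convex set\<close>

lemma dbound_zero_open:
  assumes "open U" "x \<in> U" "\<And>y. y \<in> U \<Longrightarrow> F y = 0" "B \<ge> 0"
  shows "dbound F x j B"
proof -
  have "dform F x us = 0" for us
    using dform_cong_open[OF assms(1,2), of F "\<lambda>_. 0" us] assms(3) by (simp add: dform_const)
  then show ?thesis using assms(4) by (simp add: dbound_def norm_prod_nonneg)
qed

text \<open>
  Finitely many terms of a series may be bounded by compactness, without any estimate.
\<close>
lemma eventually_bounded_imp_summable_bound:
  fixes T :: "nat \<Rightarrow> 'a::euclidean_space \<Rightarrow> real"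
  assumes T: "\<And>k. smooth (T k)" and s: "summable s"
    and ev: "\<forall>\<^sub>F k in sequentially. \<forall>x. norm x \<le> R \<longrightarrow> dbound (T k) x j (s k)"
  shows "\<exists>s'. summable s' \<and> (\<forall>k x. norm x \<le> R \<longrightarrow> dbound (T k) x j (s' k))"
proof -
  obtain K where K: "\<And>k x. k \<ge> K \<Longrightarrow> norm x \<le> R \<Longrightarrow> dbound (T k) x j (s k)"
    using ev unfolding eventually_sequentially by blast
  have "\<forall>k. \<exists>B. \<forall>x\<in>cball 0 R. dbound (T k) x j B" using dbound_compact[OF T compact_cball] by blast
  then obtain B where B: "\<And>k x. norm x \<le> R \<Longrightarrow> dbound (T k) x j (B k)" by (metis mem_cball_0)
  have "summable (\<lambda>k. if k < K then B k else s k)"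
    using s by (subst summable_cong[of _ s]) (auto intro!: eventually_sequentiallyI[of K])
  then show ?thesis
    by (intro exI[of _ "\<lambda>k. if k < K then B k else s k"]) (use K B in auto)
qed

text \<open>
  If every degree \<open>m\<close> is admissible from some scale on, the degree can be raised with the scale so
  slowly that it is admissible throughout.
\<close>
lemma slow_sequence:
  assumes Q: "\<And>m::nat. \<forall>\<^sub>F k in sequentially. Q m k"
  obtains \<mu> :: "nat \<Rightarrow> nat" and k0 :: nat
  where "mono \<mu>" "filterlim \<mu> at_top sequentially" "\<And>k. k \<ge> k0 \<Longrightarrow> Q (\<mu> k) k"
proof -
  have "\<forall>m. \<exists>K. \<forall>k\<ge>K. Q m k" using Q unfolding eventually_sequentially by blast
  then obtain K where K: "\<And>m k. k \<ge> K m \<Longrightarrow> Q m k" by metis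
  \<comment> \<open>An increasing majorant of the thresholds; the summand \<open>m\<close> makes the sets below finite.\<close>
  define L where "L m = (\<Sum>i\<le>m. K i) + m" for m
  have L: "K m \<le> L m" "m \<le> L m" for m
    by (auto simp: L_def intro: trans_le_add1 member_le_sum)
  define \<mu> where "\<mu> k = Max (insert 0 {m. L m \<le> k})" for k
  have fin: "finite {m. L m \<le> k}" for k
    by (rule finite_subset[of _ "{..k}"]) (use L(2) order_trans in auto)
  have ge: "\<mu> k \<ge> m" if "L m \<le> k" for m k
    unfolding \<mu>_def using fin that by (intro Max_ge) auto
  show ?thesis
  proof (rule that)
    show "mono \<mu>" unfolding mono_def \<mu>_def using fin by (auto intro!: Max_mono)
    show "filterlim \<mu> at_top sequentially"
      unfolding filterlim_at_top eventually_sequentially using ge by blast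
    show "Q (\<mu> k) k" if "k \<ge> L 0" for k
    proof -
      have "\<mu> k \<in> insert 0 {m. L m \<le> k}" unfolding \<mu>_def using fin by (intro Max_in) auto
      then have "L (\<mu> k) \<le> k" using that by auto
      then show ?thesis using K[of "\<mu> k" k] L(1)[of "\<mu> k"] by simp
    qed
  qed
qed

lemma card_ge_1: "real CARD('n::finite) \<ge> 1"
  using zero_less_card_finite[where 'a='n] by linarith

lemma half_power_inverse: "(1/2) ^ k * 2 ^ k = (1::real)"
  by (simp flip: power_mult_distrib)

text \<open>
  The profile of a lattice partition of unity, fixed once and for all so that the bounds for its
  derivatives do not depend on the scale.
\<close>
definition bump :: "real^'n \<Rightarrow> real" where
  "bump = (SOME \<eta>. smooth \<eta> \<and> (\<forall>x. norm x > real CARD('n) \<longrightarrow> \<eta> x = 0) \<and>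
     (\<forall>x Z. finite Z \<longrightarrow> {z. norm (x - lat z) \<le> real CARD('n)} \<subseteq> Z \<longrightarrow> (\<Sum>z\<in>Z. \<eta> (x - lat z)) = 1))"

lemma
  shows smooth_bump: "smooth (bump :: real^'n \<Rightarrow> real)"
    and bump_support: "norm (x :: real^'n) > real CARD('n) \<Longrightarrow> bump x = 0"
    and bump_partition: "finite Z \<Longrightarrow> {z. norm ((x :: real^'n) - lat z) \<le> real CARD('n)} \<subseteq> Z \<Longrightarrow> (\<Sum>z\<in>Z. bump (x - lat z)) = 1"
  using someI_ex[OF lattice_partition_of_unity[where 'n='n]] unfolding bump_def[symmetric] by blast+

definition node :: "nat \<Rightarrow> ('n \<Rightarrow> int) \<Rightarrow> real^'n" where
  "node k z = (1/2) ^ k *\<^sub>R lat z"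

definition cell :: "nat \<Rightarrow> ('n \<Rightarrow> int) \<Rightarrow> real^'n \<Rightarrow> real" where
  "cell k z x = bump (2 ^ k *\<^sub>R x + (- lat z))"

lemma smooth_cell: "smooth (cell k z)"
  unfolding cell_def by (intro smooth_affine smooth_bump bounded_linear_scaleR_right)

text \<open>
  The support of \<open>cell k z\<close> is the ball of radius \<open>n 2^-k\<close> about \<open>node k z\<close>.
\<close>
lemma norm_node_diff: "norm (x - node k z) = (1/2) ^ k * norm (2 ^ k *\<^sub>R x + (- lat z))"
proof -
  have "x - node k z = (1/2) ^ k *\<^sub>R (2 ^ k *\<^sub>R x + (- lat z))"
    unfolding scaleR_add_right scaleR_scaleR half_power_inverse by (simp add: node_def)
  then show ?thesis by (simp add: power_divide)
qed

lemma cell_support: "norm (x - node k z) > real CARD('n) * (1/2) ^ k \<Longrightarrow> cell k z (x :: real^'n) = 0"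
  unfolding norm_node_diff cell_def by (rule bump_support) (simp add: mult.commute)

text \<open>
  Each derivative costs a factor \<open>2^k\<close>, the inverse of the scale.
\<close>
lemma dbound_cell: "\<exists>B\<ge>0. \<forall>i\<le>j. \<forall>k z x. dbound (cell k z) (x :: real^'n) i (B * (2 ^ k) ^ i)"
proof -
  have "\<forall>i. \<exists>B\<ge>0. \<forall>x :: real^'n. dbound bump x i B"
    using bump_support[where 'n='n] by (intro allI dbound_compact_support[OF smooth_bump compact_cball[of 0 "real CARD('n)"]]) auto
  then obtain B where B: "\<And>i. B i \<ge> 0" "\<And>i (x :: real^'n). dbound bump x i (B i)" by metis
  have "dbound (cell k z) x i ((\<Sum>i\<le>j. B i) * (2 ^ k) ^ i)" if "i \<le> j" for i k z and x :: "real^'n"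
  proof -
    have "dbound (cell k z) x i (B i * (2 ^ k) ^ i)"
      unfolding cell_def
      by (rule dbound_affine[OF smooth_bump bounded_linear_scaleR_right]) (auto simp: B)
    moreover have "B i \<le> (\<Sum>i\<le>j. B i)" using that B by (intro member_le_sum) auto
    ultimately show ?thesis by (auto elim!: dbound_mono intro!: mult_right_mono)
  qed
  then show ?thesis using B(1) by (meson sum_nonneg)
qed

locale convex_jet =
  fixes C :: "(real^'n) set" and f :: "real^'n \<Rightarrow> real" and P :: "nat \<Rightarrow> real^'n \<Rightarrow> real^'n \<Rightarrow> real"
  assumes compact: "compact C" and convex: "convex C" and nonempty: "C \<noteq> {}"
    and compat: "compatible_family C f P"
    and whitney: "\<And>m. m \<ge> 2 \<Longrightarrow> cond_W P m C"
begin

lemmas jet_simps = jet_smooth[OF compat] jet_dform_eq[OF compat] jet_dform_high[OF compat]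

text \<open>
  Convexity of \<open>C\<close> enters the extension through this map: it is nonexpansive, so
  nearby lattice points carry jets based at nearby points of \<open>C\<close>.
\<close>
abbreviation proj :: "real^'n \<Rightarrow> real^'n" where "proj \<equiv> closest_point C"

definition gap :: "real^'n \<Rightarrow> real" where "gap x = norm (x - proj x)"

lemma closed: "closed C" using compact by (rule compact_imp_closed)

lemma proj_in: "proj x \<in> C" using closest_point_in_set[OF closed nonempty] .

lemma proj_lipschitz: "norm (proj x - proj y) \<le> norm (x - y)"
  using closest_point_lipschitz[OF convex closed nonempty] by (simp add: dist_norm)

lemma gap_lipschitz: "gap x \<le> norm (x - y) + gap y"
  using closest_point_le[OF closed proj_in, of x y] norm_triangle_ineq[of "x - y" "y - proj y"]
  by (simp add: gap_def dist_norm)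

lemma gap_nonneg: "gap x \<ge> 0" by (simp add: gap_def)

lemma gap_zero: "y \<in> C \<Longrightarrow> gap y = 0" by (simp add: gap_def closest_point_self)

lemma continuous_gap: "continuous_on S gap"
  unfolding gap_def by (intro continuous_intros continuous_on_closest_point convex closed nonempty)

lemma open_gap_less: "open {x. gap x < r}"
  by (intro open_Collect_less continuous_gap continuous_intros)

lemma open_gap_greater: "open {x. gap x > r}"
  by (intro open_Collect_less continuous_gap continuous_intros)

lemma radius_exists: "\<exists>R\<ge>0. \<forall>x. norm x \<le> R + gap x"
proof -
  obtain R where R: "R > 0" "\<And>y. y \<in> C \<Longrightarrow> norm y \<le> R"
    using compact_imp_bounded[OF compact] unfolding bounded_pos by blast
  have "norm x \<le> R + gap x" for x
    using R(2)[OF proj_in, of x] norm_triangle_sub[of x "proj x"] by (simp add: gap_def)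
  then show ?thesis using R(1) by (intro exI[of _ R]) auto
qed

text \<open>
  The parameter \<open>D\<close> measures distance to \<open>C\<close> in units of the scale.  The cells of \<open>nodes D k\<close> sum
  to \<open>1\<close> up to distance \<open>D - n\<close> and vanish beyond distance \<open>D + n\<close>.
\<close>
definition nodes :: "real \<Rightarrow> nat \<Rightarrow> ('n \<Rightarrow> int) set" where
  "nodes D k = {z. gap (node k z) \<le> D * (1/2) ^ k}"

text \<open>
  The number of cells at scale \<open>2^-k\<close> is at most a multiple of \<open>2^(kn)\<close>.  Estimating a sum over cells
  by this number loses a fixed power of \<open>2^k\<close>, which the growing degree of the polynomials absorbs.
\<close>
lemma nodes_bound: "D \<ge> 0 \<Longrightarrow> \<exists>c\<ge>0. \<forall>k. finite (nodes D k) \<and> real (card (nodes D k)) \<le> c * (2 ^ k) ^ CARD('n)"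
proof -
  assume D: "D \<ge> 0"
  obtain R where R: "R \<ge> 0" "\<And>x. norm x \<le> R + gap x" using radius_exists by blast
  have *: "finite (nodes D k) \<and> real (card (nodes D k)) \<le> (2 * (R + D) + 1) ^ CARD('n) * (2 ^ k) ^ CARD('n)" for k
  proof -
    have sub: "nodes D k \<subseteq> {z. norm (lat z) \<le> (R + D) * 2 ^ k}"
    proof
      fix z assume z: "z \<in> nodes D k"
      have "norm (node k z) \<le> R + D * (1/2) ^ k" using R(2)[of "node k z"] z by (simp add: nodes_def)
      also have "\<dots> \<le> R + D" using D by (simp add: mult_left_le power_le_one)
      finally have "norm (lat z) * (1/2) ^ k \<le> R + D" by (simp add: node_def mult.commute)
      then have "norm (lat z) * (1/2) ^ k * 2 ^ k \<le> (R + D) * 2 ^ k" by (intro mult_right_mono) auto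
      then show "z \<in> {z. norm (lat z) \<le> (R + D) * 2 ^ k}" by (simp add: mult.assoc half_power_inverse)
    qed
    have "real (card (nodes D k)) \<le> real (card {z :: 'n \<Rightarrow> int. norm (lat z) \<le> (R + D) * 2 ^ k})"
      using card_mono[OF finite_lat sub] by simp
    also have "\<dots> \<le> (2 * ((R + D) * 2 ^ k) + 1) ^ CARD('n)"
      using R D by (intro card_lat) auto
    also have "\<dots> \<le> ((2 * (R + D) + 1) * 2 ^ k) ^ CARD('n)"
      using R D by (intro power_mono) (auto simp: algebra_simps)
    finally show ?thesis using finite_subset[OF sub finite_lat] by (simp add: power_mult_distrib)
  qed
  have "(2 * (R + D) + 1) ^ CARD('n) \<ge> 0" using R(1) D by simp
  with * show ?thesis by blast
qed

lemma finite_nodes: "D \<ge> 0 \<Longrightarrow> finite (nodes D k)"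
  using nodes_bound by blast

lemma cell_partition:
  assumes "D \<ge> 0" "gap x \<le> (D - real CARD('n)) * (1/2) ^ k"
  shows "(\<Sum>z\<in>nodes D k. cell k z x) = 1"
proof -
  have "{z. norm (2 ^ k *\<^sub>R x - lat z) \<le> real CARD('n)} \<subseteq> nodes D k"
  proof (clarsimp simp: nodes_def)
    fix z assume "norm (2 ^ k *\<^sub>R x - lat z) \<le> real CARD('n)"
    then have "norm (x - node k z) \<le> real CARD('n) * (1/2) ^ k" by (simp add: norm_node_diff mult.commute)
    then have "gap (node k z) \<le> real CARD('n) * (1/2) ^ k + (D - real CARD('n)) * (1/2) ^ k"
      using gap_lipschitz[of "node k z" x] assms by (simp add: norm_minus_commute)
    then show "gap (node k z) \<le> D * (1/2) ^ k" by (simp add: algebra_simps)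
  qed
  from bump_partition[OF finite_nodes[OF assms(1)] this] show ?thesis by (simp add: cell_def)
qed

lemma cell_far:
  assumes "z \<in> nodes D k" "gap x > (D + real CARD('n)) * (1/2) ^ k" shows "norm (x - node k z) > real CARD('n) * (1/2) ^ k"
  using gap_lipschitz[of x "node k z"] assms by (simp add: nodes_def algebra_simps)

text \<open>
  The choice \<open>D = 2n\<close> makes it \<open>1\<close> up to distance \<open>n 2^-k\<close> from \<open>C\<close>, hence on a neighbourhood of \<open>C\<close>,
  and \<open>0\<close> beyond distance \<open>3n 2^-k\<close>.
\<close>
definition cutoff :: "nat \<Rightarrow> real^'n \<Rightarrow> real" where
  "cutoff k x = (\<Sum>z\<in>nodes (2 * real CARD('n)) k. cell k z x)"

lemma smooth_cutoff: "smooth (cutoff k)"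
  unfolding cutoff_def by (intro smooth_sum smooth_cell)

lemma cutoff_eq_1: "gap x \<le> real CARD('n) * (1/2) ^ k \<Longrightarrow> cutoff k x = 1"
  unfolding cutoff_def by (rule cell_partition) auto

lemma cutoff_eq_0: "gap x > 3 * real CARD('n) * (1/2) ^ k \<Longrightarrow> cutoff k x = 0"
  unfolding cutoff_def using cell_far[of _ "2 * real CARD('n)" k x] cell_support[of k x] by (intro sum.neutral) auto

lemma dbound_cutoff: "\<exists>B\<ge>0. \<forall>i\<le>j. \<forall>k x. dbound (cutoff k) x i (B * (2 ^ k) ^ CARD('n) * (2 ^ k) ^ i)"
proof -
  obtain c where c: "c \<ge> 0" "\<And>k. real (card (nodes (2 * real CARD('n)) k)) \<le> c * (2 ^ k) ^ CARD('n)"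
    using nodes_bound[of "2 * real CARD('n)"] by auto
  obtain B where B: "B \<ge> 0" "\<And>i k z (x :: real^'n). i \<le> j \<Longrightarrow> dbound (cell k z) x i (B * (2 ^ k) ^ i)"
    using dbound_cell[of j, where 'n='n] by blast
  have "dbound (cutoff k) x i (c * B * (2 ^ k) ^ CARD('n) * (2 ^ k) ^ i)" if "i \<le> j" for i k x
  proof -
    have "dbound (cutoff k) x i (\<Sum>z\<in>nodes (2 * real CARD('n)) k. B * (2 ^ k) ^ i)"
      unfolding cutoff_def using B(2)[OF that] by (intro dbound_sum smooth_cell)
    moreover have "(\<Sum>z\<in>nodes (2 * real CARD('n)) k. B * (2 ^ k) ^ i) \<le> c * (2 ^ k) ^ CARD('n) * (B * (2 ^ k) ^ i)"
      using B(1) c(2)[of k] by (simp add: mult_right_mono)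
    ultimately show ?thesis by (auto elim!: dbound_mono simp: mult_ac)
  qed
  then show ?thesis using B(1) c(1) by (meson mult_nonneg_nonneg)
qed

text \<open>
  The jets of order \<open>m\<close>, glued at scale \<open>2^-k\<close>.  With \<open>D = 8n\<close> the cells sum to \<open>1\<close> up to distance
  \<open>7n 2^-k\<close>.  Half of this exceeds \<open>3n 2^-k\<close>, so on the support of \<open>cutoff k\<close> the partition of unity
  is complete for the scales \<open>k\<close> and \<open>k + 1\<close> alike.
\<close>
definition patch :: "nat \<Rightarrow> nat \<Rightarrow> real^'n \<Rightarrow> real" where
  "patch m k x = (\<Sum>z\<in>nodes (8 * real CARD('n)) k. cell k z x * P m (proj (node k z)) x)"

lemma smooth_patch: "smooth (patch m k)"
  unfolding patch_def by (intro smooth_sum smooth_mult smooth_cell jet_simps proj_in)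

lemma patch_support: "gap x > 9 * real CARD('n) * (1/2) ^ k \<Longrightarrow> patch m k x = 0"
  unfolding patch_def using cell_far[of _ "8 * real CARD('n)" k x] cell_support[of k x] by (intro sum.neutral) auto

text \<open>
  \<open>(W^m)\<close> controls the difference of two jets at the base point \<open>b\<close>; re-expansion at \<open>b\<close> carries the
  estimate to points \<open>x\<close> at distance comparable to that of the base points.
\<close>
lemma dbound_jet_diff:
  assumes ab: "a \<in> C" "b \<in> C" "norm (a - b) \<le> r" "norm (x - b) \<le> r" and j: "j \<le> m"
    and W: "\<And>i. i \<le> m \<Longrightarrow> dbound (\<lambda>x. P m a x - P m b x) b i (norm (a - b) ^ (m - i))"
  shows "dbound (\<lambda>x. P m a x - P m b x) x j (real (Suc m) * r ^ (m - j))"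
  unfolding dbound_def
proof (intro allI impI)
  fix us :: "(real^'n) list" assume us: "length us = j"
  let ?D = "\<lambda>x. P m a x - P m b x"
  have r0: "r \<ge> 0" using order_trans[OF norm_ge_zero ab(3)] .
  have dD: "dform ?D x us = dform (P m a) x us - dform (P m b) x us" for x us
    by (intro dform_diff jet_simps ab)
  have "dform ?D x us = (\<Sum>i\<le>m - j. dform ?D b (us @ replicate i (x - b)) / fact i)"
    unfolding dD using jet_expansion[OF compat ab(1), of us m x b] jet_expansion[OF compat ab(2), of us m x b] us j
    by (simp add: sum_subtractf diff_divide_distrib)
  also have "\<bar>\<dots>\<bar> \<le> (\<Sum>i\<le>m - j. \<bar>dform ?D b (us @ replicate i (x - b)) / fact i\<bar>)" by (rule sum_abs)
  also have "\<dots> \<le> (\<Sum>i\<le>m - j. r ^ (m - j) * norm_prod us)"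
  proof (rule sum_mono)
    fix i assume i: "i \<in> {..m - j}"
    have "\<bar>dform ?D b (us @ replicate i (x - b)) / fact i\<bar> \<le> \<bar>dform ?D b (us @ replicate i (x - b))\<bar>"
      using fact_ge_1[of i, where 'a=real] by (simp add: divide_le_eq mult_le_cancel_left1)
    also have "\<dots> \<le> norm (a - b) ^ (m - (j + i)) * (norm_prod us * norm (x - b) ^ i)"
      using dboundD[of ?D b "us @ replicate i (x - b)"] W[of "j + i"] us i j by (simp add: norm_prod_replicate)
    also have "\<dots> \<le> r ^ (m - (j + i)) * (norm_prod us * r ^ i)"
      using ab norm_prod_nonneg r0 by (intro mult_mono power_mono mult_left_mono) auto
    also have "\<dots> = r ^ (m - j) * norm_prod us"
      using i j by (simp add: mult_ac flip: power_add)
    finally show "\<bar>dform ?D b (us @ replicate i (x - b)) / fact i\<bar> \<le> r ^ (m - j) * norm_prod us" .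
  qed
  also have "\<dots> \<le> real (Suc m) * r ^ (m - j) * norm_prod us"
    using mult_right_mono[of "real (Suc (m - j))" "real (Suc m)" "r ^ (m - j) * norm_prod us"] norm_prod_nonneg[of us] r0
    by (simp add: mult.assoc)
  finally show "\<bar>dform ?D x us\<bar> \<le> real (Suc m) * r ^ (m - j) * norm_prod us" .
qed

text \<open>
  Near \<open>C\<close> the cells sum to \<open>1\<close>, so the difference of \<open>patch m k\<close> and the jet at the nearest point of
  \<open>x\<close> is a sum of cells times differences of jets.  A derivative of order \<open>i\<close> of a cell costs \<open>2^(ki)\<close>,
  while the difference of jets, differentiated \<open>j - i\<close> times, is of order \<open>2^(-k(m - j + i))\<close>; so the
  losses cancel in every term of the Leibniz rule.
\<close>
lemma patch_estimate:
  assumes m: "m \<ge> 2"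
  shows "\<exists>A\<ge>0. \<forall>\<^sub>F k in sequentially. \<forall>x j. gap x < 7 * real CARD('n) * (1/2) ^ k \<longrightarrow> j \<le> m \<longrightarrow>
    dbound (\<lambda>z. patch m k z - P m (proj x) z) x j (A * (2 ^ k) ^ CARD('n) * ((1/2) ^ k) ^ (m - j))"
proof -
  obtain \<delta> where \<delta>: "\<delta> > 0"
    "\<And>j y z. j \<le> m \<Longrightarrow> y \<in> C \<Longrightarrow> z \<in> C \<Longrightarrow> norm (y - z) \<le> \<delta> \<Longrightarrow>
       dbound (\<lambda>x. P m y x - P m z x) z j (1 * norm (y - z) ^ (m - j))"
    using cond_W_bound[OF compat whitney[OF m] compact zero_less_one] by blast
  obtain B where B: "B \<ge> 0" "\<And>i k z (x :: real^'n). i \<le> m \<Longrightarrow> dbound (cell k z) x i (B * (2 ^ k) ^ i)"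
    using dbound_cell[of m, where 'n='n] by blast
  obtain c where c: "c \<ge> 0" "\<And>k. real (card (nodes (8 * real CARD('n)) k)) \<le> c * (2 ^ k) ^ CARD('n)"
    using nodes_bound[of "8 * real CARD('n)"] by auto
  define A where "A = B * (real (Suc m) * (7 * real CARD('n)) ^ m)"
  have A: "A \<ge> 0" using B(1) by (simp add: A_def)
  have est: "dbound (\<lambda>z. patch m k z - P m (proj x) z) x j (c * 2 ^ m * A * (2 ^ k) ^ CARD('n) * ((1/2) ^ k) ^ (m - j))"
    if k: "real CARD('n) * (1/2) ^ k \<le> \<delta>" and x: "gap x < 7 * real CARD('n) * (1/2) ^ k" and j: "j \<le> m" for k x j
  proof -
    define h :: real where "h = (1/2) ^ k"
    have h: "h > 0" "h * 2 ^ k = 1" by (simp_all add: h_def half_power_inverse)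
    define b where "b = proj x"
    have bC: "b \<in> C" by (simp add: b_def proj_in)
    let ?E = "\<lambda>z y. cell k z y * (P m (proj (node k z)) y - P m b y)"
    \<comment> \<open>The base point \<open>b\<close> stays fixed while \<open>y\<close> varies, so this identity may be differentiated.\<close>
    have local: "patch m k y - P m b y = (\<Sum>z\<in>nodes (8 * real CARD('n)) k. ?E z y)" if "y \<in> {y. gap y < 7 * real CARD('n) * (1/2) ^ k}" for y
    proof -
      have "(\<Sum>z\<in>nodes (8 * real CARD('n)) k. cell k z y) = 1"
        using that by (intro cell_partition) auto
      then show ?thesis
        unfolding patch_def by (simp add: right_diff_distrib sum_subtractf flip: sum_distrib_right)
    qed
    have sD: "smooth (\<lambda>y. P m (proj (node k z)) y - P m b y)" for z
      by (intro smooth_diff jet_simps proj_in bC)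
    have cell_est: "dbound (?E z) x j (2 ^ j * (A * h ^ (m - j)))" for z
    proof (cases "norm (x - node k z) > real CARD('n) * (1/2) ^ k")
      case True
      show ?thesis
      proof (rule dbound_zero_open)
        show "open {x. norm (x - node k z) > real CARD('n) * (1/2) ^ k}" by (intro open_Collect_less continuous_intros)
      qed (use True cell_support A h in auto)
    next
      case False
      have 1: "norm (proj (node k z) - b) \<le> real CARD('n) * h"
        using False proj_lipschitz[of "node k z" x] by (simp add: b_def h_def norm_minus_commute)
      have 2: "norm (x - b) \<le> 7 * real CARD('n) * h" using x by (simp add: gap_def b_def h_def)
      have r: "norm (proj (node k z) - b) \<le> 7 * real CARD('n) * h" using 1 h(1) mult_nonneg_nonneg[of "real CARD('n)" h] by linarith
      have diff: "dbound (\<lambda>y. P m (proj (node k z)) y - P m b y) x i (real (Suc m) * (7 * real CARD('n) * h) ^ (m - i))" if "i \<le> m" for i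
        using \<delta>(2)[OF _ proj_in bC] 1 k that
        by (intro dbound_jet_diff[OF proj_in bC r 2]) (auto simp: h_def)
      show ?thesis
      proof (rule dbound_mult[OF smooth_cell sD, where A = "\<lambda>i. B * (2 ^ k) ^ i" and B = "\<lambda>i. real (Suc m) * (7 * real CARD('n) * h) ^ (m - i)"])
        fix i assume i: "i \<le> j"
        show "dbound (cell k z) x i (B * (2 ^ k) ^ i)" using B i j by simp
        show "dbound (\<lambda>y. P m (proj (node k z)) y - P m b y) x i (real (Suc m) * (7 * real CARD('n) * h) ^ (m - i))" using diff i j by simp
        show "0 \<le> B * (2 ^ k) ^ i" using B by simp
        have e: "m - (j - i) = (m - j) + i" using i j by simp
        have N1: "7 * real CARD('n) \<ge> 1" using card_ge_1[where 'n='n] by linarith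
        have "B * (2 ^ k) ^ i * (real (Suc m) * (7 * real CARD('n) * h) ^ (m - (j - i)))
           = B * (real (Suc m) * (7 * real CARD('n)) ^ (m - (j - i))) * h ^ (m - j) * (h * 2 ^ k) ^ i"
          unfolding power_mult_distrib e power_add by (simp add: mult_ac)
        also have "\<dots> = B * (real (Suc m) * (7 * real CARD('n)) ^ (m - (j - i))) * h ^ (m - j)" by (simp add: h)
        also have "\<dots> \<le> A * h ^ (m - j)"
          unfolding A_def using B(1) h(1) N1 by (intro mult_right_mono mult_left_mono power_increasing) auto
        finally show "B * (2 ^ k) ^ i * (real (Suc m) * (7 * real CARD('n) * h) ^ (m - (j - i))) \<le> A * h ^ (m - j)" .
      qed
    qed
    have "dbound (\<lambda>y. \<Sum>z\<in>nodes (8 * real CARD('n)) k. ?E z y) x j (\<Sum>z\<in>nodes (8 * real CARD('n)) k. 2 ^ j * (A * h ^ (m - j)))"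
      by (intro dbound_sum cell_est smooth_mult smooth_cell sD)
    then have "dbound (\<lambda>y. patch m k y - P m b y) x j (\<Sum>z\<in>nodes (8 * real CARD('n)) k. 2 ^ j * (A * h ^ (m - j)))"
      using dbound_cong[OF open_gap_less, of x "7 * real CARD('n) * (1/2) ^ k" "\<lambda>y. patch m k y - P m b y" "\<lambda>y. \<Sum>z\<in>nodes (8 * real CARD('n)) k. ?E z y"] local x
      by auto
    moreover have "(\<Sum>z\<in>nodes (8 * real CARD('n)) k. 2 ^ j * (A * h ^ (m - j))) \<le> c * (2 ^ k) ^ CARD('n) * (2 ^ m * (A * h ^ (m - j)))"
      unfolding sum_constant
      using c A h(1) j by (intro mult_mono mult_right_mono power_increasing) auto
    ultimately show ?thesis by (auto elim!: dbound_mono simp: b_def h_def mult_ac)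
  qed
  have "(\<lambda>k. real CARD('n) * (1/2) ^ k) \<longlonglongrightarrow> real CARD('n) * 0" by (intro tendsto_intros LIMSEQ_power_zero) auto
  then have "\<forall>\<^sub>F k in sequentially. real CARD('n) * (1/2) ^ k < \<delta>" using \<delta>(1) order_tendstoD(2) by fastforce
  then have "\<forall>\<^sub>F k in sequentially. \<forall>x j. gap x < 7 * real CARD('n) * (1/2) ^ k \<longrightarrow> j \<le> m \<longrightarrow>
    dbound (\<lambda>z. patch m k z - P m (proj x) z) x j (c * 2 ^ m * A * (2 ^ k) ^ CARD('n) * ((1/2) ^ k) ^ (m - j))"
    by eventually_elim (use est in auto)
  then show ?thesis using A c(1) by (intro exI[of _ "c * 2 ^ m * A"]) auto
qed

text \<open>
  By \<open>(W^m)\<close> the jets at the points of a finite net bound all the others.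
\<close>
lemma jet_bounded:
  assumes m: "m \<ge> 2"
  shows "\<exists>B\<ge>0. \<forall>y\<in>C. \<forall>j\<le>m. dbound (P m y) y j B"
proof -
  obtain \<delta> where \<delta>: "\<delta> > 0"
    "\<And>j y z. j \<le> m \<Longrightarrow> y \<in> C \<Longrightarrow> z \<in> C \<Longrightarrow> norm (y - z) \<le> \<delta> \<Longrightarrow>
       dbound (\<lambda>x. P m y x - P m z x) z j (1 * norm (y - z) ^ (m - j))"
    using cond_W_bound[OF compat whitney[OF m] compact zero_less_one] by blast
  define r where "r = min \<delta> 1"
  have r: "r > 0" "r \<le> \<delta>" "r \<le> 1" using \<delta>(1) by (auto simp: r_def)
  obtain T where T: "T \<subseteq> C" "finite T" "C \<subseteq> (\<Union>y\<in>T. ball y r)"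
    using compactE_image[OF compact, of C "\<lambda>y. ball y r"] r(1) by (metis (no_types, lifting) UN_I centre_in_ball open_ball subsetI)
  have "\<forall>y\<in>T. \<forall>j. \<exists>B\<ge>0. \<forall>z\<in>C. dbound (P m y) z j B"
    using dbound_compact[OF jet_simps(1) compact] T(1) by blast
  then obtain B where B: "\<And>y j. y \<in> T \<Longrightarrow> B y j \<ge> 0" "\<And>y j z. y \<in> T \<Longrightarrow> z \<in> C \<Longrightarrow> dbound (P m y) z j (B y j)" by metis
  define M where "M = (\<Sum>y\<in>T. \<Sum>j\<le>m. B y j)"
  have M: "B y j \<le> M" if "y \<in> T" "j \<le> m" for y j
  proof -
    have "B y j \<le> (\<Sum>j\<le>m. B y j)" using that B by (intro member_le_sum) auto
    also have "\<dots> \<le> M" unfolding M_def using that B T(2) by (intro member_le_sum[where f = "\<lambda>y. \<Sum>j\<le>m. B y j"]) (auto intro: sum_nonneg)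
    finally show ?thesis .
  qed
  have "dbound (P m z) z j (M + 1)" if z: "z \<in> C" and j: "j \<le> m" for z j
  proof -
    obtain y where y: "y \<in> T" "dist y z < r" using T(3) z by auto
    have yC: "y \<in> C" using y T by auto
    have "dbound (\<lambda>x. P m y x - P m z x) z j (1 * norm (y - z) ^ (m - j))"
      using y r by (intro \<delta>(2) yC z j) (auto simp: dist_norm)
    moreover have "norm (y - z) ^ (m - j) \<le> 1"
      using y r by (intro power_le_one) (auto simp: dist_norm)
    ultimately have "dbound (\<lambda>x. P m y x - P m z x) z j 1" by (auto elim: dbound_mono)
    from dbound_diff[OF jet_simps(1) smooth_diff[OF jet_simps(1) jet_simps(1)] B(2)[OF y(1) z] this] yC z
    have "dbound (P m z) z j (B y j + 1)" by simp
    then show ?thesis using M[OF y(1) j] by (auto elim: dbound_mono)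
  qed
  moreover have "M \<ge> 0" unfolding M_def using B by (intro sum_nonneg) auto
  ultimately show ?thesis by (intro exI[of _ "M + 1"]) auto
qed

text \<open>
  By compatibility two jets of different degree at one point differ by terms of order larger than the
  smaller degree.
\<close>
lemma jet_degree_estimate:
  assumes m: "m \<ge> 2"
  shows "\<exists>A\<ge>0. \<forall>k x l j. l \<le> m \<longrightarrow> j \<le> l \<longrightarrow> gap x < 7 * real CARD('n) * (1/2) ^ k \<longrightarrow>
    dbound (\<lambda>z. P m (proj x) z - P l (proj x) z) x j (A * ((1/2) ^ k) ^ (Suc l - j))"
proof -
  obtain B where B: "B \<ge> 0" "\<And>y j. y \<in> C \<Longrightarrow> j \<le> m \<Longrightarrow> dbound (P m y) y j B" using jet_bounded[OF m] by blast
  define A where "A = real (Suc m) * (B * (7 * real CARD('n)) ^ m)"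
  have "dbound (\<lambda>z. P m (proj x) z - P l (proj x) z) x j (A * ((1/2) ^ k) ^ (Suc l - j))"
    if l: "l \<le> m" "j \<le> l" and x: "gap x < 7 * real CARD('n) * (1/2) ^ k" for k x l j
    unfolding dbound_def
  proof (intro allI impI)
    fix us :: "(real^'n) list" assume us: "length us = j"
    define h :: real where "h = (1/2) ^ k"
    have h: "0 < h" "h \<le> 1" by (simp_all add: h_def power_le_one)
    define b where "b = proj x"
    have bC: "b \<in> C" by (simp add: b_def proj_in)
    have xb: "norm (x - b) \<le> 7 * real CARD('n) * h" using x by (simp add: gap_def b_def h_def)
    have N1: "7 * real CARD('n) \<ge> 1" using card_ge_1[where 'n='n] by linarith
    let ?t = "\<lambda>i. dform (P m b) b (us @ replicate i (x - b)) / fact i"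
    have "dform (P l b) x us = (\<Sum>i\<le>l - j. ?t i)"
      using jet_expansion[OF compat bC, of us l x b] us l
      by (simp add: jet_simps(2)[OF bC, of _ l m])
    moreover have "dform (P m b) x us = (\<Sum>i\<le>m - j. ?t i)"
      using jet_expansion[OF compat bC, of us m x b] us l by simp
    moreover have "(\<Sum>i\<le>m - j. ?t i) - (\<Sum>i\<le>l - j. ?t i) = (\<Sum>i\<in>{..m - j} - {..l - j}. ?t i)"
      using l by (intro sum_diff[symmetric]) auto
    ultimately have "dform (\<lambda>z. P m b z - P l b z) x us = (\<Sum>i\<in>{..m - j} - {..l - j}. ?t i)"
      by (simp add: dform_diff jet_simps bC)
    also have "\<bar>\<dots>\<bar> \<le> (\<Sum>i\<in>{..m - j} - {..l - j}. \<bar>?t i\<bar>)" by (rule sum_abs)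
    also have "\<dots> \<le> (\<Sum>i\<in>{..m - j} - {..l - j}. B * (7 * real CARD('n)) ^ m * h ^ (Suc l - j) * norm_prod us)"
    proof (rule sum_mono)
      fix i assume i: "i \<in> {..m - j} - {..l - j}"
      then have ji: "j + i \<le> m" using l by auto
      have "\<bar>?t i\<bar> \<le> \<bar>dform (P m b) b (us @ replicate i (x - b))\<bar>"
        using fact_ge_1[of i, where 'a=real] by (simp add: divide_le_eq mult_le_cancel_left1)
      also have "\<dots> \<le> B * (norm_prod us * norm (x - b) ^ i)"
        using dboundD[of "P m b" b "us @ replicate i (x - b)" B] B(2)[OF bC, of "j + i"] us ji by (simp add: norm_prod_replicate)
      also have "\<dots> \<le> B * (norm_prod us * ((7 * real CARD('n)) ^ m * h ^ (Suc l - j)))"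
      proof -
        have "norm (x - b) ^ i \<le> (7 * real CARD('n) * h) ^ i" using xb by (intro power_mono) auto
        also have "\<dots> = (7 * real CARD('n)) ^ i * h ^ i" by (simp add: power_mult_distrib)
        also have "\<dots> \<le> (7 * real CARD('n)) ^ m * h ^ (Suc l - j)"
          using i l h N1 by (intro mult_mono power_increasing power_decreasing) auto
        finally show ?thesis using B(1) norm_prod_nonneg by (intro mult_left_mono) auto
      qed
      finally show "\<bar>?t i\<bar> \<le> B * (7 * real CARD('n)) ^ m * h ^ (Suc l - j) * norm_prod us" by (simp add: mult_ac)
    qed
    also have "\<dots> = real (card ({..m - j} - {..l - j})) * (B * (7 * real CARD('n)) ^ m * h ^ (Suc l - j) * norm_prod us)" by simp
    also have "\<dots> \<le> real (Suc m) * (B * (7 * real CARD('n)) ^ m * h ^ (Suc l - j) * norm_prod us)"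
    proof (rule mult_right_mono)
      have "card ({..m - j} - {..l - j}) \<le> card {..m}" by (intro card_mono) auto
      then show "real (card ({..m - j} - {..l - j})) \<le> real (Suc m)" by simp
      show "0 \<le> B * (7 * real CARD('n)) ^ m * h ^ (Suc l - j) * norm_prod us"
        using B(1) h norm_prod_nonneg by (intro mult_nonneg_nonneg) auto
    qed
    finally show "\<bar>dform (\<lambda>z. P m (proj x) z - P l (proj x) z) x us\<bar> \<le> A * ((1/2) ^ k) ^ (Suc l - j) * norm_prod us"
      by (simp add: A_def b_def h_def mult_ac)
  qed
  moreover have "A \<ge> 0" using B(1) by (simp add: A_def)
  ultimately show ?thesis by blast
qed

text \<open>
  The estimates of \<open>patch_estimate\<close> and \<open>jet_degree_estimate\<close> at scale \<open>k\<close>, with the constants, which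
  depend on \<open>m\<close> in an uncontrolled way, replaced by \<open>2^k\<close>.  A degree that grows slowly enough with \<open>k\<close>
  satisfies them at every large scale.
\<close>
definition tame :: "nat \<Rightarrow> nat \<Rightarrow> bool" where
  "tame m k \<longleftrightarrow>
     (\<forall>x j. gap x < 7 * real CARD('n) * (1/2) ^ k \<longrightarrow> j \<le> m \<longrightarrow>
        dbound (\<lambda>z. patch m k z - P m (proj x) z) x j ((2 ^ k) ^ Suc CARD('n) * ((1/2) ^ k) ^ (m - j))) \<and>
     (\<forall>x l j. gap x < 7 * real CARD('n) * (1/2) ^ k \<longrightarrow> l \<le> m \<longrightarrow> j \<le> l \<longrightarrow>
        dbound (\<lambda>z. P m (proj x) z - P l (proj x) z) x j (2 ^ k * ((1/2) ^ k) ^ (Suc l - j)))"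

lemma eventually_tame:
  assumes "m \<ge> 2" shows "\<forall>\<^sub>F k in sequentially. tame m k"
proof -
  obtain A where A: "\<forall>\<^sub>F k in sequentially. \<forall>x j. gap x < 7 * real CARD('n) * (1/2) ^ k \<longrightarrow> j \<le> m \<longrightarrow>
    dbound (\<lambda>z. patch m k z - P m (proj x) z) x j (A * (2 ^ k) ^ CARD('n) * ((1/2) ^ k) ^ (m - j))"
    using patch_estimate[OF assms] by blast
  obtain A' where A': "\<And>k x l j. l \<le> m \<Longrightarrow> j \<le> l \<Longrightarrow> gap x < 7 * real CARD('n) * (1/2) ^ k \<Longrightarrow>
    dbound (\<lambda>z. P m (proj x) z - P l (proj x) z) x j (A' * ((1/2) ^ k) ^ (Suc l - j))"
    using jet_degree_estimate[OF assms] by blast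
  have "\<forall>\<^sub>F k in sequentially. max A A' \<le> 2 ^ k"
  proof -
    obtain K :: nat where "max A A' < 2 ^ K" using real_arch_pow[of 2 "max A A'"] by auto
    then have "max A A' \<le> 2 ^ k" if "k \<ge> K" for k
      using power_increasing[OF that, of "2 :: real"] by linarith
    then show ?thesis unfolding eventually_sequentially by blast
  qed
  with A show ?thesis
  proof eventually_elim
    case (elim k)
    have "A * (2 ^ k) ^ CARD('n) * ((1/2) ^ k) ^ (m - j) \<le> (2 ^ k) ^ Suc CARD('n) * ((1/2) ^ k) ^ (m - j)" for j
      using elim(2) unfolding power_Suc by (intro mult_right_mono) auto
    moreover have "A' * ((1/2) ^ k) ^ (Suc l - j) \<le> 2 ^ k * ((1/2) ^ k) ^ (Suc l - j)" for l j
      using elim(2) by (intro mult_right_mono) auto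
    ultimately show ?case
      unfolding tame_def using elim(1) A' dbound_mono by (meson)
  qed
qed

text \<open>
  Consecutive patches are compared through the jets of degree \<open>m'\<close> and \<open>m\<close> at the nearest point.
\<close>
lemma patch_increment_estimate:
  assumes tame: "tame m k" "tame m' (Suc k)" and m: "m \<le> m'" "j \<le> m" and x: "gap x < 7/2 * real CARD('n) * (1/2) ^ k"
  shows "dbound (\<lambda>z. patch m' (Suc k) z - patch m k z) x j ((2 ^ Suc CARD('n) + 3) * (2 ^ k) ^ Suc CARD('n) * ((1/2) ^ k) ^ (m - j))"
proof -
  define h :: real where "h = (1/2) ^ k"
  define p :: real where "p = 2 ^ k"
  define b where "b = proj x"
  have h: "0 < h" "h \<le> 1" and p: "p \<ge> 1" by (simp_all add: h_def p_def power_le_one)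
  have h': "(1/2) ^ Suc k = h / 2" and p': "2 ^ Suc k = 2 * p" by (simp_all add: h_def p_def)
  have bC: "b \<in> C" by (simp add: b_def proj_in)
  have x': "gap x < 7 * real CARD('n) * (1/2) ^ Suc k" "gap x < 7 * real CARD('n) * (1/2) ^ k"
    using x gap_nonneg[of x] by auto
  have hle: "(h/2) ^ (m' - j) \<le> h ^ (m - j)"
  proof -
    have "(h/2) ^ (m' - j) \<le> (h/2) ^ (m - j)" using h m by (intro power_decreasing) auto
    also have "\<dots> \<le> h ^ (m - j)" using h by (intro power_mono) auto
    finally show ?thesis .
  qed
  have hle': "(h/2) ^ (Suc m - j) \<le> h ^ (m - j)"
  proof -
    have "(h/2) ^ (Suc m - j) \<le> (h/2) ^ (m - j)" using h by (intro power_decreasing) auto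
    also have "\<dots> \<le> h ^ (m - j)" using h by (intro power_mono) auto
    finally show ?thesis .
  qed
  let ?Q = "p ^ Suc CARD('n) * h ^ (m - j)"
  have "dbound (\<lambda>z. patch m' (Suc k) z - P m' b z) x j ((2 * p) ^ Suc CARD('n) * (h/2) ^ (m' - j))"
    using tame(2) x'(1) m unfolding tame_def b_def h' p' by auto
  then have 1: "dbound (\<lambda>z. patch m' (Suc k) z - P m' b z) x j (2 ^ Suc CARD('n) * ?Q)"
    by (rule dbound_mono) (use hle p in \<open>simp add: power_mult_distrib mult_left_mono mult.assoc\<close>)
  have 2: "dbound (\<lambda>z. patch m k z - P m b z) x j ?Q"
    using tame(1) x'(2) m unfolding tame_def b_def h_def p_def by auto
  have "dbound (\<lambda>z. P m' b z - P m b z) x j (2 * p * (h/2) ^ (Suc m - j))"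
    using tame(2) x'(1) m unfolding tame_def b_def h' p' by auto
  then have 3: "dbound (\<lambda>z. P m' b z - P m b z) x j (2 * ?Q)"
  proof (rule dbound_mono)
    have "p \<le> p ^ Suc CARD('n)" using p by (simp add: mult_le_cancel_left1)
    then have "p * (h/2) ^ (Suc m - j) \<le> ?Q" using hle' h p by (intro mult_mono) auto
    then show "2 * p * (h/2) ^ (Suc m - j) \<le> 2 * ?Q" by simp
  qed
  have "dbound (\<lambda>z. ((patch m' (Suc k) z - P m' b z) - (patch m k z - P m b z)) + (P m' b z - P m b z)) x j
     (2 ^ Suc CARD('n) * ?Q + ?Q + 2 * ?Q)"
    by (intro dbound_add dbound_diff 1 2 3 smooth_add smooth_diff smooth_patch jet_simps bC)
  then show ?thesis by (simp add: h_def p_def algebra_simps)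
qed

text \<open>
  The increments of the patches, cut off near \<open>C\<close>, have derivatives of order \<open>j\<close> bounded by
  \<open>2^(k(2n + 1)) 2^(-k(\<mu> k - j))\<close> up to a factor depending on \<open>j\<close>.  Since \<open>\<mu> k\<close> tends to infinity, this
  is summable for every \<open>j\<close>, and the series is smooth on the whole space.  On \<open>C\<close> the cutoffs are
  locally \<open>1\<close>, and the partial sums are patches, whose derivatives converge to those of the jet.
\<close>
theorem whitney_extension:
  "\<exists>F R. smooth F \<and> (\<forall>x. norm x > R \<longrightarrow> F x = 0) \<and>
     (\<forall>y\<in>C. \<forall>m us. length us \<le> m \<longrightarrow> dform F y us = dform (P m y) y us)"
proof -
  \<comment> \<open>The Whitney condition is assumed from order \<open>2\<close> on, whence the shift by \<open>2\<close>.\<close>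
  obtain \<nu> k0 where \<nu>: "mono \<nu>" "filterlim \<nu> at_top sequentially" "\<And>k. k \<ge> k0 \<Longrightarrow> tame (\<nu> k + 2) k"
    using slow_sequence[of "\<lambda>m. tame (m + 2)"] eventually_tame by (metis le_add2)
  define \<mu> where "\<mu> k = \<nu> k + 2" for k
  have \<mu>: "\<mu> k \<le> \<mu> (Suc k)" "k \<ge> k0 \<Longrightarrow> tame (\<mu> k) k" for k
    using \<nu> by (auto simp: \<mu>_def mono_def)
  have \<mu>_ge: "\<forall>\<^sub>F k in sequentially. \<mu> k \<ge> M" for M
    using \<nu>(2) unfolding filterlim_at_top \<mu>_def by (auto elim!: eventually_mono allE[of _ M])
  define E where "E k = (\<lambda>x. patch (\<mu> (Suc k)) (Suc k) x - patch (\<mu> k) k x)" for k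
  define T where "T k = (\<lambda>x. cutoff k x * E k x)" for k
  have sE: "smooth (E k)" for k unfolding E_def by (intro smooth_diff smooth_patch)
  have sT: "smooth (T k)" for k unfolding T_def by (intro smooth_mult smooth_cutoff sE)
  have Tbound: "\<exists>c\<ge>0. \<forall>k\<ge>k0. j \<le> \<mu> k \<longrightarrow> (\<forall>x. dbound (T k) x j (c * (2 ^ k) ^ (2 * CARD('n) + 1) * ((1/2) ^ k) ^ (\<mu> k - j)))" for j
  proof -
    obtain B where B: "B \<ge> 0" "\<And>i k x. i \<le> j \<Longrightarrow> dbound (cutoff k) x i (B * (2 ^ k) ^ CARD('n) * (2 ^ k) ^ i)"
      using dbound_cutoff[of j] by blast
    define a :: real where "a = 2 ^ Suc CARD('n) + 3"
    have a: "a \<ge> 0" by (simp add: a_def)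
    have "dbound (T k) x j (2 ^ j * (B * a) * (2 ^ k) ^ (2 * CARD('n) + 1) * ((1/2) ^ k) ^ (\<mu> k - j))"
      if k: "k \<ge> k0" and j: "j \<le> \<mu> k" for k x
    proof (cases "gap x > 3 * real CARD('n) * (1/2) ^ k")
      case True
      show ?thesis
        by (rule dbound_zero_open[OF open_gap_greater[of "3 * real CARD('n) * (1/2) ^ k"]])
          (use True B a cutoff_eq_0 in \<open>auto simp: T_def\<close>)
    next
      case False
      have "3 * real CARD('n) * (1/2) ^ k < 7/2 * real CARD('n) * (1/2) ^ k" by simp
      with False have x: "gap x < 7/2 * real CARD('n) * (1/2) ^ k" by linarith
      let ?h = "(1/2) ^ k :: real" and ?p = "2 ^ k :: real"
      have "dbound (T k) x j (2 ^ j * (B * a * ?p ^ (2 * CARD('n) + 1) * ?h ^ (\<mu> k - j)))"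
        unfolding T_def
      proof (rule dbound_mult[OF smooth_cutoff sE, where A = "\<lambda>i. B * ?p ^ CARD('n) * ?p ^ i"
            and B = "\<lambda>i. a * ?p ^ Suc CARD('n) * ?h ^ (\<mu> k - i)"])
        fix i assume i: "i \<le> j"
        show "dbound (cutoff k) x i (B * ?p ^ CARD('n) * ?p ^ i)" using B(2)[OF i] .
        show "dbound (E k) x i (a * ?p ^ Suc CARD('n) * ?h ^ (\<mu> k - i))"
          unfolding E_def a_def using i j k x \<mu> by (intro patch_increment_estimate) auto
        show "0 \<le> B * ?p ^ CARD('n) * ?p ^ i" using B(1) by simp
        have e: "\<mu> k - (j - i) = (\<mu> k - j) + i" using i j by simp
        have "B * ?p ^ CARD('n) * ?p ^ i * (a * ?p ^ Suc CARD('n) * ?h ^ (\<mu> k - (j - i)))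
           = B * a * (?p ^ CARD('n) * ?p ^ Suc CARD('n)) * ?h ^ (\<mu> k - j) * (?h * ?p) ^ i"
          unfolding e power_add power_mult_distrib by (simp only: mult_ac)
        also have "\<dots> = B * a * ?p ^ (2 * CARD('n) + 1) * ?h ^ (\<mu> k - j)"
          unfolding half_power_inverse power_add[symmetric] by (simp add: mult_2)
        finally show "B * ?p ^ CARD('n) * ?p ^ i * (a * ?p ^ Suc CARD('n) * ?h ^ (\<mu> k - (j - i)))
           \<le> B * a * ?p ^ (2 * CARD('n) + 1) * ?h ^ (\<mu> k - j)" by (rule eq_refl)
      qed
      then show ?thesis by (simp add: mult.assoc)
    qed
    then show ?thesis using B(1) a by (intro exI[of _ "2 ^ j * (B * a)"]) auto
  qed
  have decay: "(2 ^ k) ^ M * ((1/2) ^ k) ^ i \<le> (1/2 :: real) ^ k" if "Suc M \<le> i" for k M i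
  proof -
    have "((1/2 :: real) ^ k) ^ i \<le> ((1/2) ^ k) ^ Suc M" using that by (intro power_decreasing) (auto simp: power_le_one)
    then have "(2 ^ k) ^ M * ((1/2 :: real) ^ k) ^ i \<le> (2 ^ k) ^ M * ((1/2) ^ k) ^ Suc M" by (intro mult_left_mono) auto
    also have "\<dots> = ((1/2) ^ k * 2 ^ k) ^ M * (1/2) ^ k" by (simp only: power_mult_distrib power_Suc mult_ac)
    finally show ?thesis by (simp add: half_power_inverse)
  qed
  have Tsum: "\<exists>s. summable s \<and> (\<forall>k x. norm x \<le> R \<longrightarrow> dbound (T (k0 + k)) x j (s k))" for j R
  proof -
    obtain c where c: "c \<ge> 0" "\<And>k x. k \<ge> k0 \<Longrightarrow> j \<le> \<mu> k \<Longrightarrow>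
        dbound (T k) x j (c * (2 ^ k) ^ (2 * CARD('n) + 1) * ((1/2) ^ k) ^ (\<mu> k - j))" using Tbound[of j] by blast
    have "\<forall>\<^sub>F k in sequentially. \<forall>x. norm x \<le> R \<longrightarrow> dbound (T (k0 + k)) x j (c * (1/2) ^ k)"
    proof -
      have "\<forall>\<^sub>F k in sequentially. \<mu> (k + k0) \<ge> j + 2 * CARD('n) + 2"
        using \<mu>_ge[of "j + 2 * CARD('n) + 2"] by (rule sequentially_offset)
      then show ?thesis
      proof eventually_elim
        case (elim k)
        have "dbound (T (k0 + k)) x j (c * (2 ^ (k0 + k)) ^ (2 * CARD('n) + 1) * ((1/2) ^ (k0 + k)) ^ (\<mu> (k0 + k) - j))" for x
          using elim by (intro c) (auto simp: add.commute)
        moreover have "c * (2 ^ (k0 + k)) ^ (2 * CARD('n) + 1) * ((1/2) ^ (k0 + k)) ^ (\<mu> (k0 + k) - j) \<le> c * (1/2) ^ k"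
        proof -
          have "(2 ^ (k0 + k)) ^ (2 * CARD('n) + 1) * ((1/2) ^ (k0 + k)) ^ (\<mu> (k0 + k) - j) \<le> (1/2 :: real) ^ (k0 + k)"
            using elim by (intro decay) (simp add: add.commute)
          also have "\<dots> \<le> (1/2) ^ k" by (intro power_decreasing) auto
          finally show ?thesis using mult_left_mono[OF _ c(1)] by (fastforce simp: mult.assoc)
        qed
        ultimately show ?case using dbound_mono by blast
      qed
    qed
    moreover have "summable (\<lambda>k. c * (1/2 :: real) ^ k)" by (intro summable_mult summable_geometric) simp
    ultimately show ?thesis using eventually_bounded_imp_summable_bound[of "\<lambda>k. T (k0 + k)"] sT by blast
  qed
  define S where "S = (\<lambda>x. \<Sum>k. T (k0 + k) x)"
  define F where "F = (\<lambda>x. patch (\<mu> k0) k0 x + S x)"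
  have sS: "smooth S" and dS: "dform S x us = (\<Sum>k. dform (T (k0 + k)) x us)"
    and summS: "summable (\<lambda>k. dform (T (k0 + k)) x us)" for x us
    unfolding S_def using smooth_series[OF _ Tsum] dform_series[OF _ Tsum] summable_dform_series[OF _ Tsum] sT by auto
  have sF: "smooth F" unfolding F_def by (intro smooth_add smooth_patch sS)
  have dF: "dform F y us = dform (P m y) y us" if y: "y \<in> C" and us: "length us \<le> m" for y m us
  proof -
    let ?g = "\<lambda>k. dform (patch (\<mu> k) k) y us"
    have "dform (T k) y us = ?g (Suc k) - ?g k" for k
    proof -
      have "dform (T k) y us = dform (E k) y us"
        using gap_zero[OF y] cutoff_eq_1[of _ k]
        by (intro dform_cong_open[OF open_gap_less[of "real CARD('n) * (1/2) ^ k"]]) (auto simp: T_def)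
      then show ?thesis by (simp add: E_def dform_diff smooth_patch)
    qed
    then have "(\<lambda>k. ?g (k0 + Suc k) - ?g (k0 + k)) sums dform S y us"
      using summable_sums[OF summS, of y us] dS by simp
    then have "(\<lambda>n. \<Sum>k<n. ?g (k0 + Suc k) - ?g (k0 + k)) \<longlonglongrightarrow> dform S y us" unfolding sums_def .
    then have lim: "(\<lambda>n. ?g (k0 + n) - ?g k0) \<longlonglongrightarrow> dform S y us"
      using sum_lessThan_telescope[of "\<lambda>k. ?g (k0 + k)"] by simp
    have "?g \<longlonglongrightarrow> dform (P m y) y us"
    proof -
      have "\<forall>\<^sub>F k in sequentially. norm (?g k - dform (P m y) y us) \<le> (1/2) ^ k * norm_prod us"
        using \<mu>_ge[of "m + CARD('n) + 2"] eventually_ge_at_top[of k0]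
      proof eventually_elim
        case (elim k)
        have "dbound (\<lambda>z. patch (\<mu> k) k z - P (\<mu> k) (proj y) z) y (length us) ((2 ^ k) ^ Suc CARD('n) * ((1/2) ^ k) ^ (\<mu> k - length us))"
          using \<mu>(2)[OF elim(2)] gap_zero[OF y] elim us unfolding tame_def by auto
        moreover have "(2 ^ k) ^ Suc CARD('n) * ((1/2) ^ k) ^ (\<mu> k - length us) \<le> (1/2 :: real) ^ k"
          using elim us by (intro decay) auto
        moreover have "proj y = y" using y by (rule closest_point_self)
        ultimately have "dbound (\<lambda>z. patch (\<mu> k) k z - P (\<mu> k) y z) y (length us) ((1/2) ^ k)"
          using dbound_mono by auto
        from dboundD[OF this] have "\<bar>?g k - dform (P (\<mu> k) y) y us\<bar> \<le> (1/2) ^ k * norm_prod us"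
          by (simp add: dform_diff smooth_patch jet_simps y)
        moreover have "dform (P (\<mu> k) y) y us = dform (P m y) y us"
          using elim us by (intro jet_simps(2)[symmetric] y) auto
        ultimately show ?case by simp
      qed
      moreover have "(\<lambda>k. (1/2) ^ k * norm_prod us) \<longlonglongrightarrow> 0"
        by (intro tendsto_mult_left_zero LIMSEQ_power_zero) simp
      ultimately have "(\<lambda>k. ?g k - dform (P m y) y us) \<longlonglongrightarrow> 0" by (rule Lim_null_comparison)
      then show ?thesis by (rule LIM_zero_cancel)
    qed
    then have "(\<lambda>n. ?g (n + k0) - ?g k0) \<longlonglongrightarrow> dform (P m y) y us - ?g k0"
      by (intro tendsto_intros LIMSEQ_ignore_initial_segment)
    then have "(\<lambda>n. ?g (k0 + n) - ?g k0) \<longlonglongrightarrow> dform (P m y) y us - ?g k0"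
      unfolding add.commute[of k0] .
    from LIMSEQ_unique[OF lim this] show ?thesis by (simp add: F_def dform_add smooth_patch sS)
  qed
  obtain R where R: "\<And>x. norm x \<le> R + gap x" using radius_exists by blast
  have "F x = 0" if "norm x > R + 9 * real CARD('n)" for x
  proof -
    have gx: "gap x > 9 * real CARD('n)" using R[of x] that by linarith
    have le: "r * real CARD('n) * (1/2) ^ k \<le> r * real CARD('n)" if "r \<ge> 0" for r and k :: nat
      using that by (simp add: mult_left_le power_le_one)
    have "patch m k x = 0" for m k using gx le[of 9 k] by (intro patch_support) linarith
    moreover have "T k x = 0" for k
    proof -
      have "3 * real CARD('n) * (1/2) ^ k < gap x" using gx le[of 3 k] of_nat_0_le_iff[of "CARD('n)", where 'a=real] by linarith
      then show ?thesis using cutoff_eq_0 by (simp add: T_def)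
    qed
    ultimately show ?thesis by (simp add: F_def S_def)
  qed
  then show ?thesis using sF dF by blast
qed

end

section \<open>A convex function that is flat on the set and strictly convex off it\<close>

text \<open>
  The square makes the second derivative bounded below away from \<open>0\<close> and only lets the function grow
  quadratically, so that rescaling by \<open>2^k\<close> costs a fixed power of \<open>2^k\<close>.
\<close>
definition ramp :: "real \<Rightarrow> real" where
  "ramp t = t\<^sup>2 * flat 1 t"

definition ramp' :: "real \<Rightarrow> real" where
  "ramp' t = (2 * t + 1) * flat 1 t"

lemma ramp_derivatives:
  "(ramp has_real_derivative ramp' t) (at t)"
  "(ramp' has_real_derivative flat [:2, 2, 1:] t) (at t)"
proof -
  have F: "(flat 1 has_real_derivative flat [:0, 0, 1:] t) (at t)"
    using flat_has_derivative[of 1 t] by (simp add: flat_step_def)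
  show "(ramp has_real_derivative ramp' t) (at t)"
    unfolding ramp_def[abs_def]
    by (rule derivative_eq_intros F refl)+ (auto simp: ramp'_def flat_def power2_eq_square field_simps)
  show "(ramp' has_real_derivative flat [:2, 2, 1:] t) (at t)"
    unfolding ramp'_def[abs_def]
    by (rule derivative_eq_intros F refl)+ (auto simp: flat_def power2_eq_square field_simps)
qed

lemma smooth_ramp': "smooth ramp'"
  and dform_ramp': "dform ramp' t (us @ [u]) = u * dform (flat [:2, 2, 1:]) t us"
  using smooth_primitive[OF ramp_derivatives(2) smooth_flat] by auto

lemma smooth_ramp: "smooth ramp"
  and dform_ramp: "dform ramp t (us @ [u]) = u * dform ramp' t us"
  using smooth_primitive[OF ramp_derivatives(1) smooth_ramp'] by auto

lemma dform2_ramp: "dform ramp t [a, b] = a * b * flat [:2, 2, 1:] t"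
  using dform_ramp[of t "[a]" b] dform_ramp'[of t "[]" a] by (simp add: dform_flat)

lemma dform_ramp_nonpos:
  assumes "t \<le> 0" shows "dform ramp t us = 0"
proof (cases us rule: rev_cases)
  case Nil
  then show ?thesis using assms by (simp add: ramp_def flat_def)
next
  case (snoc vs u)
  have "dform ramp' t vs = 0"
  proof (cases vs rule: rev_cases)
    case Nil
    then show ?thesis using assms by (simp add: ramp'_def flat_def)
  next
    case (snoc ws w)
    then show ?thesis using assms by (simp only: dform_ramp' dform_flat) (simp add: flat_def)
  qed
  then show ?thesis unfolding snoc dform_ramp by simp
qed

lemma flat_second_nonneg: "flat [:2, 2, 1:] t \<ge> 0"
  by (auto simp: flat_def intro!: mult_nonneg_nonneg)

lemma flat_second_lower: "t \<ge> 1/2 \<Longrightarrow> flat [:2, 2, 1:] t \<ge> 2 * exp (- 2)"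
proof -
  assume t: "t \<ge> 1/2"
  then have "1 / t \<le> 2" by (simp add: field_simps)
  moreover have "2 \<le> poly [:2, 2, 1:] (1 / t)" using t by simp
  ultimately have "2 * exp (- 2) \<le> poly [:2, 2, 1:] (1 / t) * exp (- (1 / t))"
    by (intro mult_mono) auto
  then show ?thesis using t by (simp add: flat_def)
qed

text \<open>
  From order two on the derivatives are bounded; the factor \<open>(1 + |t|)^2\<close> accounts for orders zero
  and one.
\<close>
lemma dbound_ramp: "\<exists>B\<ge>0. \<forall>t. dbound ramp t j (B * (1 + \<bar>t\<bar>)\<^sup>2)"
proof -
  have prod: "\<bar>prod_list us\<bar> = norm_prod us" for us :: "real list"
    by (induction us) (auto simp: abs_mult)
  have sq: "(1 + \<bar>t\<bar>)\<^sup>2 \<ge> 1" for t :: real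
    by (simp add: one_le_power)
  obtain B1 where B1: "B1 \<ge> 0" "\<And>t. \<bar>flat 1 t\<bar> \<le> B1" using flat_bounded by blast
  consider "j = 0" | "j = 1" | i where "j = Suc (Suc i)" by (metis One_nat_def not0_implies_Suc)
  then show ?thesis
  proof cases
    case 1
    have "\<bar>ramp t\<bar> \<le> B1 * (1 + \<bar>t\<bar>)\<^sup>2" for t
    proof -
      have "t\<^sup>2 \<le> (1 + \<bar>t\<bar>)\<^sup>2" by (simp add: power2_eq_square algebra_simps abs_mult_self_eq)
      then show ?thesis
        unfolding ramp_def abs_mult using B1 by (subst mult.commute) (intro mult_mono, auto)
    qed
    then show ?thesis using 1 B1(1) by (auto simp: dbound_def intro!: exI[of _ B1])
  next
    case 2
    have "\<bar>ramp' t\<bar> \<le> 2 * B1 * (1 + \<bar>t\<bar>)\<^sup>2" for t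
    proof -
      have "\<bar>2 * t + 1\<bar> \<le> 2 * (1 + \<bar>t\<bar>)" by (auto simp: abs_if)
      also have "\<dots> \<le> 2 * (1 + \<bar>t\<bar>)\<^sup>2" using power_increasing[of 1 2 "1 + \<bar>t\<bar>"] by simp
      finally show ?thesis
        unfolding ramp'_def abs_mult using mult_mono[OF _ B1(2)[of t]] B1(1) by (fastforce simp: mult_ac)
    qed
    then have "\<bar>dform ramp t us\<bar> \<le> 2 * B1 * (1 + \<bar>t\<bar>)\<^sup>2 * norm_prod us" if "length us = 1" for t us
    proof -
      obtain u where "us = [u]" using \<open>length us = 1\<close> by (auto simp: length_Suc_conv)
      then show ?thesis using dform_ramp[of t "[]" u] mult_right_mono[OF \<open>\<And>t. \<bar>ramp' t\<bar> \<le> 2 * B1 * (1 + \<bar>t\<bar>)\<^sup>2\<close>, of "\<bar>u\<bar>" t]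
        by (simp add: abs_mult mult_ac)
    qed
    then show ?thesis using 2 B1(1) by (auto simp: dbound_def intro!: exI[of _ "2 * B1"])
  next
    case (3 i)
    obtain B where B: "B \<ge> 0" "\<And>t. \<bar>flat ((flat_step ^^ i) [:2, 2, 1:]) t\<bar> \<le> B" using flat_bounded by blast
    have "\<bar>dform ramp t us\<bar> \<le> B * (1 + \<bar>t\<bar>)\<^sup>2 * norm_prod us" if len: "length us = Suc (Suc i)" for t us
    proof -
      obtain ws w where ws: "us = ws @ [w]" "length ws = Suc i" using len by (metis length_Suc_conv_rev)
      obtain vs v where vs: "ws = vs @ [v]" "length vs = i" using ws(2) by (metis length_Suc_conv_rev)
      have "dform ramp t us = prod_list us * flat ((flat_step ^^ i) [:2, 2, 1:]) t"
        unfolding ws(1) dform_ramp unfolding vs(1) dform_ramp' by (simp add: dform_flat vs(2))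
      then have "\<bar>dform ramp t us\<bar> \<le> norm_prod us * B"
        using B(2)[of t] by (simp add: abs_mult prod mult_left_mono norm_prod_nonneg)
      also have "\<dots> \<le> norm_prod us * (B * (1 + \<bar>t\<bar>)\<^sup>2)"
        using B(1) sq[of t] by (intro mult_left_mono norm_prod_nonneg) (auto simp: mult_le_cancel_left1)
      finally show ?thesis by (simp add: mult_ac)
    qed
    then show ?thesis using 3 B(1) by (auto simp: dbound_def intro!: exI[of _ B])
  qed
qed

lemma dform2_scale:
  assumes "smooth F" shows "dform F x [c *\<^sub>R u, c *\<^sub>R u] = c\<^sup>2 * dform F x [u, u]"
  using dform_scale_replicate[OF assms, of x "[]" 2 c u] by (simp add: numeral_2_eq_2)

text \<open>
  If the lattice point next to \<open>\<nu>\<close> is nearly orthogonal to \<open>v\<close>, then its neighbour along the largest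
  coordinate of \<open>v\<close> is not.  So \<open>\<nu>\<close> can be approximated by lattice vectors that see a given
  direction \<open>v\<close>, even when \<open>v\<close> is orthogonal to \<open>\<nu>\<close>.
\<close>
lemma lattice_direction:
  fixes \<nu> v :: "real^'n"
  assumes s: "s > 0"
  obtains z where "norm (s *\<^sub>R lat z - \<nu>) \<le> 2 * real CARD('n) * s" "\<bar>(s *\<^sub>R lat z) \<bullet> v\<bar> \<ge> s * norm v / (2 * real CARD('n))"
proof -
  obtain z0 where "norm ((1 / s) *\<^sub>R \<nu> - lat z0) \<le> real CARD('n)" using lat_near by blast
  then have "norm (s *\<^sub>R lat z0 - \<nu>) \<le> real CARD('n) * s"
  proof -
    have "norm (s *\<^sub>R lat z0 - \<nu>) = s * norm ((1 / s) *\<^sub>R \<nu> - lat z0)"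
      using s norm_scaleR[of s "(1 / s) *\<^sub>R \<nu> - lat z0"] by (simp add: scaleR_diff_right norm_minus_commute)
    then show ?thesis using s \<open>norm ((1 / s) *\<^sub>R \<nu> - lat z0) \<le> real CARD('n)\<close> by (simp add: mult.commute)
  qed
  note z0 = this
  obtain i where i: "norm v \<le> real CARD('n) * \<bar>v $ i\<bar>"
  proof -
    let ?g = "\<lambda>k. \<bar>v $ k\<bar>"
    have "Max (range ?g) \<in> range ?g" by (intro Max_in) auto
    then obtain i where "Max (range ?g) = ?g i" by blast
    then have "?g k \<le> ?g i" for k by (metis Max_ge finite finite_imageI rangeI)
    then show ?thesis using norm_le_card_cart[of v] that by blast
  qed
  define z1 where "z1 = z0(i := z0 i + 1)"
  have z1: "lat z1 = lat z0 + axis i 1" by (simp add: vec_eq_iff z1_def lat_def axis_def)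
  have n1: "real CARD('n) \<ge> 1" by (rule card_ge_1)
  have a: "norm (s *\<^sub>R lat z0 - \<nu>) \<le> 2 * real CARD('n) * s"
    using z0 mult_nonneg_nonneg[of "real CARD('n)" s] s by linarith
  have "norm (s *\<^sub>R lat z1 - \<nu>) \<le> norm (s *\<^sub>R lat z0 - \<nu>) + norm (s *\<^sub>R axis i (1::real))"
    using norm_triangle_ineq[of "s *\<^sub>R lat z0 - \<nu>" "s *\<^sub>R axis i 1"] by (simp add: z1 algebra_simps)
  also have "norm (s *\<^sub>R axis i (1::real)) = s" using s by simp
  also have "norm (s *\<^sub>R lat z0 - \<nu>) + s \<le> 2 * real CARD('n) * s"
    using z0 mult_right_mono[OF n1, of s] s by linarith
  finally have b: "norm (s *\<^sub>R lat z1 - \<nu>) \<le> 2 * real CARD('n) * s" .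
  have d: "(s *\<^sub>R lat z1) \<bullet> v - (s *\<^sub>R lat z0) \<bullet> v = s * v $ i"
    by (simp add: z1 inner_add_left distrib_left inner_axis')
  have "s * norm v / (2 * real CARD('n)) \<le> s * \<bar>v $ i\<bar> / 2"
    using i s n1 by (simp add: field_simps)
  also have "s * \<bar>v $ i\<bar> / 2 \<le> max \<bar>(s *\<^sub>R lat z0) \<bullet> v\<bar> \<bar>(s *\<^sub>R lat z1) \<bullet> v\<bar>"
  proof -
    have "s * \<bar>v $ i\<bar> = \<bar>(s *\<^sub>R lat z1) \<bullet> v - (s *\<^sub>R lat z0) \<bullet> v\<bar>" unfolding d using s by (simp add: abs_mult)
    then show ?thesis by linarith
  qed
  finally show ?thesis using that[OF a] that[OF b] by (auto simp: max_def split: if_splits)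
qed

context convex_jet
begin

text \<open>
  A point of \<open>C\<close> where \<open>y \<bullet> w\<close> is maximal; the value of the support function at \<open>w\<close> is attained there.
\<close>
definition support_point :: "real^'n \<Rightarrow> real^'n" where
  "support_point w = (SOME c. c \<in> C \<and> (\<forall>y\<in>C. y \<bullet> w \<le> c \<bullet> w))"

lemma support_point: "support_point w \<in> C" "y \<in> C \<Longrightarrow> y \<bullet> w \<le> support_point w \<bullet> w"
proof -
  have "\<exists>c. c \<in> C \<and> (\<forall>y\<in>C. y \<bullet> w \<le> c \<bullet> w)"
    using continuous_attains_sup[OF compact nonempty continuous_on_inner[OF continuous_on_id continuous_on_const]] by blast
  from someI_ex[OF this] show "support_point w \<in> C" "y \<in> C \<Longrightarrow> y \<bullet> w \<le> support_point w \<bullet> w"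
    unfolding support_point_def by blast+
qed

text \<open>
  A convex function that vanishes on the supporting half-space of \<open>C\<close> with outer normal \<open>w\<close>.
\<close>
definition ridge :: "nat \<Rightarrow> real^'n \<Rightarrow> real^'n \<Rightarrow> real" where
  "ridge k w x = ramp (2 ^ k * (w \<bullet> x) + (- (2 ^ k * (w \<bullet> support_point w))))"

lemma ridge_linear: "bounded_linear (\<lambda>x. 2 ^ k * (w \<bullet> x))"
  by (intro bounded_linear_const_mult bounded_linear_inner_right)

lemma smooth_ridge: "smooth (ridge k w)"
  unfolding ridge_def by (rule smooth_affine[OF smooth_ramp ridge_linear])

lemma dform_ridge:
  "dform (ridge k w) x us = dform ramp (2 ^ k * (w \<bullet> (x - support_point w))) (map (\<lambda>u. 2 ^ k * (w \<bullet> u)) us)"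
  unfolding ridge_def dform_affine[OF smooth_ramp ridge_linear] by (simp add: inner_diff_right right_diff_distrib)

lemma dform_ridge_on_set: "y \<in> C \<Longrightarrow> dform (ridge k w) y us = 0"
  unfolding dform_ridge
  using support_point(2)[of y w] by (intro dform_ramp_nonpos) (simp add: inner_commute inner_diff_right mult_nonneg_nonpos)

lemma dform2_ridge: "dform (ridge k w) x [v, v] = (2 ^ k * (w \<bullet> v))\<^sup>2 * flat [:2, 2, 1:] (2 ^ k * (w \<bullet> (x - support_point w)))"
  by (simp add: dform_ridge dform2_ramp power2_eq_square)

lemma dform2_ridge_nonneg: "dform (ridge k w) x [v, v] \<ge> 0"
  unfolding dform2_ridge by (intro mult_nonneg_nonneg flat_second_nonneg) auto

lemma dbound_ridge:
  "\<exists>B\<ge>0. \<forall>k w x. norm w \<le> 2 \<longrightarrow> norm x \<le> R \<longrightarrow> dbound (ridge k w) x j (B * (2 ^ k) ^ (j + 2))"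
proof -
  obtain R0 where R0: "R0 \<ge> 0" "\<And>x. norm x \<le> R0 + gap x" using radius_exists by blast
  obtain B where B: "B \<ge> 0" "\<And>t. dbound ramp t j (B * (1 + \<bar>t\<bar>)\<^sup>2)" using dbound_ramp by blast
  define R1 where "R1 = \<bar>R\<bar> + R0"
  have "dbound (ridge k w) x j (B * (1 + 2 * R1)\<^sup>2 * 2 ^ j * (2 ^ k) ^ (j + 2))"
    if w: "norm w \<le> 2" and x: "norm x \<le> R" for k w x
  proof -
    let ?t = "2 ^ k * (w \<bullet> x) + (- (2 ^ k * (w \<bullet> support_point w)))" and ?p = "2 ^ k :: real"
    have "dbound (ridge k w) x j (B * (1 + \<bar>?t\<bar>)\<^sup>2 * (2 * ?p) ^ j)"
      unfolding ridge_def
    proof (rule dbound_affine[OF smooth_ramp ridge_linear _ _ B(2)])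
      fix u :: "real^'n"
      have "\<bar>w \<bullet> u\<bar> \<le> 2 * norm u" using Cauchy_Schwarz_ineq2[of w u] mult_right_mono[OF w norm_ge_zero[of u]] by linarith
      then show "norm (2 ^ k * (w \<bullet> u)) \<le> 2 * ?p * norm u" by (simp add: abs_mult)
    qed (use B in auto)
    note est = this
    have "1 + \<bar>?t\<bar> \<le> (1 + 2 * R1) * ?p"
    proof -
      have "norm (x - support_point w) \<le> R1"
        using norm_triangle_ineq4[of x "support_point w"] x R0(2)[of "support_point w"] gap_zero[OF support_point(1)[of w]]
        by (simp add: R1_def)
      then have "\<bar>w \<bullet> (x - support_point w)\<bar> \<le> 2 * R1"
        using Cauchy_Schwarz_ineq2[of w "x - support_point w"] mult_mono[OF w, of "norm (x - support_point w)" R1] by simp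
      then have "?p * \<bar>w \<bullet> (x - support_point w)\<bar> \<le> ?p * (2 * R1)" by (intro mult_left_mono) auto
      moreover have "?t = ?p * (w \<bullet> (x - support_point w))" by (simp add: inner_diff_right right_diff_distrib)
      then have "\<bar>?t\<bar> = ?p * \<bar>w \<bullet> (x - support_point w)\<bar>" by (simp add: abs_mult)
      moreover have "1 \<le> ?p" by simp
      ultimately have "1 + \<bar>?t\<bar> \<le> ?p + ?p * (2 * R1)" by linarith
      also have "\<dots> = (1 + 2 * R1) * ?p" by (simp add: algebra_simps)
      finally show ?thesis .
    qed
    then have "B * (1 + \<bar>?t\<bar>)\<^sup>2 * (2 * ?p) ^ j \<le> B * ((1 + 2 * R1) * ?p)\<^sup>2 * (2 * ?p) ^ j"
      using B(1) by (intro mult_right_mono mult_left_mono power_mono) auto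
    also have "\<dots> = B * (1 + 2 * R1)\<^sup>2 * 2 ^ j * ?p ^ (j + 2)"
      by (simp add: power_mult_distrib power_add power2_eq_square mult_ac)
    finally show ?thesis using est dbound_mono by blast
  qed
  then show ?thesis using B(1) by (intro exI[of _ "B * (1 + 2 * R1)\<^sup>2 * 2 ^ j"]) auto
qed

text \<open>
  The hyperplane through the nearest point of \<open>x\<close>, orthogonal to the direction towards \<open>x\<close>, separates
  \<open>C\<close> from \<open>x\<close>.
\<close>
lemma exterior_normal:
  assumes "gap x > 0" "y \<in> C"
  shows "(x - y) \<bullet> ((x - proj x) /\<^sub>R gap x) \<ge> gap x"
proof -
  have "(x - y) \<bullet> (x - proj x) = (x - proj x) \<bullet> (x - proj x) - (x - proj x) \<bullet> (y - proj x)"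
    by (simp add: inner_diff_left inner_diff_right inner_commute)
  moreover have "(x - proj x) \<bullet> (y - proj x) \<le> 0" using closest_point_dot[OF convex closed assms(2)] .
  ultimately have "(x - y) \<bullet> (x - proj x) \<ge> gap x * gap x"
    by (simp add: gap_def power2_norm_eq_inner flip: power2_eq_square)
  moreover have "(x - y) \<bullet> ((x - proj x) /\<^sub>R gap x) = (x - y) \<bullet> (x - proj x) / gap x"
    by (simp add: divide_inverse mult.commute)
  ultimately show ?thesis using assms(1) by (simp add: pos_le_divide_eq)
qed

text \<open>
  At scale \<open>k\<close> the ridges are taken over the vectors \<open>w\<close> of norm at most \<open>2\<close> in a lattice of mesh
  proportional to \<open>2^-k\<close>.  For a point at distance at least \<open>2^-k\<close> from \<open>C\<close> and a direction \<open>v\<close>, one of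
  them is so close to the exterior normal that its ridge has argument at least \<open>1/2\<close>, and has
  \<open>|w \<bullet> v|\<close> at least a multiple of \<open>2^-k |v|\<close>; the factor \<open>4^k\<close> from rescaling the ramp then makes
  its second derivative at least \<open>b |v|^2\<close>, with \<open>b\<close> independent of \<open>k\<close>.  All other costs are powers of
  \<open>2^k\<close>, which the rapid decay of the coefficients \<open>q k / b\<close> absorbs.
\<close>
theorem convexifier_exists:
  assumes q: "\<And>k. q k \<ge> 0" and rapid: "\<And>M. \<exists>A. \<forall>k. q k * (2 ^ k) ^ M \<le> A"
  shows "\<exists>\<phi>. smooth \<phi> \<and> (\<forall>x v. dform \<phi> x [v, v] \<ge> 0) \<and> (\<forall>y\<in>C. \<forall>us. dform \<phi> y us = 0) \<and>
     (\<forall>x k v. norm x \<le> R \<longrightarrow> gap x \<ge> (1/2) ^ k \<longrightarrow> dform \<phi> x [v, v] \<ge> q k * (norm v)\<^sup>2)"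
proof -
  obtain R0 where R0: "R0 \<ge> 0" "\<And>x. norm x \<le> R0 + gap x" using radius_exists by blast
  have n1: "real CARD('n) \<ge> 1" by (rule card_ge_1)
  define R1 where "R1 = \<bar>R\<bar> + R0 + 1"
  have R1: "R1 \<ge> 1" using R0(1) by (simp add: R1_def)
  \<comment> \<open>Chosen so that moving the normal by \<open>2n\<tau> 2^-k\<close> changes its pairing with a vector of norm at most
    \<open>R1\<close> by no more than \<open>2^-k / 2\<close>.\<close>
  define \<tau> where "\<tau> = 1 / (4 * real CARD('n) * R1)"
  have \<tau>: "\<tau> > 0" using n1 R1 by (simp add: \<tau>_def)
  have \<tau>R: "2 * real CARD('n) * \<tau> * R1 = 1/2" using n1 R1 by (simp add: \<tau>_def)
  have \<tau>1: "2 * real CARD('n) * \<tau> \<le> 1/2"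
  proof -
    have "2 * real CARD('n) * \<tau> * 1 \<le> 2 * real CARD('n) * \<tau> * R1"
      using R1 \<tau> by (intro mult_left_mono) auto
    then show ?thesis using \<tau>R by linarith
  qed
  define w where "w k z = (\<tau> * (1/2) ^ k) *\<^sub>R (lat z :: real^'n)" for k z
  define Z where "Z k = {z :: 'n \<Rightarrow> int. norm (lat z) \<le> 2 / \<tau> * 2 ^ k}" for k
  have Z_iff: "z \<in> Z k \<longleftrightarrow> norm (w k z) \<le> 2" for z k
    using \<tau> by (simp add: Z_def w_def power_divide field_simps)
  have finZ: "finite (Z k)" for k unfolding Z_def by (rule finite_lat)
  have cardZ: "real (card (Z k)) \<le> (4 / \<tau> + 1) ^ CARD('n) * (2 ^ k) ^ CARD('n)" for k
  proof -
    have "real (card (Z k)) \<le> (2 * (2 / \<tau> * 2 ^ k) + 1) ^ CARD('n)"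
      unfolding Z_def using \<tau> by (intro card_lat) auto
    also have "\<dots> \<le> ((4 / \<tau> + 1) * 2 ^ k) ^ CARD('n)"
      using \<tau> by (intro power_mono) (auto simp: algebra_simps)
    finally show ?thesis by (simp add: power_mult_distrib)
  qed
  define b where "b = (\<tau> / (2 * real CARD('n)))\<^sup>2 * (2 * exp (- 2))"
  have b: "b > 0" using \<tau> n1 by (simp add: b_def)
  define T where "T k = (\<lambda>x. (q k / b) * (\<Sum>z\<in>Z k. ridge k (w k z) x))" for k
  have sT: "smooth (T k)" for k unfolding T_def by (intro smooth_cmult smooth_sum smooth_ridge)
  have dT: "dform (T k) x us = (q k / b) * (\<Sum>z\<in>Z k. dform (ridge k (w k z)) x us)" for k x us
    unfolding T_def by (subst dform_cmult) (auto simp: dform_sum smooth_ridge intro!: smooth_sum)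
  have cb: "q k / b \<ge> 0" for k using q b by simp
  have T_nonneg: "dform (T k) x [v, v] \<ge> 0" for k x v
    unfolding dT by (intro mult_nonneg_nonneg cb sum_nonneg dform2_ridge_nonneg)
  have Tsum: "\<exists>s. summable s \<and> (\<forall>k x. norm x \<le> r \<longrightarrow> dbound (T k) x j (s k))" for j r
  proof -
    obtain B where B: "B \<ge> 0" "\<And>k w x. norm w \<le> 2 \<Longrightarrow> norm x \<le> r \<Longrightarrow> dbound (ridge k w) x j (B * (2 ^ k) ^ (j + 2))"
      using dbound_ridge[of r j] by blast
    obtain A where A: "\<And>k. q k * (2 ^ k) ^ (CARD('n) + j + 3) \<le> A" using rapid by blast
    define c where "c = (4 / \<tau> + 1) ^ CARD('n) * B / b"
    have c: "c \<ge> 0" using \<tau> B(1) b by (simp add: c_def)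
    have "dbound (T k) x j (c * A * (1/2) ^ k)" if x: "norm x \<le> r" for k x
    proof -
      let ?p = "2 ^ k :: real"
      have "dbound (T k) x j (\<bar>q k / b\<bar> * (\<Sum>z\<in>Z k. B * ?p ^ (j + 2)))"
        unfolding T_def using Z_iff x by (intro dbound_cmult dbound_sum smooth_sum smooth_ridge B(2)) auto
      moreover have "\<bar>q k / b\<bar> * (\<Sum>z\<in>Z k. B * ?p ^ (j + 2)) \<le> c * A * (1/2) ^ k"
      proof -
        have "\<bar>q k / b\<bar> * (\<Sum>z\<in>Z k. B * ?p ^ (j + 2)) = q k / b * (real (card (Z k)) * (B * ?p ^ (j + 2)))"
          unfolding abs_of_nonneg[OF cb] by simp
        also have "\<dots> \<le> q k / b * ((4 / \<tau> + 1) ^ CARD('n) * ?p ^ CARD('n) * (B * ?p ^ (j + 2)))"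
          using cardZ[of k] B(1) by (intro mult_left_mono[OF _ cb] mult_right_mono) auto
        also have "\<dots> = c * (q k * ?p ^ (CARD('n) + j + 2))"
          by (simp add: c_def power_add mult_ac)
        also have "\<dots> = c * ((q k * ?p ^ (CARD('n) + j + 3)) * (1/2) ^ k)"
        proof -
          have "?p ^ (CARD('n) + j + 3) * (1/2) ^ k = ?p ^ (CARD('n) + j + 2) * ((1/2) ^ k * ?p)"
            by (simp add: power_add numeral_3_eq_3 numeral_2_eq_2 mult_ac)
          then show ?thesis by (simp add: half_power_inverse mult.assoc)
        qed
        also have "\<dots> \<le> c * (A * (1/2) ^ k)"
          using A[of k] by (intro mult_left_mono[OF _ c] mult_right_mono) auto
        finally show ?thesis by simp
      qed
      ultimately show ?thesis using dbound_mono by blast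
    qed
    moreover have "summable (\<lambda>k. c * A * (1/2 :: real) ^ k)" by (intro summable_mult summable_geometric) simp
    ultimately show ?thesis by blast
  qed
  define \<phi> where "\<phi> = (\<lambda>x. \<Sum>k. T k x)"
  have s\<phi>: "smooth \<phi>" and d\<phi>: "dform \<phi> x us = (\<Sum>k. dform (T k) x us)"
    and summ: "summable (\<lambda>k. dform (T k) x us)" for x us
    unfolding \<phi>_def using smooth_series[OF sT Tsum] dform_series[OF sT Tsum] summable_dform_series[OF sT Tsum] by auto
  have ge: "dform (T k) x [v, v] \<le> dform \<phi> x [v, v]" for k x v
    using sum_le_suminf[OF summ, of "{k}" x "[v, v]"] T_nonneg by (simp add: d\<phi>)
  have lower: "q k * (norm v)\<^sup>2 \<le> dform (T k) x [v, v]" if x: "norm x \<le> R" and g: "gap x \<ge> (1/2) ^ k" for x k v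
  proof -
    let ?h = "(1/2) ^ k :: real"
    have h: "?h > 0" "?h \<le> 1" by (simp_all add: power_le_one)
    have gpos: "gap x > 0" using g h(1) by linarith
    define \<nu> where "\<nu> = (x - proj x) /\<^sub>R gap x"
    have \<nu>: "norm \<nu> = 1" using gpos by (simp add: \<nu>_def gap_def)
    have "\<tau> * ?h > 0" using \<tau> h by simp
    from lattice_direction[OF this, of \<nu> v] obtain z where
      "norm ((\<tau> * ?h) *\<^sub>R lat z - \<nu>) \<le> 2 * real CARD('n) * (\<tau> * ?h)"
      "\<bar>((\<tau> * ?h) *\<^sub>R lat z) \<bullet> v\<bar> \<ge> \<tau> * ?h * norm v / (2 * real CARD('n))" by blast
    then have z: "norm (w k z - \<nu>) \<le> 2 * real CARD('n) * \<tau> * ?h" "\<bar>w k z \<bullet> v\<bar> \<ge> \<tau> * ?h * norm v / (2 * real CARD('n))"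
      unfolding w_def by (simp_all only: mult.assoc)
    have wn: "norm (w k z - \<nu>) \<le> 1/2" using z(1) mult_mono[OF \<tau>1 h(2)] h by simp
    then have "norm (w k z) \<le> 2" using norm_triangle_sub[of "w k z" \<nu>] \<nu> by simp
    then have zZ: "z \<in> Z k" using Z_iff by simp
    let ?c = "support_point (w k z)"
    let ?t = "2 ^ k * (w k z \<bullet> (x - ?c))"
    have "(x - ?c) \<bullet> \<nu> \<ge> ?h" using exterior_normal[OF gpos support_point(1), of "w k z"] g by (simp add: \<nu>_def)
    moreover have "\<bar>(w k z - \<nu>) \<bullet> (x - ?c)\<bar> \<le> ?h / 2"
    proof -
      have "norm (x - ?c) \<le> R1"
        using norm_triangle_ineq4[of x ?c] x R0(2)[of ?c] gap_zero[OF support_point(1)[of "w k z"]] by (simp add: R1_def)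
      then have "norm (w k z - \<nu>) * norm (x - ?c) \<le> (2 * real CARD('n) * \<tau> * ?h) * R1"
        using z(1) by (intro mult_mono) (use \<tau> h in auto)
      also have "\<dots> = (2 * real CARD('n) * \<tau> * R1) * ?h" by (simp only: mult_ac)
      also have "\<dots> = ?h / 2" unfolding \<tau>R by simp
      finally show ?thesis using Cauchy_Schwarz_ineq2[of "w k z - \<nu>" "x - ?c"] by linarith
    qed
    moreover have "w k z \<bullet> (x - ?c) = (x - ?c) \<bullet> \<nu> + (w k z - \<nu>) \<bullet> (x - ?c)"
      by (simp add: inner_diff_left inner_diff_right inner_commute)
    ultimately have "w k z \<bullet> (x - ?c) \<ge> ?h / 2" by linarith
    then have "2 ^ k * (w k z \<bullet> (x - ?c)) \<ge> 2 ^ k * (?h / 2)" by (intro mult_left_mono) auto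
    moreover have "2 ^ k * (?h / 2) = 1/2" using half_power_inverse[of k] by (simp add: mult.commute)
    ultimately have t: "?t \<ge> 1/2" by (simp only:)
    have "b * (norm v)\<^sup>2 = (2 ^ k * (\<tau> * ?h * norm v / (2 * real CARD('n))))\<^sup>2 * (2 * exp (- 2))"
    proof -
      have "2 ^ k * (\<tau> * ?h * norm v / (2 * real CARD('n))) = (?h * 2 ^ k) * (\<tau> / (2 * real CARD('n)) * norm v)" by (simp add: mult_ac)
      also have "\<dots> = \<tau> / (2 * real CARD('n)) * norm v" unfolding half_power_inverse by simp
      finally show ?thesis unfolding b_def by (simp only: power_mult_distrib mult_ac)
    qed
    also have "\<dots> \<le> (2 ^ k * \<bar>w k z \<bullet> v\<bar>)\<^sup>2 * flat [:2, 2, 1:] ?t"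
      using z(2) flat_second_lower[OF t] \<tau> h by (intro mult_mono power_mono mult_left_mono) auto
    also have "\<dots> = dform (ridge k (w k z)) x [v, v]"
      unfolding dform2_ridge by (simp add: power_mult_distrib)
    also have "\<dots> \<le> (\<Sum>z\<in>Z k. dform (ridge k (w k z)) x [v, v])"
      using zZ finZ dform2_ridge_nonneg by (intro member_le_sum) auto
    finally have "q k / b * (b * (norm v)\<^sup>2) \<le> dform (T k) x [v, v]"
      unfolding dT by (intro mult_left_mono cb)
    then show ?thesis using b by simp
  qed
  have "dform \<phi> x [v, v] \<ge> 0" for x v
    using T_nonneg ge order_trans by blast
  moreover have "dform \<phi> y us = 0" if "y \<in> C" for y us
    unfolding d\<phi> dT using dform_ridge_on_set[OF that] by simp
  moreover have "q k * (norm v)\<^sup>2 \<le> dform \<phi> x [v, v]" if "norm x \<le> R" "gap x \<ge> (1/2) ^ k" for x k v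
    using lower[OF that] ge order_trans by blast
  ultimately show ?thesis using s\<phi> by blast
qed

end

section \<open>Sufficiency of the conditions\<close>

context convex_jet
begin

text \<open>
  From an interior point of \<open>C\<close> one could move inside \<open>C\<close> towards \<open>x\<close>.
\<close>
lemma proj_in_frontier:
  assumes "gap x > 0" shows "proj x \<in> frontier C"
proof (rule ccontr)
  assume "proj x \<notin> frontier C"
  then have "proj x \<in> interior C" using proj_in closure_subset by (auto simp: frontier_def)
  then obtain r where r: "r > 0" "ball (proj x) r \<subseteq> C" by (meson interior_subset mem_interior subset_trans)
  define s where "s = r / (2 * gap x)"
  have s: "s > 0" using r assms by (simp add: s_def)
  have "dist (proj x) (proj x + s *\<^sub>R (x - proj x)) = s * gap x"
    using s by (simp add: dist_norm gap_def)
  also have "\<dots> < r" using r assms by (simp add: s_def)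
  finally have "proj x + s *\<^sub>R (x - proj x) \<in> C" using r(2) by auto
  from closest_point_dot[OF convex closed this, of x] have "s * (gap x)\<^sup>2 \<le> 0"
    by (simp add: gap_def power2_norm_eq_inner)
  then show False using s assms by (simp add: mult_le_0_iff)
qed

text \<open>
  For \<open>k > 0\<close>, the defect \<open>q k\<close> is the supremum of \<open>0\<close> and of \<open>-D^2F(x)(v^2)\<close> over unit vectors \<open>v\<close> and
  points \<open>x\<close> at distance at most \<open>2 \<cdot> 2^-k\<close> from \<open>C\<close>.  It decays faster than every power of \<open>2^-k\<close> by \<open>(CW^m)\<close> at the
  nearest points, and a convex function correcting a defect of this kind leaves the jets on \<open>C\<close>
  unchanged.
\<close>
theorem convex_extension_exists:
  assumes CW: "\<And>m. m \<ge> 2 \<Longrightarrow> cond_CW P m (frontier C)"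
    and nonneg: "\<And>y v. y \<in> C \<Longrightarrow> dform (P 2 y) y [v, v] \<ge> 0"
  shows "has_convex_smooth_extension C f P"
proof -
  obtain F R where F: "smooth F" "\<And>x. norm x > R \<Longrightarrow> F x = 0"
    "\<And>y m us. y \<in> C \<Longrightarrow> length us \<le> m \<Longrightarrow> dform F y us = dform (P m y) y us"
    using whitney_extension by metis
  have bound: "\<exists>B\<ge>0. \<forall>x. dbound F x j B" for j
    using F(2) by (intro dbound_compact_support[OF F(1) compact_cball[of 0 R]]) auto
  obtain B2 where B2: "B2 \<ge> 0" "\<And>x. dbound F x 2 B2" using bound by blast
  have D2: "\<bar>dform F x [v, v]\<bar> \<le> B2" if "norm v = 1" for x v
    using dboundD[of F x "[v, v]" B2] B2(2) that by (simp add: numeral_2_eq_2)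
  have onC: "dform F y [v, v] \<ge> 0" if "y \<in> C" for y v
    using F(3)[OF that, of "[v, v]" 2] nonneg[OF that] by simp
  \<comment> \<open>Index \<open>0\<close> takes care of all points at distance at least \<open>1\<close> from \<open>C\<close>, however far.\<close>
  define near where "near k x \<longleftrightarrow> k = (0::nat) \<or> gap x \<le> 2 * (1/2) ^ k" for k x
  \<comment> \<open>Inserting \<open>0\<close> makes the supremum nonnegative and the set nonempty.\<close>
  define V where "V k = insert 0 {- dform F x [v, v] | x v. norm v = 1 \<and> near k x}" for k
  define q where "q k = Sup (V k)" for k
  have bdd: "bdd_above (V k)" for k
    unfolding bdd_above_def V_def using D2 B2(1) by (fastforce simp: abs_le_iff)
  have q0: "q k \<ge> 0" for k unfolding q_def by (rule cSup_upper[OF _ bdd]) (simp add: V_def)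
  have q: "- dform F x [v, v] \<le> q k" if "norm v = 1" "near k x" for x v k
    unfolding q_def by (rule cSup_upper[OF _ bdd]) (use that in \<open>auto simp: V_def\<close>)
  have q_le: "q k \<le> c" if "c \<ge> 0" "\<And>x v. norm v = 1 \<Longrightarrow> near k x \<Longrightarrow> - dform F x [v, v] \<le> c" for k c
    unfolding q_def by (rule cSup_least) (use that in \<open>auto simp: V_def\<close>)
  have rapid: "\<exists>A. \<forall>k. q k * (2 ^ k) ^ M \<le> A" for M
  proof -
    let ?m = "M + 2"
    obtain t0 where t0: "t0 > 0" "\<And>y v w t. y \<in> frontier C \<Longrightarrow> norm v = 1 \<Longrightarrow> norm w = 1 \<Longrightarrow> 0 < t \<Longrightarrow> t \<le> t0 \<Longrightarrow>
      (\<Sum>k = 2..?m. t ^ (k - 2) / fact (k - 2) * dform (P ?m y) y (replicate (k - 2) w @ [v, v])) \<ge> - 1 * t ^ (?m - 2)"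
      using CW[of ?m] unfolding cond_CW_def by (auto dest!: spec[of _ 1])
    obtain B where B: "B \<ge> 0" "\<And>x. dbound F x (Suc ?m) B" using bound by blast
    have "(\<lambda>k. 2 * (1/2 :: real) ^ k) \<longlonglongrightarrow> 2 * 0" by (intro tendsto_intros LIMSEQ_power_zero) auto
    then have "\<forall>\<^sub>F k in sequentially. 2 * (1/2 :: real) ^ k < min t0 1"
      using t0(1) by (intro order_tendstoD(2)) auto
    then obtain K0 where K0: "\<And>k. k \<ge> K0 \<Longrightarrow> 2 * (1/2 :: real) ^ k < min t0 1" unfolding eventually_sequentially by blast
    have late: "q k * (2 ^ k) ^ M \<le> (1 + B) * 2 ^ M" if k: "k \<ge> Suc K0" for k
    proof -
      let ?h = "(1/2) ^ k :: real"
      have h: "2 * ?h < min t0 1" "?h > 0" using K0 k by auto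
      have "q k \<le> (1 + B) * (2 * ?h) ^ M"
      proof (rule q_le)
        show "0 \<le> (1 + B) * (2 * ?h) ^ M" using B(1) by simp
        fix x v :: "real^'n" assume v: "norm v = 1" and x: "near k x"
        show "- dform F x [v, v] \<le> (1 + B) * (2 * ?h) ^ M"
        proof (cases "gap x = 0")
          case True
          then have "x \<in> C" using proj_in[of x] by (simp add: gap_def)
          then have "dform F x [v, v] \<ge> 0" by (rule onC)
          then show ?thesis using B(1) h by (smt (verit) mult_nonneg_nonneg zero_le_power)
        next
          case False
          define t where "t = gap x"
          define y where "y = proj x"
          define w where "w = (x - y) /\<^sub>R t"
          have t: "0 < t" "t \<le> 2 * ?h" using False gap_nonneg[of x] x k by (auto simp: t_def near_def)
          have t': "t \<le> t0" "t \<le> 1" using t h by auto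
          have y: "y \<in> frontier C" "y \<in> C" using proj_in_frontier[of x] t(1) proj_in by (auto simp: t_def y_def)
          have w: "norm w = 1" "x = y + t *\<^sub>R w" using t(1) by (auto simp: w_def t_def gap_def y_def)
          let ?sum = "\<Sum>k = 2..?m. t ^ (k - 2) / fact (k - 2) * dform F y (replicate (k - 2) w @ [v, v])"
          have r1: "\<bar>dform F (y + t *\<^sub>R w) [v, v] - ?sum\<bar> \<le> B * t ^ (?m - 1)"
            using t by (intro CW_sum_remainder F(1) B v w) auto
          have r2: "?sum = (\<Sum>k = 2..?m. t ^ (k - 2) / fact (k - 2) * dform (P ?m y) y (replicate (k - 2) w @ [v, v]))"
            by (intro sum.cong refl) (subst F(3)[OF y(2), of _ ?m], auto)
          have r3: "(\<Sum>k = 2..?m. t ^ (k - 2) / fact (k - 2) * dform (P ?m y) y (replicate (k - 2) w @ [v, v])) \<ge> - 1 * t ^ (?m - 2)"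
            by (rule t0(2)[OF y(1) v w(1) t(1) t'(1)])
          have e: "B * t ^ (?m - 1) = B * (t * t ^ M)" "- 1 * t ^ (?m - 2) = - (t ^ M)" by simp_all
          have "- dform F x [v, v] \<le> t ^ M + B * (t * t ^ M)"
            using r1 r2 r3 unfolding w(2)[symmetric] e by linarith
          also have "\<dots> \<le> t ^ M + B * t ^ M"
            using t t' B(1) by (intro add_left_mono mult_left_mono) (auto simp: mult_le_cancel_right1)
          also have "\<dots> \<le> (1 + B) * (2 * ?h) ^ M"
          proof -
            have "(1 + B) * t ^ M \<le> (1 + B) * (2 * ?h) ^ M"
              using t B(1) by (intro mult_left_mono power_mono) auto
            then show ?thesis by (simp add: distrib_right)
          qed
          finally show ?thesis .
        qed
      qed
      then have "q k * (2 ^ k) ^ M \<le> (1 + B) * (2 * ?h) ^ M * (2 ^ k) ^ M" by (intro mult_right_mono) auto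
      also have "\<dots> = (1 + B) * 2 ^ M * (?h * 2 ^ k) ^ M" by (simp only: power_mult_distrib mult_ac)
      finally show ?thesis by (simp add: half_power_inverse)
    qed
    have early: "q k * (2 ^ k) ^ M \<le> B2 * (2 ^ K0) ^ M" if "k \<le> K0" for k
    proof (rule mult_mono)
      show "q k \<le> B2" using D2 B2(1) by (intro q_le) (auto simp: abs_le_iff)
      show "(2 ^ k) ^ M \<le> ((2 ^ K0) ^ M :: real)" using that by (intro power_mono power_increasing) auto
    qed (use B2 in auto)
    have "q k * (2 ^ k) ^ M \<le> max ((1 + B) * 2 ^ M) (B2 * (2 ^ K0) ^ M)" for k
      using late[of k] early[of k] by (cases "k \<le> K0") auto
    then show ?thesis by blast
  qed
  obtain \<phi> where \<phi>: "smooth \<phi>" "\<And>x v. dform \<phi> x [v, v] \<ge> 0" "\<And>y us. y \<in> C \<Longrightarrow> dform \<phi> y us = 0"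
    "\<And>x k v. norm x \<le> R \<Longrightarrow> gap x \<ge> (1/2) ^ k \<Longrightarrow> dform \<phi> x [v, v] \<ge> q k * (norm v)\<^sup>2"
    using convexifier_exists[of q R, OF q0 rapid] by blast
  define G where "G = (\<lambda>x. F x + \<phi> x)"
  have sG: "smooth G" unfolding G_def by (intro smooth_add F \<phi>)
  have dG: "dform G x us = dform F x us + dform \<phi> x us" for x us
    unfolding G_def by (intro dform_add F \<phi>)
  have "dform G x [v, v] \<ge> 0" for x v
  proof -
    consider "norm x > R" | "x \<in> C" | "norm x \<le> R" "gap x > 0"
    proof (cases "gap x = 0")
      case True
      then have "x = proj x" by (simp add: gap_def)
      then have "x \<in> C" using proj_in[of x] by simp
      then show ?thesis using that by blast
    next
      case False
      then have "gap x > 0" using gap_nonneg[of x] by simp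
      then show ?thesis using that by (cases "norm x \<le> R") auto
    qed
    then show ?thesis
    proof cases
      case 1
      have "dform F x [v, v] = dform (\<lambda>_. 0) x [v, v]"
        using 1 F(2) by (intro dform_cong_open[of "{x. norm x > R}"] open_Collect_less continuous_intros) auto
      then show ?thesis using \<phi>(2)[of x v] by (simp add: dG dform_const)
    next
      case 2
      then show ?thesis using onC \<phi>(2) by (simp add: dG)
    next
      case 3
      \<comment> \<open>The shell of \<open>x\<close>: its distance to \<open>C\<close> is at least \<open>2^-k\<close> and, unless \<open>k = 0\<close>, less than \<open>2 \<cdot> 2^-k\<close>.\<close>
      define k where "k = (LEAST k. (1/2) ^ k \<le> gap x)"
      have ex: "\<exists>k. (1/2 :: real) ^ k \<le> gap x"
        using real_arch_pow_inv[OF 3(2), of "1/2"] by (auto intro: less_imp_le)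
      then have k: "(1/2) ^ k \<le> gap x" unfolding k_def by (rule LeastI_ex)
      have "near k x"
      proof (cases k)
        case (Suc i)
        then have "\<not> (1/2) ^ i \<le> gap x" using not_less_Least[of i "\<lambda>k. (1/2) ^ k \<le> gap x"] by (simp add: k_def)
        then show ?thesis using Suc by (simp add: near_def)
      qed (simp add: near_def)
      show ?thesis
      proof (cases "v = 0")
        case True
        then show ?thesis using linear_0[OF linear_dform_first[OF sG, of x "[0]"]] by simp
      next
        case False
        define u where "u = v /\<^sub>R norm v"
        have u: "norm u = 1" "v = norm v *\<^sub>R u" using False by (auto simp: u_def)
        have "dform F x [v, v] = (norm v)\<^sup>2 * dform F x [u, u]"
          using dform2_scale[OF F(1), of x "norm v" u] u(2) by simp
        moreover have "(norm v)\<^sup>2 * (- dform F x [u, u]) \<le> (norm v)\<^sup>2 * q k"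
          by (intro mult_left_mono q u \<open>near k x\<close>) auto
        moreover have "q k * (norm v)\<^sup>2 \<le> dform \<phi> x [v, v]" by (rule \<phi>(4)[OF 3(1) k])
        ultimately show ?thesis by (simp add: dG mult.commute)
      qed
    qed
  qed
  then have convG: "convex_on UNIV G" by (rule dform2_nonneg_imp_convex[OF sG])
  have jetG: "dform G y us = dform (P m y) y us" if "y \<in> C" "length us \<le> m" for y us m
    using F(3)[OF that] \<phi>(3)[OF that(1)] by (simp add: dG)
  have "taylor_poly m y G = P m y" if y: "y \<in> C" for m y
  proof -
    have "taylor_poly m y G = taylor_poly m y (P m y)"
      unfolding taylor_poly_def using jetG[OF y] by (intro ext sum.cong) auto
    also have "\<dots> = P m y"
      using jet_simps(3)[OF y] by (intro taylor_exact jet_simps y) auto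
    finally show ?thesis .
  qed
  moreover have "G y = f y" if "y \<in> C" for y
    using jetG[OF that, of "[]" 0] jet_value[OF compat that] by simp
  ultimately show ?thesis
    unfolding has_convex_smooth_extension_def
    using convG smooth_imp_class_C_infinity[OF sG] by blast
qed

end

text \<open>
  For \<open>m = 2\<close> the sum reduces to one term and the factor \<open>t^(m-2)\<close> to \<open>1\<close>, so \<open>\<epsilon>\<close> is arbitrary.
\<close>
lemma cond_CW_imp_dform2_nonneg:
  assumes CW: "cond_CW P 2 S" and y: "y \<in> S" and s: "smooth (P 2 y)"
  shows "dform (P 2 y) y [v, v] \<ge> 0"
proof -
  have unit: "dform (P 2 y) y [u, u] \<ge> 0" if u: "norm u = 1" for u
  proof (rule field_le_epsilon)
    fix e :: real assume e: "e > 0"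
    from CW[unfolded cond_CW_def, rule_format, OF e] obtain t where t: "t > 0"
      "\<And>y v w s. y \<in> S \<Longrightarrow> v \<in> sphere 0 1 \<Longrightarrow> w \<in> sphere 0 1 \<Longrightarrow> 0 < s \<and> s \<le> t \<Longrightarrow>
      - e * s ^ (2 - 2) \<le> (\<Sum>k = 2..2. s ^ (k - 2) / fact (k - 2) * dform (P 2 y) y (replicate (k - 2) w @ [v, v]))"
      by blast
    from t(2)[of y u u t] t(1) y u show "0 \<le> dform (P 2 y) y [u, u] + e" by simp
  qed
  show ?thesis
  proof (cases "v = 0")
    case True
    then show ?thesis using linear_0[OF linear_dform_first[OF s, of y "[0]"]] by simp
  next
    case False
    then show ?thesis
      using dform2_scale[OF s, of y "norm v" "v /\<^sub>R norm v"] unit[of "v /\<^sub>R norm v"] by simp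
  qed
qed

lemma cond_CW_subset: "cond_CW P m S \<Longrightarrow> T \<subseteq> S \<Longrightarrow> cond_CW P m T"
  unfolding cond_CW_def by (meson subsetD)

text \<open>
  Both equivalences rest on the same construction, which asks for \<open>(CW^m)\<close> on the frontier and for
  \<open>D^2P^2_y(y) \<ge> 0\<close> at every point of \<open>C\<close>.  At interior points the latter comes from \<open>(CW^2)\<close> on \<open>C\<close> in
  the first equivalence, and from the convexity of \<open>f\<close>, with which the extended jet agrees on \<open>C\<close>,
  in the second.
\<close>
theorem theorem1p3:
  fixes C :: "(real^'n) set" and f :: "real^'n \<Rightarrow> real"
    and P :: "nat \<Rightarrow> real^'n \<Rightarrow> real^'n \<Rightarrow> real"
  assumes "compact C" and "convex C"
    and "compatible_family C f P"
  shows "(has_convex_smooth_extension C f P \<longleftrightarrow> (\<forall>m\<ge>2. cond_W P m C \<and> cond_CW P m C)) \<and>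
         (interior C \<noteq> {} \<and> convex_on C f \<longrightarrow>
            (has_convex_smooth_extension C f P \<longleftrightarrow>
               (\<forall>m\<ge>2. cond_W P m C \<and> cond_CW P m (frontier C))))"
proof (cases "C = {}")
  case True
  have "has_convex_smooth_extension C f P"
    unfolding has_convex_smooth_extension_def True
    using smooth_imp_class_C_infinity[OF smooth_const[of 0]] by (intro exI[of _ "\<lambda>_. 0"]) (auto simp: convex_on_def)
  moreover have "cond_W P m C" for m
  proof -
    have "rho P m {} = (\<lambda>_. 0)" by (rule ext) (simp add: rho_def bot_ennreal)
    then show ?thesis unfolding cond_W_def True by auto
  qed
  moreover have "cond_CW P m C" for m
    unfolding cond_CW_def True by (simp add: exI[of _ 1])
  ultimately show ?thesis using True by simp
next
  case False
  have frontier: "frontier C \<subseteq> C" using assms(1) by (intro frontier_subset_closed compact_imp_closed)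
  have necessary: "cond_W P m C \<and> cond_CW P m S"
    if ext: "has_convex_smooth_extension C f P" and m: "m \<ge> 2" and S: "S \<subseteq> C" for m S
  proof -
    obtain F where F: "convex_on UNIV F" "smooth F" "\<And>m y. y \<in> C \<Longrightarrow> taylor_poly m y F = P m y"
      using ext class_C_infinity_imp_smooth unfolding has_convex_smooth_extension_def by blast
    show ?thesis
      using extension_imp_cond_W[OF assms(3) assms(1,2) F(2,3)]
        extension_imp_cond_CW[OF assms(3) assms(1) F(2,1,3) m S] by blast
  qed
  have sufficient: "has_convex_smooth_extension C f P"
    if W: "\<forall>m\<ge>2. cond_W P m C" and CW: "\<forall>m\<ge>2. cond_CW P m (frontier C)"
      and interior: "cond_CW P 2 C \<or> convex_on C f"
  proof -
    interpret convex_jet C f P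
      using assms False W by unfold_locales auto
    obtain F where F: "smooth F" "\<And>y m us. y \<in> C \<Longrightarrow> length us \<le> m \<Longrightarrow> dform F y us = dform (P m y) y us"
      using whitney_extension by metis
    have "dform (P 2 y) y [v, v] \<ge> 0" if y: "y \<in> C" for y v
    proof (cases "cond_CW P 2 C \<or> y \<in> frontier C")
      case True
      then show ?thesis using cond_CW_imp_dform2_nonneg y CW jet_smooth[OF assms(3) y] by blast
    next
      case False
      then have "convex_on C f" and yint: "y \<in> interior C"
        using interior y closure_subset by (auto simp: frontier_def)
      moreover have "F x = f x" if "x \<in> C" for x
        using F(2)[OF that, of "[]" 0] jet_value[OF assms(3) that] by simp
      ultimately have "dform F y [v, v] \<ge> 0" by (intro convex_imp_dform2_nonneg[OF F(1)])
      then show ?thesis using F(2)[OF y, of "[v, v]" 2] by simp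
    qed
    then show ?thesis using CW by (intro convex_extension_exists) auto
  qed
  show ?thesis
    using necessary[OF _ _ order_refl] necessary[OF _ _ frontier] sufficient cond_CW_subset[OF _ frontier] by blast
qed

end
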